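(* Let $T\ge 20$ be real and let $\mathcal{M}$ be a set of distinct integers $m\in(0,T]$, with $R=\#\mathcal{M}$. For each $m\in\mathcal{M}$ let $\varepsilon_m$ be a complex number of modulus at most $1$. Let $N$ be a positive integer and let $q_1,\ldots,q_N$ be real coefficients in $[0,1]$. Put $$M(s):=\sum_{m\in\mathcal{M}}\varepsilon_m m^{-s},\qquad Q(s):=\sum_{n\le N}q_n n^{-s},$$ $$\mathcal{I}(\mathcal{M},Q):=\int_0^T|M(it)Q(it)|^2\,dt,\qquad \mathcal{J}(\mathcal{M},Q):=\sum_{\substack{(m_1,m_2,n_1,n_2)\in\mathcal{M}^2\times\mathbb{N}^2\\ |\log(m_1n_1/m_2n_2)|\le 2\pi/T}}q_{n_1}q_{n_2}.$$ Then the following hold. (i) We have $\mathcal{I}(\mathcal{M},Q)\ll T\mathcal{J}(\mathcal{M},Q)$. Moreover, if $\varepsilon_m=1$ for every $m\in\mathcal{M}$ then $$\mathcal{I}(\mathcal{M},Q)\ll T\mathcal{J}(\mathcal{M},Q)\ll\mathcal{I}(\mathcal{M},Q).$$ (ii) Under the Lindelöf Hypothesis, for any $\eta>0$ and any $Q(s)=\sum_{n\le N}q_n n^{-s}$ with real coefficients $q_n\in[0,1]$, $$\mathcal{I}(\mathcal{M},Q)\ll_{\eta}N^2R^2+(NT)^{\eta}NRT.\qquad( * )$$ (iii) Unconditionally, for any $\eta>0$ and any $Q(s)=\sum_{n\le N}q_n n^{-s}$ with real coefficients $q_n\in[0,1]$, $$\mathcal{I}(\mathcal{M},Q)\ll_{\eta}N^2R^2+(NT)^{\eta}\{NRT+NR^{7/4}T^{3/4}\}.$$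 Moreover, the bound $( * )$ holds (unconditionally) when either $N\ge T^{2/3}$ or $R\le T^{1/3}$. (iv) If $k$ is a positive integer and $$Q(s)=\frac{1}{k!}\Big(\sum_{N^{1/k}/2<p\le N^{1/k}}p^{-s}\Big)^k,$$ with $p$ running over primes, then $$\mathcal{I}(\mathcal{M},Q)\ll_k N^2R^2+R^2T+NRT.$$
   Context: In the definition of $\mathcal{J}$, one takes $q_n=0$ for $n>N$. The implied constants are absolute in $\ll$, and depend only on the indicated parameter in $\ll_\eta$ and $\ll_k$; in particular they are uniform in $T,\mathcal{M},(\varepsilon_m),N,(q_n)$. The Lindelöf Hypothesis is the statement that $\zeta(\tfrac12+it)\ll_{\eta}(1+|t|)^{\eta}$ for all real $t$ and every fixed $\eta>0$. *)

theory Defs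
  imports "HOL-Complex_Analysis.Complex_Analysis" "HOL-Computational_Algebra.Primes"
begin

text \<open>
  The zeta function is the analytic continuation of its Dirichlet series. Only its values on the
  critical line are needed, so the continuation is taken to the half-plane \<open>Re s > 0\<close> with the
  pole at \<open>1\<close> removed. Outside this domain the value is \<open>0\<close> by convention, which makes the
  description unique; existence and uniqueness are \<open>ex1_zeta_continuation\<close> below.
\<close>

definition zeta_dom :: "complex set" where
  "zeta_dom = {s. 0 < Re s} - {1}"

definition zeta_continuation :: "(complex \<Rightarrow> complex) \<Rightarrow> bool" where
  "zeta_continuation f \<longleftrightarrow>
     f holomorphic_on zeta_dom \<and>
     (\<forall>s. 1 < Re s \<longrightarrow> (\<lambda>n. of_nat (Suc n) powr (- s)) sums f s) \<and>
     (\<forall>s. s \<notin> zeta_dom \<longrightarrow> f s = 0)"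

definition zeta :: "complex \<Rightarrow> complex" where
  "zeta = (THE f. zeta_continuation f)"

lemma open_zeta_dom: "open zeta_dom"
  unfolding zeta_dom_def by (intro open_Diff open_halfspace_Re_gt) auto

lemma connected_zeta_dom: "connected zeta_dom"
  unfolding zeta_dom_def
  by (intro connected_open_delete open_halfspace_Re_gt convex_connected convex_halfspace_Re_gt) auto

lemma zeta_continuation_unique:
  assumes f: "zeta_continuation f" and g: "zeta_continuation g"
  shows "f = g"
proof
  fix z
  show "f z = g z"
  proof (cases "z \<in> zeta_dom")
    case True
    show ?thesis
    proof (rule analytic_continuation_open[where s = "{s. 1 < Re s}" and s' = zeta_dom and f = f and g = g])
      have "2 \<in> {s. 1 < Re s}" by simp
      then show "{s. 1 < Re s} \<noteq> {}" by blast
      show "{s. 1 < Re s} \<subseteq> zeta_dom" by (auto simp: zeta_dom_def)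
      show "f w = g w" if "w \<in> {s. 1 < Re s}" for w
        using f g that sums_unique2 unfolding zeta_continuation_def by blast
    qed (use f g True open_zeta_dom connected_zeta_dom open_halfspace_Re_gt in
          \<open>auto simp: zeta_continuation_def\<close>)
  next
    case False
    with f g show ?thesis by (simp add: zeta_continuation_def)
  qed
qed

definition zeta_term :: "nat \<Rightarrow> complex \<Rightarrow> complex" where
  "zeta_term n s = of_nat (Suc n) powr (- s)
     - (of_nat (Suc (Suc n)) powr (1 - s) - of_nat (Suc n) powr (1 - s)) / (1 - s)"

lemma norm_zeta_term_le:
  assumes s: "s \<in> zeta_dom"
  shows "norm (zeta_term n s) \<le> norm s * real (Suc n) powr (- Re s - 1)"
proof -
  define f :: "nat \<Rightarrow> complex \<Rightarrow> complex" where
    "f i x = (if i = 0 then x powr (1 - s) / (1 - s) else if i = 1 then x powr (- s)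
              else - s * x powr (- s - 1))" for i x
  define a :: complex where "a = of_real (real (Suc n))"
  define b :: complex where "b = of_real (real (Suc (Suc n)))"
  have s1: "s \<noteq> 1" and s0: "Re s > 0" using s by (auto simp: zeta_dom_def)
  have seg: "\<exists>r. x = of_real r \<and> real (Suc n) \<le> r" if "x \<in> closed_segment a b" for x
    using that unfolding a_def b_def closed_segment_of_real
    by (auto simp: closed_segment_eq_real_ivl)
  have "norm (f 0 b - (\<Sum>i\<le>1. f i a * (b - a) ^ i / fact i))
        \<le> norm s * real (Suc n) powr (- Re s - 1) * norm (b - a) ^ Suc 1 / fact 1"
  proof (rule complex_Taylor[where S = "closed_segment a b"])
    fix i :: nat and x assume x: "x \<in> closed_segment a b" and i: "i \<le> 1"
    obtain r where r: "x = of_real r" "real (Suc n) \<le> r" using seg[OF x] by blast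
    have nx: "x \<notin> \<real>\<^sub>\<le>\<^sub>0" using r by (auto simp: complex_nonpos_Reals_iff)
    have "((\<lambda>x. x powr (1 - s) / (1 - s)) has_field_derivative (x powr (- s)))
            (at x within closed_segment a b)"
      using nx s1 by (auto intro!: derivative_eq_intros)
    moreover have "((\<lambda>x. x powr (- s)) has_field_derivative (- s * x powr (- s - 1)))
            (at x within closed_segment a b)"
      using nx s1 by (auto intro!: derivative_eq_intros)
    moreover have "f 0 = (\<lambda>x. x powr (1 - s) / (1 - s))" "f 1 = (\<lambda>x. x powr (- s))"
      by (auto simp: f_def)
    moreover have "f (Suc 1) = (\<lambda>x. - s * x powr (- s - 1))" by (auto simp: f_def)
    moreover have "i = 0 \<or> i = 1" using i by auto
    ultimately show "(f i has_field_derivative f (Suc i) x) (at x within closed_segment a b)"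
      by auto
  next
    fix x assume x: "x \<in> closed_segment a b"
    obtain r where r: "x = of_real r" "real (Suc n) \<le> r" using seg[OF x] by blast
    have "norm (x powr (- s - 1)) = r powr (- Re s - 1)"
      using r by (simp add: norm_powr_real_powr)
    also have "\<dots> \<le> real (Suc n) powr (- Re s - 1)"
      using r s0 by (intro powr_mono2') auto
    finally show "norm (f (Suc 1) x) \<le> norm s * real (Suc n) powr (- Re s - 1)"
      by (auto simp: f_def norm_mult intro: mult_left_mono)
  qed auto
  moreover have "b - a = 1" by (simp add: a_def b_def)
  moreover have "zeta_term n s = - (f 0 b - (\<Sum>i\<le>1. f i a * (b - a) ^ i / fact i))"
    using \<open>b - a = 1\<close> s1
    by (simp add: zeta_term_def f_def a_def b_def diff_divide_distrib)
  ultimately show ?thesis by (simp only: norm_minus_cancel) simp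
qed

lemma zeta_term_uniform_limit:
  assumes z: "z \<in> zeta_dom"
  shows "\<exists>d>0. cball z d \<subseteq> zeta_dom \<and>
           uniform_limit (cball z d) (\<lambda>n s. \<Sum>i<n. zeta_term i s) (\<lambda>s. \<Sum>i. zeta_term i s) sequentially"
proof -
  obtain e where e: "e > 0" "cball z e \<subseteq> zeta_dom"
    using open_zeta_dom z open_contains_cball by blast
  define d where "d = min e (Re z / 2)"
  have z0: "Re z > 0" using z by (auto simp: zeta_dom_def)
  have d: "d > 0" "cball z d \<subseteq> zeta_dom" using e z0 by (auto simp: d_def)
  have "uniform_limit (cball z d) (\<lambda>n s. \<Sum>i<n. zeta_term i s) (\<lambda>s. \<Sum>i. zeta_term i s) sequentially"
  proof (rule Weierstrass_m_test)
    fix n s assume s: "s \<in> cball z d"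
    have "\<bar>Re (z - s)\<bar> \<le> norm (z - s)" by (rule abs_Re_le_cmod)
    also have "\<dots> \<le> Re z / 2" using s by (simp add: dist_norm d_def)
    finally have "\<bar>Re z - Re s\<bar> \<le> Re z / 2" by simp
    then have 1: "Re s \<ge> Re z / 2" by linarith
    have "norm s \<le> norm z + norm (z - s)" by (metis norm_triangle_sub norm_minus_commute)
    with s have 2: "norm s \<le> norm z + d" by (simp add: dist_norm)
    have "norm (zeta_term n s) \<le> norm s * real (Suc n) powr (- Re s - 1)"
      using s d by (intro norm_zeta_term_le) auto
    also have "\<dots> \<le> (norm z + d) * real (Suc n) powr (- Re z / 2 - 1)"
      using 1 2 d by (intro mult_mono powr_mono add_nonneg_nonneg) auto
    finally show "norm (zeta_term n s) \<le> (norm z + d) * real (Suc n) powr (- Re z / 2 - 1)" .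
  next
    have "summable (\<lambda>n. real n powr (- Re z / 2 - 1))"
      using z0 summable_real_powr_iff[of "- Re z / 2 - 1"] by simp
    then have "summable (\<lambda>n. real (Suc n) powr (- Re z / 2 - 1))"
      by (subst summable_Suc_iff)
    then show "summable (\<lambda>n. (norm z + d) * real (Suc n) powr (- Re z / 2 - 1))"
      by (rule summable_mult)
  qed
  with d show ?thesis by blast
qed

lemma zeta_term_sums:
  assumes s: "1 < Re s"
  shows "(\<lambda>n. of_nat (Suc n) powr (- s)) sums ((\<Sum>i. zeta_term i s) + 1 / (s - 1))"
proof -
  have sd: "s \<in> zeta_dom" and s1: "s \<noteq> 1" using s by (auto simp: zeta_dom_def)
  obtain d where "d > 0" "uniform_limit (cball s d) (\<lambda>n s. \<Sum>i<n. zeta_term i s)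
                    (\<lambda>s. \<Sum>i. zeta_term i s) sequentially"
    using zeta_term_uniform_limit[OF sd] by blast
  then have "(\<lambda>n. \<Sum>i<n. zeta_term i s) \<longlonglongrightarrow> (\<Sum>i. zeta_term i s)"
    by (intro tendsto_uniform_limitI[where S = "cball s d"]) auto
  then have 1: "(\<lambda>i. zeta_term i s) sums (\<Sum>i. zeta_term i s)" by (simp add: sums_def)
  have "(\<lambda>n. of_nat (Suc n) powr (1 - s)) \<longlonglongrightarrow> 0"
  proof (rule tendsto_norm_zero_cancel)
    have "(\<lambda>n. real (Suc n) powr (1 - Re s)) \<longlonglongrightarrow> 0"
      using s by (intro tendsto_neg_powr filterlim_compose[OF filterlim_real_sequentially]
                        filterlim_Suc) auto
    moreover have "norm (of_nat (Suc n) powr (1 - s)) = real (Suc n) powr (1 - Re s)" for n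
      by (subst norm_powr_real_powr) auto
    ultimately show "(\<lambda>n. norm (of_nat (Suc n) powr (1 - s))) \<longlonglongrightarrow> 0" by simp
  qed
  then have "(\<lambda>n. of_nat (Suc (Suc n)) powr (1 - s) - of_nat (Suc n) powr (1 - s))
               sums (0 - of_nat (Suc 0) powr (1 - s))"
    by (rule telescope_sums)
  then have "(\<lambda>n. (of_nat (Suc (Suc n)) powr (1 - s) - of_nat (Suc n) powr (1 - s)) / (1 - s))
               sums ((0 - 1) / (1 - s))"
    by (intro sums_divide) simp
  from sums_add[OF 1 this]
  have "(\<lambda>n. of_nat (Suc n) powr (- s)) sums ((\<Sum>i. zeta_term i s) + (0 - 1) / (1 - s))"
    by (simp add: zeta_term_def)
  moreover have "(0 - 1) / (1 - s) = 1 / (s - 1)" using s1 by (simp add: field_simps)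
  ultimately show ?thesis by (simp only:)
qed

lemma ex1_zeta_continuation: "\<exists>!f. zeta_continuation f"
proof (rule ex_ex1I)
  define F where "F s = (if s \<in> zeta_dom then (\<Sum>i. zeta_term i s) + 1 / (s - 1) else 0)" for s
  have "(\<lambda>s. \<Sum>i. zeta_term i s) holomorphic_on zeta_dom"
  proof (rule holomorphic_uniform_sequence[OF open_zeta_dom])
    show "(\<lambda>s. \<Sum>i<n. zeta_term i s) holomorphic_on zeta_dom" for n
      unfolding zeta_term_def
      by (intro holomorphic_intros) (auto simp: zeta_dom_def)
    show "\<exists>d. 0 < d \<and> cball x d \<subseteq> zeta_dom \<and>
            uniform_limit (cball x d) (\<lambda>n s. \<Sum>i<n. zeta_term i s)
              (\<lambda>s. \<Sum>i. zeta_term i s) sequentially" if "x \<in> zeta_dom" for x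
      using zeta_term_uniform_limit[OF that] .
  qed
  then have "(\<lambda>s. (\<Sum>i. zeta_term i s) + 1 / (s - 1)) holomorphic_on zeta_dom"
    by (intro holomorphic_intros) (auto simp: zeta_dom_def)
  then have "F holomorphic_on zeta_dom"
    by (rule holomorphic_transform) (simp add: F_def)
  moreover have "(\<lambda>n. of_nat (Suc n) powr (- s)) sums F s" if "1 < Re s" for s
    using zeta_term_sums[OF that] that by (auto simp: F_def zeta_dom_def)
  ultimately show "\<exists>f. zeta_continuation f"
    by (intro exI[of _ F]) (auto simp: zeta_continuation_def F_def)
qed (rule zeta_continuation_unique)

lemma zeta_continuation_zeta: "zeta_continuation zeta"
  unfolding zeta_def by (rule theI'[OF ex1_zeta_continuation])

definition lindelof_hypothesis :: bool where
  "lindelof_hypothesis \<longleftrightarrow>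
     (\<forall>\<eta>>0. \<exists>C. \<forall>t::real. norm (zeta (1 / 2 + \<i> * of_real t)) \<le> C * (1 + \<bar>t\<bar>) powr \<eta>)"

definition admissible_set :: "real \<Rightarrow> nat set \<Rightarrow> (nat \<Rightarrow> complex) \<Rightarrow> bool" where
  "admissible_set T M \<epsilon> \<longleftrightarrow>
     20 \<le> T \<and> (\<forall>m\<in>M. 0 < m \<and> real m \<le> T) \<and> (\<forall>m\<in>M. norm (\<epsilon> m) \<le> 1)"

definition admissible_coeffs :: "nat \<Rightarrow> (nat \<Rightarrow> real) \<Rightarrow> bool" where
  "admissible_coeffs N q \<longleftrightarrow> 0 < N \<and> (\<forall>n\<in>{1..N}. 0 \<le> q n \<and> q n \<le> 1)"

definition dirichlet_poly :: "nat set \<Rightarrow> (nat \<Rightarrow> complex) \<Rightarrow> complex \<Rightarrow> complex" where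
  "dirichlet_poly A a s = (\<Sum>n\<in>A. a n * of_nat n powr (- s))"

definition Qpoly :: "nat \<Rightarrow> (nat \<Rightarrow> real) \<Rightarrow> complex \<Rightarrow> complex" where
  "Qpoly N q = dirichlet_poly {1..N} (\<lambda>n. of_real (q n))"

definition prime_Qpoly :: "nat \<Rightarrow> nat \<Rightarrow> complex \<Rightarrow> complex" where
  "prime_Qpoly N k s =
     1 / fact k *
     dirichlet_poly {p. prime p \<and> real N powr (1 / real k) / 2 < real p \<and>
                        real p \<le> real N powr (1 / real k)} (\<lambda>_. 1) s ^ k"

definition mean_I :: "real \<Rightarrow> nat set \<Rightarrow> (nat \<Rightarrow> complex) \<Rightarrow> (complex \<Rightarrow> complex) \<Rightarrow> real" where
  "mean_I T M \<epsilon> Q =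
     integral {0..T} (\<lambda>t. (norm (dirichlet_poly M \<epsilon> (\<i> * of_real t) * Q (\<i> * of_real t)))\<^sup>2)"

text \<open>
  The coefficients vanish beyond \<open>N\<close>, so the sum over pairs of positive integers
  \<open>n1, n2\<close> is the finite sum over \<open>{1..N}\<close>; values of \<open>q\<close> outside \<open>{1..N}\<close> are irrelevant.
\<close>

definition count_J :: "real \<Rightarrow> nat set \<Rightarrow> nat \<Rightarrow> (nat \<Rightarrow> real) \<Rightarrow> real" where
  "count_J T M N q =
     (\<Sum>(m1, m2, n1, n2) \<in> {(m1, m2, n1, n2) \<in> M \<times> M \<times> {1..N} \<times> {1..N}.
         \<bar>ln (real (m1 * n1) / real (m2 * n2))\<bar> \<le> 2 * pi / T}. q n1 * q n2)"

end

theory Submission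
  imports Defs "HOL-Probability.Characteristic_Functions" "HOL-Real_Asymp.Real_Asymp"
begin

text \<open>
  Every part is a statement about counting. For an exponential sum
  \<open>F(t) = \<Sum>x. c x * exp (- \<i> * l x * t)\<close> with \<open>|c x| \<le> b x\<close>, the mean square over \<open>[0, T]\<close> is
  at most a constant times \<open>T\<close> times the weighted number of pairs of frequencies within
  \<open>2 * pi / T\<close> of each other (\<open>mean_square_le_energy\<close>), and when \<open>c = b \<ge> 0\<close> it is also at
  least that (\<open>energy_le_mean_square\<close>). Both come from integrating \<open>|F(t)|\<^sup>2 + |F(-t)|\<^sup>2\<close> against a
  triangular weight, whose cosine transform is nonnegative and explicit. With frequencies
  \<open>ln (m * n)\<close> this is part (i). It also shows that in the other parts only the size of the
  coefficients matters: all \<open>\<epsilon> m\<close> can be taken to be \<open>1\<close> and the \<open>q n\<close> can be replaced by any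
  majorant.

  For part (iii) let \<open>E(N)\<close> be the number of quadruples with \<open>m1 * n1\<close> and \<open>m2 * n2\<close> close and
  \<open>n1, n2 \<le> N\<close>, and let \<open>R\<close> be the number of elements of \<open>M\<close>. Write \<open>n1 / n2\<close> in lowest terms.
  The logarithms of distinct fractions with terms up to \<open>Y\<close> differ by at least \<open>1 / Y\<^sup>2\<close>, so each pair
  \<open>(m1, m2)\<close> admits few reduced fractions; grouping by \<open>g = gcd n1 n2\<close> and treating the large
  \<open>g\<close> as solutions in the range \<open>Y < B\<close> bounds \<open>E(N)\<close> in terms of
  \<open>F = max {E(Y) / Y | Y \<le> B}\<close> (\<open>pair_count_step\<close>). To bound \<open>F\<close>, square the Dirichlet polynomial
  \<open>Q\<close> over \<open>n \<le> Y\<close>: from \<open>|Q|\<^sup>2 \<le> \<mu> + |Q|\<^sup>4 / \<mu>\<close> and the divisor bound for the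
  coefficients of \<open>Q\<^sup>2\<close>, one gets
  \<open>E(Y) \<le> C * (\<mu> * R + D\<^sup>2 * E(Y\<^sup>2) / \<mu>)\<close>. Feeding \<open>E(Y\<^sup>2)\<close> back into the
  first estimate makes \<open>F\<close> reappear on the right, and for \<open>\<mu>\<close> large enough it does so with a small
  factor and is absorbed. The general bound of part (iii) is the choice
  \<open>B = (R * T) powr (1/4)\<close> of the cut, and the sharper one for large \<open>N\<close> is \<open>B = T powr (1/3)\<close>.

  For part (iv) the same reduction to lowest terms is used for products of \<open>k\<close> primes. A common
  factor of the two products is one of the primes, and removing it leaves the problem for
  \<open>k - 1\<close>, which costs a factor \<open>N powr (1/k)\<close>. The elementary inequality
  \<open>v * u ^ (k - 1) \<le> u ^ k + v ^ k\<close> turns this loss into a small multiple of the original mean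
  value plus \<open>N\<close> times the mean square of \<open>M\<close> alone.

  For part (ii) the majorant of the coefficients \<open>1\<close> is a sum of bumps
  \<open>sqrt (V / n) * exp (- (ln (V / n))\<^sup>2 / 2)\<close>. By the Fourier transform of the Gaussian, such a
  bump sum at \<open>\<i> * t\<close> is a Gaussian average over \<open>u\<close> of partial sums of the series for zeta at
  \<open>1/2 + \<i> * (t + u)\<close>. On the critical line these partial sums are zeta, plus the pole term
  \<open>Y powr (1 - s) / (1 - s)\<close>, plus an error that vanishes as the length grows. The pole term averages
  to \<open>O(V * exp (- t\<^sup>2 / 2))\<close> and yields \<open>N\<^sup>2 * R\<^sup>2\<close>; the zeta values are controlled by the
  Lindelof Hypothesis and yield \<open>N * R * T\<close> up to a small power.
\<close>

section \<open>Exponential sums and close pairs of frequencies\<close>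

definition expsum :: "'a set \<Rightarrow> ('a \<Rightarrow> real) \<Rightarrow> ('a \<Rightarrow> complex) \<Rightarrow> real \<Rightarrow> complex" where
  "expsum A l c t = (\<Sum>x\<in>A. c x * cis (- (l x * t)))"

text \<open>
  The quantity that governs the mean square over an interval of length \<open>2 * pi / d\<close>: pairs of
  frequencies closer than \<open>d\<close> do not have room to oscillate against each other.
\<close>

definition energy :: "real \<Rightarrow> 'a set \<Rightarrow> ('a \<Rightarrow> real) \<Rightarrow> ('a \<Rightarrow> real) \<Rightarrow> real" where
  "energy d A l b = (\<Sum>x\<in>A. \<Sum>y\<in>A. if \<bar>l x - l y\<bar> \<le> d then b x * b y else 0)"

text \<open>
  The Fejer kernel of continuous frequency, normalised as the cosine transform of the triangle
  \<open>1 - \<bar>t\<bar> / U\<close> on \<open>[-U, U]\<close>.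
\<close>

definition fejer :: "real \<Rightarrow> real \<Rightarrow> real" where
  "fejer U L = (if L = 0 then U else (2 - 2 * cos (U * L)) / (U * L\<^sup>2))"

lemma continuous_on_expsum [continuous_intros]: "continuous_on S (\<lambda>t. expsum A l c t)"
  unfolding expsum_def by (intro continuous_intros)

lemma fejer_has_integral:
  assumes U: "U > 0"
  shows "((\<lambda>t. (1 - t / U) * (2 * cos (t * L))) has_integral fejer U L) {0..U}"
proof (cases "L = 0")
  case True
  have "((\<lambda>t. (1 - t / U) * (2 * cos (t * L))) has_integral (2 * U - U\<^sup>2 / U) - (2 * 0 - 0\<^sup>2 / U)) {0..U}"
    using U True
    by (intro fundamental_theorem_of_calculus)
       (auto intro!: derivative_eq_intros simp flip: has_real_derivative_iff_has_vector_derivative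
             simp: field_simps)
  then show ?thesis using U True by (simp add: fejer_def power2_eq_square)
next
  case False
  let ?G = "\<lambda>t. (1 - t / U) * (2 * sin (t * L)) / L - 2 * cos (t * L) / (U * L\<^sup>2)"
  have "((\<lambda>t. (1 - t / U) * (2 * cos (t * L))) has_integral ?G U - ?G 0) {0..U}"
    using U False
    by (intro fundamental_theorem_of_calculus)
       (auto intro!: derivative_eq_intros simp flip: has_real_derivative_iff_has_vector_derivative
             simp: field_simps power2_eq_square)
  then show ?thesis using U False by (simp add: fejer_def field_simps)
qed

lemma fejer_nonneg: "U > 0 \<Longrightarrow> fejer U L \<ge> 0"
  by (auto simp: fejer_def intro!: divide_nonneg_nonneg mult_nonneg_nonneg)

lemma one_minus_cos_le: "2 - 2 * cos (x::real) \<le> x\<^sup>2"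
proof -
  have "cos x = 1 - 2 * sin (x/2)^2" using cos_double_sin[of "x/2"] by simp
  moreover have "sin (x/2)^2 \<le> (x/2)^2"
    using abs_sin_x_le_abs_x[of "x/2"] by (simp only: abs_le_square_iff)
  ultimately show ?thesis by (simp add: power2_eq_square)
qed

lemma fejer_le:
  assumes "U > 0"
  shows "fejer U L \<le> U"
proof (cases "L = 0")
  case False
  then have "U * L\<^sup>2 > 0" using assms by simp
  then show ?thesis using False one_minus_cos_le[of "U * L"]
    by (simp add: fejer_def pos_divide_le_eq power2_eq_square mult_ac)
qed (simp add: fejer_def)

lemma fejer_le_decay:
  assumes "U > 0" "L \<noteq> 0"
  shows "fejer U L \<le> 4 / (U * L\<^sup>2)"
proof -
  have "2 - 2 * cos (U * L) \<le> 4" using cos_ge_minus_one[of "U*L"] by linarith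
  then show ?thesis using assms by (auto simp: fejer_def intro!: divide_right_mono)
qed

text \<open>
  The kernel has not yet decayed when \<open>L\<close> is below \<open>1 / U\<close>; this is what makes close pairs visible
  in the mean square. A Taylor polynomial of the cosine suffices.
\<close>

lemma fejer_ge:
  assumes U: "U > 0" and L: "U * \<bar>L\<bar> \<le> 1"
  shows "fejer U L \<ge> U / 2"
proof (cases "L = 0")
  case True then show ?thesis using U by (simp add: fejer_def)
next
  case False
  define x where "x = U * L"
  have x: "x\<^sup>2 \<le> 1" using L U by (simp add: x_def abs_mult abs_square_le_1)
  have "cos x \<le> 1 - x\<^sup>2 / 4"
  proof -
    obtain t where "cos x = (\<Sum>m<4. cos_coeff m * x ^ m) + cos (t + 1/2 * real 4 * pi) / fact 4 * x ^ 4"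
      using Maclaurin_cos_expansion[of x 4] by blast
    moreover have "(\<Sum>m<4. cos_coeff m * x ^ m) = 1 - x\<^sup>2 / 2"
    proof -
      have "{..<4::nat} = {0, 1, 2, 3}" by auto
      then show ?thesis by (simp add: cos_coeff_def)
    qed
    moreover have "cos (t + 1/2 * real 4 * pi) / fact 4 * x ^ 4 \<le> 1 / fact 4 * x ^ 4"
      by (intro mult_right_mono divide_right_mono) auto
    moreover have "x ^ 4 \<le> x\<^sup>2"
    proof -
      have "x ^ 4 = x\<^sup>2 * x\<^sup>2" by (simp add: power2_eq_square numeral_eq_Suc)
      also have "\<dots> \<le> x\<^sup>2 * 1" using x by (intro mult_left_mono) auto
      finally show ?thesis by simp
    qed
    moreover have "1 / fact 4 * x ^ 4 = x ^ 4 / 24" by (simp add: fact_numeral)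
    moreover have "0 \<le> x\<^sup>2" by simp
    ultimately show ?thesis by linarith
  qed
  then have "x\<^sup>2 / 2 \<le> 2 - 2 * cos x" by linarith
  then have "x\<^sup>2 / 2 / (U * L\<^sup>2) \<le> (2 - 2 * cos x) / (U * L\<^sup>2)"
    using U by (intro divide_right_mono) auto
  moreover have "x\<^sup>2 / 2 / (U * L\<^sup>2) = U / 2" using U False
    by (simp add: x_def power2_eq_square)
  moreover have "fejer U L = (2 - 2 * cos x) / (U * L\<^sup>2)" using False by (simp add: fejer_def x_def)
  ultimately show ?thesis by linarith
qed

text \<open>
  Adding the value at \<open>- t\<close> cancels the sine parts. Keeping them would give a transform that decays
  like \<open>1 / L\<close> only, which is not summable over the pairs of frequencies.
\<close>

lemma norm_expsum_symm:
  "complex_of_real ((cmod (expsum A l c t))\<^sup>2 + (cmod (expsum A l c (- t)))\<^sup>2)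
     = (\<Sum>x\<in>A. \<Sum>y\<in>A. c x * cnj (c y) * of_real (2 * cos (t * (l x - l y))))"
proof -
  have sq: "complex_of_real ((cmod (expsum A l c t))\<^sup>2)
       = (\<Sum>x\<in>A. \<Sum>y\<in>A. c x * cnj (c y) * cis (- (t * (l x - l y))))" for t
    unfolding complex_norm_square expsum_def cnj_sum sum_product
    by (intro sum.cong refl) (simp add: cis_cnj cis_mult algebra_simps)
  have cs: "cis (- x) + cis x = of_real (2 * cos x)" for x by (simp add: complex_eq_iff)
  show ?thesis unfolding of_real_add sq
    by (simp add: sum.distrib[symmetric] cs distrib_left[symmetric] del: of_real_mult)
qed

lemma fejer_mean_expsum:
  assumes U: "U > 0"
  shows "((\<lambda>t. (1 - t / U) * ((cmod (expsum A l c t))\<^sup>2 + (cmod (expsum A l c (- t)))\<^sup>2)) has_integral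
     Re (\<Sum>x\<in>A. \<Sum>y\<in>A. c x * cnj (c y) * of_real (fejer U (l x - l y)))) {0..U}"
proof (cases "finite A")
  case False then show ?thesis by (simp add: expsum_def)
next
  case True
  have eq: "(1 - t / U) * ((cmod (expsum A l c t))\<^sup>2 + (cmod (expsum A l c (- t)))\<^sup>2)
     = (\<Sum>x\<in>A. \<Sum>y\<in>A. Re (c x * cnj (c y)) * ((1 - t / U) * (2 * cos (t * (l x - l y)))))" for t
  proof -
    have "(cmod (expsum A l c t))\<^sup>2 + (cmod (expsum A l c (- t)))\<^sup>2 =
      Re (\<Sum>x\<in>A. \<Sum>y\<in>A. c x * cnj (c y) * of_real (2 * cos (t * (l x - l y))))"
      by (simp only: norm_expsum_symm[symmetric] Re_complex_of_real)
    also have "\<dots> = (\<Sum>x\<in>A. \<Sum>y\<in>A. Re (c x * cnj (c y)) * (2 * cos (t * (l x - l y))))"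
      unfolding Re_sum by (intro sum.cong refl) (simp add: algebra_simps)
    finally show ?thesis by (simp only: sum_distrib_left mult.left_commute)
  qed
  have "((\<lambda>t. \<Sum>x\<in>A. \<Sum>y\<in>A. Re (c x * cnj (c y)) * ((1 - t / U) * (2 * cos (t * (l x - l y)))))
     has_integral (\<Sum>x\<in>A. \<Sum>y\<in>A. Re (c x * cnj (c y)) * fejer U (l x - l y))) {0..U}"
    by (intro has_integral_sum True has_integral_mult_right fejer_has_integral U)
  then show ?thesis unfolding eq by simp
qed

text \<open>
  The majorant \<open>5 - 4 / (n + 1)\<close> of the partial sum over \<open>[-n, n]\<close> telescopes fast enough to be
  proved by induction.
\<close>

lemma sum_inverse_square_le:
  fixes I :: "int set"
  assumes "finite I"
  shows "(\<Sum>j\<in>I. 1 / (1 + (real_of_int (i - j))\<^sup>2)) \<le> 5"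
proof -
  have 0: "(\<Sum>k\<in>{-int n..int n}. 1 / (1 + (real_of_int k)\<^sup>2)) \<le> 5 - 4 / (real n + 1)" for n
  proof (induction n)
    case (Suc n)
    have "{-int (Suc n)..int (Suc n)} = insert (- int (Suc n)) (insert (int (Suc n)) {-int n..int n})"
      by auto
    then have "(\<Sum>k\<in>{-int (Suc n)..int (Suc n)}. 1 / (1 + (real_of_int k)\<^sup>2)) =
       (\<Sum>k\<in>{-int n..int n}. 1 / (1 + (real_of_int k)\<^sup>2)) + 2 / (1 + (real n + 1)\<^sup>2)"
      by (simp add: power2_eq_square algebra_simps)
    moreover have "2 / (1 + (real n + 1)\<^sup>2) \<le> 4 / (real n + 1) - 4 / (real (Suc n) + 1)"
    proof -
      have "4 / (real n + 1) - 4 / (real (Suc n) + 1) = 4 / ((real n + 1) * (real n + 2))"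
        by (simp add: field_simps)
      moreover have "2 * ((real n + 1) * (real n + 2)) \<le> 4 * (1 + (real n + 1)\<^sup>2)"
        by (simp add: power2_eq_square algebra_simps)
      ultimately show ?thesis by (simp add: divide_simps power2_eq_square add_nonneg_eq_0_iff) (smt (verit) mult_nonneg_nonneg of_nat_0_le_iff)
    qed
    ultimately show ?case using Suc by linarith
  qed simp
  define J where "J = (\<lambda>j. i - j) ` I"
  have "finite J" using assms by (simp add: J_def)
  define n where "n = (\<Sum>j\<in>J. nat \<bar>j\<bar>)"
  have "J \<subseteq> {-int n..int n}"
  proof
    fix j assume "j \<in> J"
    then have "nat \<bar>j\<bar> \<le> n" unfolding n_def using \<open>finite J\<close> by (intro member_le_sum) auto
    then show "j \<in> {-int n..int n}" by auto
  qed
  have "(\<Sum>j\<in>I. 1 / (1 + (real_of_int (i - j))\<^sup>2)) = (\<Sum>k\<in>J. 1 / (1 + (real_of_int k)\<^sup>2))"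
    unfolding J_def by (subst sum.reindex) (auto simp: inj_on_def)
  also have "\<dots> \<le> (\<Sum>k\<in>{-int n..int n}. 1 / (1 + (real_of_int k)\<^sup>2))"
    using \<open>J \<subseteq> _\<close> by (intro sum_mono2) auto
  also have "\<dots> \<le> 5" using 0[of n] by (smt (verit) divide_nonneg_nonneg of_nat_0_le_iff)
  finally show ?thesis .
qed

lemma energy_nonneg: "(\<And>x. x \<in> A \<Longrightarrow> b x \<ge> 0) \<Longrightarrow> energy d A l b \<ge> 0"
  unfolding energy_def by (intro sum_nonneg) auto

text \<open>
  Sort the frequencies into buckets of width \<open>d\<close> and let \<open>S i\<close> be the total weight of bucket \<open>i\<close>.
  Since \<open>S i * S j \<le> ((S i)\<^sup>2 + (S j)\<^sup>2) / 2\<close>, a summable weight in \<open>i - j\<close> reduces the double sum to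
  the diagonal, and two members of one bucket are within \<open>d\<close>. Hence quadratic decay
  of a kernel away from the diagonal is enough for an upper bound by the energy.
\<close>

lemma bucket_sum_le_energy:
  fixes l b :: "'a \<Rightarrow> real"
  assumes A: "finite A" and d: "d > 0" and b: "\<And>x. x \<in> A \<Longrightarrow> b x \<ge> 0"
  defines "h \<equiv> (\<lambda>x. \<lfloor>l x / d\<rfloor>)"
  shows "(\<Sum>x\<in>A. \<Sum>y\<in>A. b x * b y * (1 / (1 + (real_of_int (h x - h y))\<^sup>2))) \<le> 5 * energy d A l b"
proof -
  define I where "I = h ` A"
  have I: "finite I" using A by (simp add: I_def)
  define S where "S i = (\<Sum>x\<in>{x\<in>A. h x = i}. b x)" for i
  define g where "g k = 1 / (1 + (real_of_int k)\<^sup>2)" for k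
  have g0: "g k \<ge> 0" for k by (simp add: g_def)
  have gs: "g (- k) = g k" for k by (simp add: g_def)
  have group: "(\<Sum>x\<in>A. f x) = (\<Sum>i\<in>I. \<Sum>x\<in>{x\<in>A. h x = i}. f x)" for f :: "'a \<Rightarrow> real"
    unfolding I_def by (rule sum.image_gen[OF A])
  have "(\<Sum>x\<in>A. \<Sum>y\<in>A. b x * b y * g (h x - h y)) = (\<Sum>i\<in>I. \<Sum>j\<in>I. S i * S j * g (i - j))"
  proof -
    have "(\<Sum>x\<in>A. \<Sum>y\<in>A. b x * b y * g (h x - h y)) =
       (\<Sum>i\<in>I. \<Sum>x\<in>{x\<in>A. h x = i}. \<Sum>j\<in>I. \<Sum>y\<in>{x\<in>A. h x = j}. b x * b y * g (h x - h y))"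
      by (subst group, subst group) simp
    also have "\<dots> = (\<Sum>i\<in>I. \<Sum>x\<in>{x\<in>A. h x = i}. \<Sum>j\<in>I. \<Sum>y\<in>{x\<in>A. h x = j}. b x * b y * g (i - j))"
      by (intro sum.cong refl) auto
    also have "\<dots> = (\<Sum>i\<in>I. \<Sum>j\<in>I. S i * S j * g (i - j))"
      unfolding S_def
    proof (intro sum.cong refl, subst sum.swap, intro sum.cong refl)
      fix i j
      show "(\<Sum>x\<in>{x\<in>A. h x = i}. \<Sum>y\<in>{x\<in>A. h x = j}. b x * b y * g (i - j)) =
         (\<Sum>x\<in>{x\<in>A. h x = i}. b x) * (\<Sum>x\<in>{x\<in>A. h x = j}. b x) * g (i - j)"
        by (subst sum_product) (simp only: sum_distrib_right)
    qed
    finally show ?thesis .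
  qed
  also have "\<dots> \<le> (\<Sum>i\<in>I. \<Sum>j\<in>I. (S i)\<^sup>2 / 2 * g (i - j) + (S j)\<^sup>2 / 2 * g (i - j))"
  proof (intro sum_mono)
    fix i j
    have "S i * S j \<le> (S i)\<^sup>2 / 2 + (S j)\<^sup>2 / 2"
      using sum_squares_bound[of "S i" "S j"] by simp
    then show "S i * S j * g (i - j) \<le> (S i)\<^sup>2 / 2 * g (i - j) + (S j)\<^sup>2 / 2 * g (i - j)"
      using g0 by (subst distrib_right[symmetric]) (rule mult_right_mono)
  qed
  also have "\<dots> = (\<Sum>i\<in>I. (S i)\<^sup>2 / 2 * (\<Sum>j\<in>I. g (i - j))) + (\<Sum>j\<in>I. (S j)\<^sup>2 / 2 * (\<Sum>i\<in>I. g (j - i)))"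
  proof -
    have "(\<Sum>i\<in>I. \<Sum>j\<in>I. (S j)\<^sup>2 / 2 * g (i - j)) = (\<Sum>j\<in>I. \<Sum>i\<in>I. (S j)\<^sup>2 / 2 * g (j - i))"
    proof (subst sum.swap, intro sum.cong refl)
      fix i j
      show "(S j)\<^sup>2 / 2 * g (i - j) = (S j)\<^sup>2 / 2 * g (j - i)"
        using gs[of "i - j"] by simp
    qed
    then show ?thesis by (simp only: sum.distrib sum_distrib_left)
  qed
  also have "\<dots> \<le> (\<Sum>i\<in>I. (S i)\<^sup>2 / 2 * 5) + (\<Sum>i\<in>I. (S i)\<^sup>2 / 2 * 5)"
    unfolding g_def by (intro add_mono sum_mono mult_left_mono sum_inverse_square_le I) auto
  also have "\<dots> = 5 * (\<Sum>i\<in>I. (S i)\<^sup>2)" by (simp add: sum_distrib_left flip: sum.distrib)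
  also have "(\<Sum>i\<in>I. (S i)\<^sup>2) \<le> energy d A l b"
  proof -
    have "(\<Sum>i\<in>I. (S i)\<^sup>2) = (\<Sum>i\<in>I. \<Sum>x\<in>{x\<in>A. h x = i}. \<Sum>y\<in>A. if h x = h y then b x * b y else 0)"
    proof (intro sum.cong refl)
      fix i
      have "(\<Sum>y\<in>A. if h x = h y then b x * b y else 0) = b x * S i" if "h x = i" for x
        using A that unfolding S_def
        by (simp add: sum_distrib_left sum.inter_filter[symmetric] eq_commute[of _ i] cong: if_cong)
           (simp add: sum.If_cases Int_def conj_commute eq_commute[of i] sum_distrib_left)?
      then show "(S i)\<^sup>2 = (\<Sum>x\<in>{x\<in>A. h x = i}. \<Sum>y\<in>A. if h x = h y then b x * b y else 0)"
        by (simp add: S_def power2_eq_square sum_distrib_right)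
    qed
    also have "\<dots> = (\<Sum>x\<in>A. \<Sum>y\<in>A. if h x = h y then b x * b y else 0)"
      by (rule group[symmetric])
    also have "\<dots> \<le> energy d A l b"
      unfolding energy_def
    proof (intro sum_mono)
      fix x y assume xy: "x \<in> A" "y \<in> A"
      have "\<bar>l x - l y\<bar> \<le> d" if "h x = h y"
      proof -
        have "\<bar>l x / d - l y / d\<bar> < 1" using that unfolding h_def by linarith
        then show ?thesis using d by (simp add: field_simps abs_le_iff abs_less_iff flip: diff_divide_distrib)
      qed
      then show "(if h x = h y then b x * b y else 0) \<le> (if \<bar>l x - l y\<bar> \<le> d then b x * b y else 0)"
        using b xy by auto
    qed
    finally show ?thesis .
  qed
  finally show ?thesis unfolding g_def by simp
qed

text \<open>
  The triangle of half-width \<open>2 * T\<close> is at least \<open>1/2\<close> on \<open>[0, T]\<close>, and its transform at a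
  pair in buckets at distance \<open>k\<close> is at most \<open>4 * T / (1 + k\<^sup>2)\<close>.
\<close>

theorem mean_square_le_energy:
  fixes l :: "'a \<Rightarrow> real"
  assumes A: "finite A" and T: "T > 0" and c: "\<And>x. x \<in> A \<Longrightarrow> cmod (c x) \<le> b x"
  shows "integral {0..T} (\<lambda>t. (cmod (expsum A l c t))\<^sup>2) \<le> 40 * T * energy (2 * pi / T) A l b"
proof -
  define d where "d = 2 * pi / T"
  have d: "d > 0" using T by (simp add: d_def)
  define h where "h x = \<lfloor>l x / d\<rfloor>" for x
  define F where "F t = (cmod (expsum A l c t))\<^sup>2" for t
  have b: "b x \<ge> 0" if "x \<in> A" for x using c[OF that] norm_ge_zero order_trans by blast
  have cont: "continuous_on S F" for S unfolding F_def by (intro continuous_intros)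
  have cont': "continuous_on S (\<lambda>t. F (- t))" for S
    by (rule continuous_on_compose2[OF cont[of UNIV]]) (auto intro: continuous_intros)
  have "integral {0..T} F \<le> integral {0..T} (\<lambda>t. 2 * ((1 - t / (2 * T)) * (F t + F (- t))))"
  proof (intro integral_le integrable_continuous_real continuous_intros cont cont')
    fix t assume t: "t \<in> {0..T}"
    have "1 / 2 * F t \<le> (1 - t / (2 * T)) * (F t + F (- t))"
      using t T by (intro mult_mono) (auto simp: F_def field_simps)
    then show "F t \<le> 2 * ((1 - t / (2 * T)) * (F t + F (- t)))" by linarith
  qed (use T in auto)
  also have "\<dots> \<le> integral {0..2*T} (\<lambda>t. 2 * ((1 - t / (2 * T)) * (F t + F (- t))))"
    using T by (intro integral_subset_le integrable_continuous_real continuous_intros cont cont')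
       (auto simp: F_def)
  also have "\<dots> = 2 * Re (\<Sum>x\<in>A. \<Sum>y\<in>A. c x * cnj (c y) * of_real (fejer (2*T) (l x - l y)))"
    using has_integral_mult_right[OF fejer_mean_expsum[of "2*T" A l c], of 2] T
    by (intro integral_unique) (simp add: F_def)
  also have "Re (\<Sum>x\<in>A. \<Sum>y\<in>A. c x * cnj (c y) * of_real (fejer (2*T) (l x - l y)))
     \<le> (\<Sum>x\<in>A. \<Sum>y\<in>A. 4 * T * (b x * b y * (1 / (1 + (real_of_int (h x - h y))\<^sup>2))))"
    unfolding Re_sum
  proof (intro sum_mono)
    fix x y assume xy: "x \<in> A" "y \<in> A"
    define k where "k = real_of_int (h x - h y)"
    define L where "L = l x - l y"
    have fej: "fejer (2*T) L \<le> 4 * T * (1 / (1 + k\<^sup>2))"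
    proof (cases "\<bar>h x - h y\<bar> \<le> 1")
      case True
      then have "k\<^sup>2 \<le> 1" unfolding k_def by (simp add: abs_square_le_1)
      then have "1 / 2 \<le> 1 / (1 + k\<^sup>2)" by (intro divide_left_mono) (auto simp: add_pos_nonneg)
      then have "4 * T * (1 / 2) \<le> 4 * T * (1 / (1 + k\<^sup>2))" using T by (intro mult_left_mono) auto
      then have "2 * T \<le> 4 * T * (1 / (1 + k\<^sup>2))" by simp
      then show ?thesis using fejer_le[of "2*T" L] T by linarith
    next
      case False
      then have k2: "\<bar>k\<bar> \<ge> 2" unfolding k_def by linarith
      have "\<bar>l x / d - l y / d\<bar> \<ge> \<bar>k\<bar> - 1" unfolding k_def h_def by linarith
      moreover have "l x / d - l y / d = L / d" by (simp add: L_def diff_divide_distrib)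
      moreover have "\<bar>L / d\<bar> = \<bar>L\<bar> / d" using d by simp
      ultimately have "\<bar>L\<bar> / d \<ge> \<bar>k\<bar> / 2" using k2 by linarith
      then have L: "\<bar>L\<bar> \<ge> \<bar>k\<bar> * (pi / T)" using T by (simp add: d_def field_simps)
      have "\<bar>k\<bar> * (pi / T) \<ge> \<bar>k\<bar> * (1 / T)"
        using T pi_gt3 by (intro mult_left_mono divide_right_mono) auto
      then have L': "\<bar>L\<bar> \<ge> \<bar>k\<bar> / T" using L by simp
      have "(\<bar>k\<bar> / T)\<^sup>2 \<le> \<bar>L\<bar>\<^sup>2" using L' T by (intro power_mono) auto
      then have L2: "k\<^sup>2 / T\<^sup>2 \<le> L\<^sup>2" by (simp add: power_divide)
      have kk: "k\<^sup>2 \<ge> 4" using power_mono[OF k2, of 2] by simp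
      have Lne: "L \<noteq> 0" using L' k2 T by (auto simp: field_simps)
      have "fejer (2*T) L \<le> 4 / (2 * T * L\<^sup>2)" using fejer_le_decay[of "2*T" L] T Lne by simp
      also have "\<dots> \<le> 4 / (2 * T * (k\<^sup>2 / T\<^sup>2))"
      proof (intro divide_left_mono mult_left_mono L2)
        have "k \<noteq> 0" using k2 by auto
        then show "0 < 2 * T * L\<^sup>2 * (2 * T * (k\<^sup>2 / T\<^sup>2))" using T Lne by simp
      qed (use T in auto)
      also have "\<dots> = 2 * T / k\<^sup>2" using T by (simp add: power2_eq_square)
      also have "\<dots> \<le> 4 * T * (1 / (1 + k\<^sup>2))"
      proof -
        have "T * (1 + k\<^sup>2) \<le> T * (2 * k\<^sup>2)" using T kk by (intro mult_left_mono) auto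
        then have "2 * T * (1 + k\<^sup>2) \<le> 4 * T * k\<^sup>2" by simp
        then have "2 * T * (1 + k\<^sup>2) / (k\<^sup>2 * (1 + k\<^sup>2)) \<le> 4 * T * k\<^sup>2 / (k\<^sup>2 * (1 + k\<^sup>2))"
          by (intro divide_right_mono) auto
        moreover have "k\<^sup>2 \<noteq> 0" "1 + k\<^sup>2 \<noteq> 0" using kk by auto
        ultimately show ?thesis by simp
      qed
      finally show ?thesis .
    qed
    have "Re (c x * cnj (c y) * of_real (fejer (2*T) L)) \<le> cmod (c x * cnj (c y) * of_real (fejer (2*T) L))"
      by (rule complex_Re_le_cmod)
    also have "\<dots> = cmod (c x) * cmod (c y) * fejer (2*T) L"
      using fejer_nonneg[of "2*T" L] T by (simp add: norm_mult)
    also have "\<dots> \<le> b x * b y * (4 * T * (1 / (1 + k\<^sup>2)))"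
      using xy c b fej fejer_nonneg[of "2*T" L] T by (intro mult_mono) auto
    finally show "Re (c x * cnj (c y) * of_real (fejer (2*T) (l x - l y)))
       \<le> 4 * T * (b x * b y * (1 / (1 + (real_of_int (h x - h y))\<^sup>2)))"
      by (simp add: k_def L_def mult_ac)
  qed
  also have "\<dots> = 4 * T * (\<Sum>x\<in>A. \<Sum>y\<in>A. b x * b y * (1 / (1 + (real_of_int (h x - h y))\<^sup>2)))"
    by (simp add: sum_distrib_left)
  also have "\<dots> \<le> 4 * T * (5 * energy d A l b)"
    unfolding h_def using T by (intro mult_left_mono bucket_sum_le_energy A d b) auto
  finally show ?thesis by (simp add: F_def [abs_def] d_def)
qed

text \<open>
  With nonnegative coefficients every pair contributes nonnegatively to the weighted mean square, so
  all pairs but the close ones can be dropped. The half-width \<open>T / 8\<close> is small enough that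
  \<open>(T / 8) * (2 * pi / T) \<le> 1\<close>, as \<open>fejer_ge\<close> requires.
\<close>

theorem energy_le_mean_square:
  assumes A: "finite A" and T: "T > 0" and b: "\<And>x. x \<in> A \<Longrightarrow> b x \<ge> 0"
  shows "T * energy (2 * pi / T) A l b \<le> 32 * integral {0..T} (\<lambda>t. (cmod (expsum A l (\<lambda>x. of_real (b x)) t))\<^sup>2)"
proof -
  define F where "F t = (cmod (expsum A l (\<lambda>x. of_real (b x)) t))\<^sup>2" for t
  define U where "U = T / 8"
  have U: "U > 0" using T by (simp add: U_def)
  have cont: "continuous_on S F" for S unfolding F_def by (intro continuous_intros)
  have "cnj (expsum A l (\<lambda>x. of_real (b x)) t) = expsum A l (\<lambda>x. of_real (b x)) (- t)" for t
    by (simp add: expsum_def cis_cnj)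
  then have even: "F (- t) = F t" for t unfolding F_def by (metis complex_mod_cnj)
  have "U / 2 * energy (2 * pi / T) A l b \<le> (\<Sum>x\<in>A. \<Sum>y\<in>A. b x * b y * fejer U (l x - l y))"
    unfolding energy_def sum_distrib_left
  proof (intro sum_mono)
    fix x y assume xy: "x \<in> A" "y \<in> A"
    show "U / 2 * (if \<bar>l x - l y\<bar> \<le> 2 * pi / T then b x * b y else 0) \<le> b x * b y * fejer U (l x - l y)"
    proof (cases "\<bar>l x - l y\<bar> \<le> 2 * pi / T")
      case True
      have "U * \<bar>l x - l y\<bar> \<le> U * (2 * pi / T)" using U True by (intro mult_left_mono) auto
      also have "\<dots> \<le> 1" using T pi_less_4 by (simp add: U_def)
      finally have "fejer U (l x - l y) \<ge> U / 2" using fejer_ge U by simp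
      then have "b x * b y * (U / 2) \<le> b x * b y * fejer U (l x - l y)"
        using b xy by (intro mult_left_mono) auto
      then show ?thesis using True by (simp add: mult_ac)
    next
      case False then show ?thesis using b xy fejer_nonneg U by simp
    qed
  qed
  also have "\<dots> = integral {0..U} (\<lambda>t. (1 - t / U) * (F t + F (- t)))"
    using integral_unique[OF fejer_mean_expsum[OF U, of A l "\<lambda>x. of_real (b x)"]] by (simp add: F_def)
  also have "\<dots> \<le> integral {0..U} (\<lambda>t. 2 * F t)"
  proof (unfold even, intro integral_le integrable_continuous_real continuous_intros cont)
    fix t assume t: "t \<in> {0..U}"
    show "(1 - t / U) * (F t + F t) \<le> 2 * F t"
      using t U mult_right_mono[of "1 - t / U" 1 "2 * F t"] by (simp add: F_def)
  qed (use U in auto)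
  also have "\<dots> \<le> integral {0..T} (\<lambda>t. 2 * F t)"
    using T by (intro integral_subset_le integrable_continuous_real continuous_intros cont)
       (auto simp: F_def U_def)
  also have "\<dots> = 2 * integral {0..T} F" by simp
  finally show ?thesis by (simp add: U_def F_def [abs_def])
qed

section \<open>Dirichlet polynomials on the imaginary axis\<close>

lemma nat_powr_imaginary:
  assumes "n > 0"
  shows "of_nat n powr (- (\<i> * of_real t)) = cis (- (ln (real n) * t))"
proof -
  have "of_nat n powr (- (\<i> * of_real t)) = exp (- (\<i> * of_real t) * of_real (ln (real n)))"
    using assms by (simp add: powr_def Ln_of_nat)
  also have "\<dots> = cis (- (ln (real n) * t))" by (simp add: cis_conv_exp mult_ac)
  finally show ?thesis .
qed

lemma dirichlet_poly_imaginary: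
  assumes "0 \<notin> A"
  shows "dirichlet_poly A a (\<i> * of_real t) = expsum A (\<lambda>n. ln (real n)) a t"
  unfolding dirichlet_poly_def expsum_def
  using assms by (intro sum.cong refl) (metis nat_powr_imaginary neq0_conv)

lemma expsum_mult:
  "expsum A l c t * expsum B l' c' t
     = expsum (A \<times> B) (\<lambda>(x, y). l x + l' y) (\<lambda>(x, y). c x * c' y) t"
  unfolding expsum_def sum_product sum.cartesian_product
  by (intro sum.cong refl) (auto simp: cis_mult algebra_simps)

definition log_prod :: "nat \<times> nat \<Rightarrow> real" where
  "log_prod = (\<lambda>(m, n). ln (real m) + ln (real n))"

lemma expsum_mult_log:
  "expsum A (\<lambda>n. ln (real n)) c t * expsum B (\<lambda>n. ln (real n)) c' t
     = expsum (A \<times> B) log_prod (\<lambda>(x, y). c x * c' y) t"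
  unfolding expsum_mult log_prod_def ..

lemma energy_mono:
  assumes "A \<subseteq> B" "finite B" "\<And>x. x \<in> A \<Longrightarrow> 0 \<le> b x" "\<And>x. x \<in> A \<Longrightarrow> b x \<le> b' x"
    "\<And>x. x \<in> B \<Longrightarrow> 0 \<le> b' x"
  shows "energy d A l b \<le> energy d B l b'"
proof -
  have "energy d A l b \<le> (\<Sum>x\<in>A. \<Sum>y\<in>B. if \<bar>l x - l y\<bar> \<le> d then b' x * b' y else 0)"
    unfolding energy_def
  proof (intro sum_mono)
    fix x assume x: "x \<in> A"
    have "(\<Sum>y\<in>A. if \<bar>l x - l y\<bar> \<le> d then b x * b y else 0) \<le> (\<Sum>y\<in>A. if \<bar>l x - l y\<bar> \<le> d then b' x * b' y else 0)"
      using assms x by (intro sum_mono) (auto intro!: mult_mono)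
    also have "\<dots> \<le> (\<Sum>y\<in>B. if \<bar>l x - l y\<bar> \<le> d then b' x * b' y else 0)"
      using assms x by (intro sum_mono2) auto
    finally show "(\<Sum>y\<in>A. if \<bar>l x - l y\<bar> \<le> d then b x * b y else 0) \<le> \<dots>" .
  qed
  also have "\<dots> \<le> energy d B l b'"
    unfolding energy_def using assms by (intro sum_mono2 sum_nonneg) auto
  finally show ?thesis .
qed

text \<open>
  The inner part of the energy of \<open>M \<times> S\<close>: for fixed \<open>m1\<close> and \<open>m2\<close> the condition on \<open>(a, b)\<close> is that
  \<open>a / b\<close> be close to \<open>m2 / m1\<close>, recorded here through \<open>\<theta> = ln (m2 / m1)\<close>.
\<close>

definition close_sum :: "real \<Rightarrow> nat set \<Rightarrow> (nat \<Rightarrow> real) \<Rightarrow> real \<Rightarrow> real" where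
  "close_sum d S r \<theta> = (\<Sum>a\<in>S. \<Sum>b\<in>S. if \<bar>ln (real a) - ln (real b) - \<theta>\<bar> \<le> d then r a * r b else 0)"

lemma energy_log_prod:
  "energy d (M \<times> S) log_prod (\<lambda>(m, n). r n)
     = (\<Sum>m1\<in>M. \<Sum>m2\<in>M. close_sum d S r (ln (real m2) - ln (real m1)))"
proof -
  have "energy d (M \<times> S) log_prod (\<lambda>(m, n). r n) =
     (\<Sum>m1\<in>M. \<Sum>n1\<in>S. \<Sum>m2\<in>M. \<Sum>n2\<in>S. if \<bar>ln (real n1) - ln (real n2) - (ln (real m2) - ln (real m1))\<bar> \<le> d then r n1 * r n2 else 0)"
    unfolding energy_def log_prod_def sum.cartesian_product[symmetric]
    by (simp only: sum.cartesian_product' case_prod_conv) (simp add: algebra_simps)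
  also have "\<dots> = (\<Sum>m1\<in>M. \<Sum>m2\<in>M. close_sum d S r (ln (real m2) - ln (real m1)))"
    unfolding close_sum_def by (rule sum.cong[OF refl], rule sum.swap)
  finally show ?thesis .
qed

lemma count_J_eq_energy:
  assumes M: "finite M" "0 \<notin> M"
  shows "count_J T M N q = energy (2 * pi / T) (M \<times> {1..N}) log_prod (\<lambda>(m, n). q n)"
proof -
  let ?P = "\<lambda>m1 m2 n1 n2. \<bar>ln (real (m1 * n1) / real (m2 * n2))\<bar> \<le> 2 * pi / T"
  let ?Q = "\<lambda>m1 m2 n1 n2. \<bar>log_prod (m1, n1) - log_prod (m2, n2)\<bar> \<le> 2 * pi / T"
  have PQ: "?P m1 m2 n1 n2 = ?Q m1 m2 n1 n2" if "m1 \<in> M" "m2 \<in> M" "n1 \<in> {1..N}" "n2 \<in> {1..N}" for m1 m2 n1 n2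
  proof -
    have "m1 > 0" "m2 > 0" using that M by (metis neq0_conv)+
    then show ?thesis using that by (simp add: log_prod_def ln_div ln_mult)
  qed
  have "count_J T M N q = (\<Sum>(m1, m2, n1, n2)\<in>M \<times> M \<times> {1..N} \<times> {1..N}. if ?P m1 m2 n1 n2 then q n1 * q n2 else 0)"
    unfolding count_J_def using M(1)
    by (intro sum.mono_neutral_cong_left) (auto split: if_splits)
  also have "\<dots> = (\<Sum>(m1, m2, n1, n2)\<in>M \<times> M \<times> {1..N} \<times> {1..N}. if ?Q m1 m2 n1 n2 then q n1 * q n2 else 0)"
  proof (rule sum.cong[OF refl])
    fix x assume "x \<in> M \<times> M \<times> {1..N} \<times> {1..N}"
    then obtain m1 m2 n1 n2 where x: "x = (m1, m2, n1, n2)" and "m1 \<in> M" "m2 \<in> M" "n1 \<in> {1..N}" "n2 \<in> {1..N}" by auto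
    then show "(case x of (m1, m2, n1, n2) \<Rightarrow> if ?P m1 m2 n1 n2 then q n1 * q n2 else 0)
       = (case x of (m1, m2, n1, n2) \<Rightarrow> if ?Q m1 m2 n1 n2 then q n1 * q n2 else 0)"
      unfolding x case_prod_conv by (simp only: PQ)
  qed
  also have "\<dots> = (\<Sum>m1\<in>M. \<Sum>m2\<in>M. \<Sum>n1\<in>{1..N}. \<Sum>n2\<in>{1..N}. if ?Q m1 m2 n1 n2 then q n1 * q n2 else 0)"
    by (simp only: sum.cartesian_product' case_prod_conv)
  also have "\<dots> = (\<Sum>m1\<in>M. \<Sum>n1\<in>{1..N}. \<Sum>m2\<in>M. \<Sum>n2\<in>{1..N}. if ?Q m1 m2 n1 n2 then q n1 * q n2 else 0)"
    by (rule sum.cong[OF refl], rule sum.swap)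
  also have "\<dots> = energy (2 * pi / T) (M \<times> {1..N}) log_prod (\<lambda>(m, n). q n)"
    unfolding energy_def by (simp only: sum.cartesian_product' case_prod_conv)
  finally show ?thesis .
qed

lemma admissible_set_finite:
  assumes "admissible_set T M \<epsilon>"
  shows "finite M" "0 \<notin> M" "T \<ge> 20"
proof -
  have "M \<subseteq> {..nat \<lfloor>T\<rfloor>}" using assms unfolding admissible_set_def by (auto simp: le_nat_floor)
  then show "finite M" by (rule finite_subset) simp
qed (use assms in \<open>auto simp: admissible_set_def\<close>)

text \<open>
  This is where the elements of \<open>M\<close> being integers up to \<open>T\<close> enters: logarithms at distance
  \<open>2 * pi / T\<close> of numbers up to \<open>T\<close> force the numbers themselves to be at bounded distance.
\<close>

lemma card_close_nats:
  assumes T: "T \<ge> 20" and M: "finite M" and m: "0 < m" "real m \<le> T"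
    and M': "\<And>m'. m' \<in> M \<Longrightarrow> 0 < m' \<and> real m' \<le> T"
  shows "card {m'\<in>M. \<bar>ln (real m) - ln (real m')\<bar> \<le> 2 * pi / T} \<le> 41"
proof -
  have main: "x - y \<le> 20" if "0 < x" "0 < y" "x \<le> T" "y \<le> T" "\<bar>ln x - ln y\<bar> \<le> 2 * pi / T" for x y :: real
  proof (cases "x \<le> y")
    case False
    have "ln (y / x) \<le> y / x - 1" using that by (intro ln_le_minus_one) auto
    then have "(x - y) / x \<le> ln x - ln y" using that by (simp add: ln_div diff_divide_distrib)
    then have "(x - y) / x \<le> 2 * pi / T" using that by linarith
    then have "x - y \<le> 2 * pi / T * x" using that by (simp add: field_simps)
    also have "\<dots> \<le> 2 * pi / T * T" using that T by (intro mult_left_mono) auto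
    also have "\<dots> \<le> 20" using T pi_less_4 by simp
    finally show ?thesis .
  qed auto
  have "{m'\<in>M. \<bar>ln (real m) - ln (real m')\<bar> \<le> 2 * pi / T} \<subseteq> {m - 20..m + 20}"
  proof
    fix m' assume a: "m' \<in> {m'\<in>M. \<bar>ln (real m) - ln (real m')\<bar> \<le> 2 * pi / T}"
    then have "real m - real m' \<le> 20" "real m' - real m \<le> 20"
      using main[of "real m" "real m'"] main[of "real m'" "real m"] M' m by (auto simp: abs_minus_commute)
    then show "m' \<in> {m - 20..m + 20}" by auto
  qed
  then have "card {m'\<in>M. \<bar>ln (real m) - ln (real m')\<bar> \<le> 2 * pi / T} \<le> card {m - 20..m + 20}"
    by (intro card_mono) auto
  also have "\<dots> \<le> 41" by simp
  finally show ?thesis .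
qed

lemma energy_logs_le:
  assumes "admissible_set T M \<epsilon>"
  shows "energy (2 * pi / T) M (\<lambda>m. ln (real m)) (\<lambda>_. 1) \<le> 41 * real (card M)"
proof -
  note fin = admissible_set_finite[OF assms]
  have "energy (2 * pi / T) M (\<lambda>m. ln (real m)) (\<lambda>_. 1)
     = (\<Sum>m\<in>M. real (card {m'\<in>M. \<bar>ln (real m) - ln (real m')\<bar> \<le> 2 * pi / T}))"
    unfolding energy_def using fin by (intro sum.cong refl) (simp add: sum.inter_filter[symmetric])
  also have "\<dots> \<le> (\<Sum>m\<in>M. 41)"
    using assms fin(1) by (intro sum_mono) (use card_close_nats in \<open>force simp: admissible_set_def\<close>)
  finally show ?thesis by simp
qed

text \<open>
  The mean value \<open>O(R * T)\<close> of \<open>M\<close> alone, the term with which every interpolation below ends.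
\<close>

lemma mean_square_M_le:
  assumes "admissible_set T M \<epsilon>"
  shows "integral {0..T} (\<lambda>t. (cmod (expsum M (\<lambda>m. ln (real m)) (\<lambda>_. 1) t))\<^sup>2) \<le> 1640 * T * real (card M)"
proof -
  note fin = admissible_set_finite[OF assms]
  have "integral {0..T} (\<lambda>t. (cmod (expsum M (\<lambda>m. ln (real m)) (\<lambda>_. 1) t))\<^sup>2)
     \<le> 40 * T * energy (2 * pi / T) M (\<lambda>m. ln (real m)) (\<lambda>_. 1)"
    using fin by (intro mean_square_le_energy) auto
  also have "\<dots> \<le> 40 * T * (41 * real (card M))"
    using fin energy_logs_le[OF assms] by (intro mult_left_mono) auto
  finally show ?thesis by simp
qed

section \<open>Fractions near a given ratio\<close>

lemma card_spaced_le:
  fixes f :: "'a \<Rightarrow> real"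
  assumes fin: "finite S" and h: "h > 0" and d: "d \<ge> 0"
    and I: "\<And>x. x \<in> S \<Longrightarrow> \<bar>f x - \<theta>\<bar> \<le> d"
    and sp: "\<And>x y. x \<in> S \<Longrightarrow> y \<in> S \<Longrightarrow> x \<noteq> y \<Longrightarrow> \<bar>f x - f y\<bar> \<ge> h"
  shows "real (card S) \<le> 1 + 2 * d / h"
proof -
  define g where "g x = \<lfloor>(f x - \<theta> + d) / h\<rfloor>" for x
  have "inj_on g S"
  proof (rule inj_onI, rule ccontr)
    fix x y assume "x \<in> S" "y \<in> S" "g x = g y" "x \<noteq> y"
    from \<open>g x = g y\<close> have "\<bar>(f x - \<theta> + d) / h - (f y - \<theta> + d) / h\<bar> < 1" unfolding g_def by linarith
    moreover have "(f x - \<theta> + d) / h - (f y - \<theta> + d) / h = (f x - f y) / h"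
      by (simp add: diff_divide_distrib add_divide_distrib)
    ultimately have "\<bar>f x - f y\<bar> < h" using h by simp
    then show False using sp[of x y] \<open>x \<in> S\<close> \<open>y \<in> S\<close> \<open>x \<noteq> y\<close> by linarith
  qed
  then have "card S = card (g ` S)" by (simp add: card_image)
  also have "\<dots> \<le> card {0..\<lfloor>2 * d / h\<rfloor>}"
  proof (intro card_mono)
    show "g ` S \<subseteq> {0..\<lfloor>2 * d / h\<rfloor>}"
    proof (intro image_subsetI)
      fix x assume "x \<in> S"
      then have "0 \<le> (f x - \<theta> + d) / h" "(f x - \<theta> + d) / h \<le> 2 * d / h"
        using I[of x] h by (auto intro!: divide_nonneg_nonneg divide_right_mono simp: abs_le_iff)
      then show "g x \<in> {0..\<lfloor>2 * d / h\<rfloor>}" unfolding g_def by (auto intro: floor_mono)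
    qed
  qed auto
  finally have "card S \<le> nat (\<lfloor>2 * d / h\<rfloor> + 1)" by simp
  moreover have "2 * d / h \<ge> 0" using d h by simp
  ultimately show ?thesis by linarith
qed

text \<open>
  Two distinct fractions \<open>a / b\<close> and \<open>a' / b'\<close> have the ratio of the distinct integers \<open>a * b'\<close> and
  \<open>a' * b\<close>, both at most \<open>Y\<^sup>2\<close>.
\<close>

lemma ln_fraction_spacing:
  assumes ab: "a \<in> {1..Y}" "b \<in> {1..Y}" "a' \<in> {1..Y}" "b' \<in> {1..Y}" and ne: "a * b' \<noteq> a' * b"
  shows "\<bar>(ln (real a) - ln (real b)) - (ln (real a') - ln (real b'))\<bar> \<ge> 1 / (real Y)\<^sup>2"
proof -
  have main: "ln (real x) - ln (real y) \<ge> 1 / (real Y)\<^sup>2" if "0 < y" "y < x" "x \<le> Y * Y" for x y :: nat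
  proof -
    have "ln (real y / real x) \<le> real y / real x - 1" using that by (intro ln_le_minus_one) auto
    then have "(real x - real y) / real x \<le> ln (real x) - ln (real y)" using that by (simp add: ln_div diff_divide_distrib)
    moreover have "1 / (real Y)\<^sup>2 \<le> (real x - real y) / real x"
    proof -
      have "1 / (real Y)\<^sup>2 \<le> 1 / real x" using that
        by (intro divide_left_mono) (auto simp: power2_eq_square simp flip: of_nat_mult intro!: Nat.gr0I)
      also have "\<dots> \<le> (real x - real y) / real x" using that by (intro divide_right_mono) auto
      finally show ?thesis .
    qed
    ultimately show ?thesis by linarith
  qed
  have b: "a * b' \<le> Y * Y" "a' * b \<le> Y * Y" using ab by (auto intro!: mult_mono)
  have pos: "0 < a * b'" "0 < a' * b" using ab by auto
  have "(ln (real a) - ln (real b)) - (ln (real a') - ln (real b')) = ln (real (a * b')) - ln (real (a' * b))"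
    using ab by (simp add: ln_mult)
  moreover have "\<bar>ln (real (a * b')) - ln (real (a' * b))\<bar> \<ge> 1 / (real Y)\<^sup>2"
  proof (cases "a * b' < a' * b")
    case True
    from main[OF pos(1) True b(2)] show ?thesis
      by (rule order_trans) (subst abs_minus_commute, rule abs_ge_self)
  next
    case False
    then have "a' * b < a * b'" using ne by simp
    from main[OF pos(2) this b(1)] show ?thesis by (rule order_trans) (rule abs_ge_self)
  qed
  ultimately show ?thesis by simp
qed

lemma coprime_cross_eq:
  fixes a b a' b' :: nat
  assumes "coprime a b" "coprime a' b'" "a * b' = a' * b" "0 < b" "0 < b'" 
  shows "a = a' \<and> b = b'"
proof -
  have "a dvd a'" using assms by (metis coprime_dvd_mult_left_iff dvd_triv_left)
  moreover have "a' dvd a" using assms by (metis coprime_dvd_mult_left_iff dvd_triv_left)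
  ultimately have "a = a'" by (simp add: dvd_antisym)
  moreover have "b dvd b'" using assms by (metis coprime_commute coprime_dvd_mult_right_iff dvd_triv_right mult.commute)
  moreover have "b' dvd b" using assms by (metis coprime_commute coprime_dvd_mult_right_iff dvd_triv_right mult.commute)
  ultimately show ?thesis by (simp add: dvd_antisym)
qed

definition close_coprime :: "real \<Rightarrow> nat \<Rightarrow> real \<Rightarrow> (nat \<times> nat) set" where
  "close_coprime d Y \<theta> = {(a, b). a \<in> {1..Y} \<and> b \<in> {1..Y} \<and> coprime a b \<and> \<bar>ln (real a) - ln (real b) - \<theta>\<bar> \<le> d}"

lemma finite_close_coprime [simp]: "finite (close_coprime d Y \<theta>)"
  by (rule finite_subset[of _ "{1..Y} \<times> {1..Y}"]) (auto simp: close_coprime_def)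

text \<open>
  A pair of coprime integers is determined by its ratio, so the spacing of the ratios bounds the
  number of pairs.
\<close>

lemma card_close_coprime_le:
  assumes "d \<ge> 0"
  shows "real (card (close_coprime d Y \<theta>)) \<le> 1 + 2 * d * (real Y)\<^sup>2"
proof (cases "Y = 0")
  case True then show ?thesis by (simp add: close_coprime_def)
next
  case False
  have "real (card (close_coprime d Y \<theta>)) \<le> 1 + 2 * d / (1 / (real Y)\<^sup>2)"
  proof (rule card_spaced_le[where f = "\<lambda>(a, b). ln (real a) - ln (real b)" and \<theta> = \<theta>])
    fix x y assume xy: "x \<in> close_coprime d Y \<theta>" "y \<in> close_coprime d Y \<theta>" "x \<noteq> y"
    obtain a b a' b' where [simp]: "x = (a, b)" "y = (a', b')" by fastforce
    have "a * b' \<noteq> a' * b" using coprime_cross_eq[of a b a' b'] xy by (auto simp: close_coprime_def)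
    then show "1 / (real Y)\<^sup>2 \<le> \<bar>(case x of (a, b) \<Rightarrow> ln (real a) - ln (real b)) - (case y of (a, b) \<Rightarrow> ln (real a) - ln (real b))\<bar>"
      using ln_fraction_spacing[of a Y b a' b'] xy by (auto simp: close_coprime_def)
  next
    show "\<And>x. x \<in> close_coprime d Y \<theta> \<Longrightarrow> \<bar>(case x of (a, b) \<Rightarrow> ln (real a) - ln (real b)) - \<theta>\<bar> \<le> d"
      by (auto simp: close_coprime_def)
  qed (use assms False in simp_all)
  then show ?thesis using False by simp
qed

section \<open>The divisor bound\<close>

lemma card_divisors_prime_power_mult:
  fixes p m e :: nat
  assumes p: "prime p" and m: "m > 0"
  shows "card {d. d dvd p ^ e * m} \<le> (e + 1) * card {d. d dvd m}"
proof -
  have fin: "finite {d. d dvd m}" using m by simp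
  have "{d. d dvd p ^ e * m} \<subseteq> (\<lambda>(i, d). p ^ i * d) ` ({..e} \<times> {d. d dvd m})"
  proof
    fix d assume "d \<in> {d. d dvd p ^ e * m}"
    then obtain a b where ab: "d = a * b" "a dvd p ^ e" "b dvd m" using division_decomp by blast
    then obtain i where "i \<le> e" "a = p ^ i" using p divides_primepow_nat by blast
    then show "d \<in> (\<lambda>(i, d). p ^ i * d) ` ({..e} \<times> {d. d dvd m})" using ab by force
  qed
  then have "card {d. d dvd p ^ e * m} \<le> card ((\<lambda>(i, d). p ^ i * d) ` ({..e} \<times> {d. d dvd m}))"
    using fin by (intro card_mono) auto
  also have "\<dots> \<le> card ({..e} \<times> {d. d dvd m})" by (rule card_image_le) (use fin in auto)
  finally show ?thesis by (simp add: card_cartesian_product)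
qed

text \<open>
  Induction on \<open>n\<close>, splitting off the full power of one prime. A prime above \<open>P\<close> costs nothing, a
  prime up to \<open>P\<close> costs a factor \<open>C\<close>, and there are boundedly many of the latter.
\<close>

lemma card_divisors_le_prod:
  assumes \<eta>: "\<eta> > 0" and C1: "C \<ge> 1" and n: "n > 0"
    and big: "\<And>p e. prime p \<Longrightarrow> p > P \<Longrightarrow> real e + 1 \<le> (real p ^ e) powr \<eta>"
    and small: "\<And>p e. prime p \<Longrightarrow> real e + 1 \<le> C * (real p ^ e) powr \<eta>"
  shows "real (card {d. d dvd n}) \<le> C ^ card {p. prime p \<and> p dvd n \<and> p \<le> P} * real n powr \<eta>"
  using n
proof (induction n rule: less_induct)
  case (less n)
  show ?case
  proof (cases "n = 1")
    case True
    then have "{d. d dvd n} = {1}" by auto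
    then show ?thesis using True C1 by (simp add: one_le_power)
  next
    case False
    then obtain p where p: "prime p" "p dvd n" using prime_factor_nat by blast
    define e where "e = multiplicity p n"
    obtain m where nm: "n = p ^ e * m" and pm: "\<not> p dvd m"
      using multiplicity_decompose'[of n p] less.prems p unfolding e_def by (metis not_prime_unit neq0_conv)
    have e: "e > 0" using nm pm p by (metis gr0I mult_1 power_0)
    have m0: "m > 0" using nm less.prems by (metis mult_0_right neq0_conv)
    have "p ^ e > 1" using p e by (metis one_less_power prime_gt_1_nat)
    then have mn: "m < n" using nm m0 by simp
    let ?S = "\<lambda>n. {q. prime q \<and> q dvd n \<and> q \<le> P}"
    have fin: "finite (?S n)" for n by (rule finite_subset[of _ "{..P}"]) auto
    have IH: "real (card {d. d dvd m}) \<le> C ^ card (?S m) * real m powr \<eta>"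
      using less.IH[OF mn m0] .
    have sub: "?S m \<subseteq> ?S n" using nm by auto
    have "real (card {d. d dvd n}) \<le> real ((e + 1) * card {d. d dvd m})"
      unfolding nm of_nat_le_iff by (rule card_divisors_prime_power_mult[OF p(1) m0])
    also have "\<dots> = (real e + 1) * real (card {d. d dvd m})" by (simp add: algebra_simps)
    also have "\<dots> \<le> (real e + 1) * (C ^ card (?S m) * real m powr \<eta>)"
      using IH by (intro mult_left_mono) auto
    also have "\<dots> \<le> C ^ card (?S n) * ((real p ^ e) powr \<eta> * real m powr \<eta>)"
    proof (cases "p \<le> P")
      case True
      have "insert p (?S m) \<subseteq> ?S n" using nm p True sub by auto
      moreover have "p \<notin> ?S m" using pm by auto
      ultimately have "card (?S m) + 1 \<le> card (?S n)"
        using card_mono[OF fin, of "insert p (?S m)" n] fin by simp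
      then have "C * C ^ card (?S m) \<le> C ^ card (?S n)"
        using C1 power_increasing[of "card (?S m) + 1" "card (?S n)" C] by simp
      then have "(C * C ^ card (?S m)) * ((real p ^ e) powr \<eta> * real m powr \<eta>) \<le> C ^ card (?S n) * ((real p ^ e) powr \<eta> * real m powr \<eta>)"
        by (intro mult_right_mono) auto
      moreover have "(real e + 1) * (C ^ card (?S m) * real m powr \<eta>) \<le> (C * (real p ^ e) powr \<eta>) * (C ^ card (?S m) * real m powr \<eta>)"
        using small[OF p(1), of e] C1 by (intro mult_right_mono) auto
      ultimately show ?thesis by (simp add: mult_ac)
    next
      case False
      have "C ^ card (?S m) \<le> C ^ card (?S n)"
        using C1 card_mono[OF fin sub] by (intro power_increasing)
      then show ?thesis using big[OF p(1), of e] False C1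
        by (subst mult.left_commute) (intro mult_mono, auto intro!: mult_right_mono)
    qed
    also have "(real p ^ e) powr \<eta> * real m powr \<eta> = real n powr \<eta>"
      unfolding nm by (simp add: powr_mult)
    finally show ?thesis .
  qed
qed

text \<open>
  For a prime \<open>p \<ge> 2 powr (1 / \<eta>)\<close> we have \<open>e + 1 \<le> 2 ^ e \<le> p powr (\<eta> * e)\<close>; for the smaller
  primes \<open>e + 1\<close> is at most a constant times \<open>2 powr (\<eta> * e)\<close>.
\<close>

theorem card_divisors_le_powr:
  assumes \<eta>: "\<eta> > (0::real)"
  shows "\<exists>C>0. \<forall>n>0. real (card {d. d dvd n}) \<le> C * real n powr \<eta>"
proof -
  define P where "P = nat \<lceil>2 powr (1 / \<eta>)\<rceil>"
  define C where "C = 1 + 1 / (\<eta> * ln 2)"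
  have C1: "C \<ge> 1" using \<eta> by (simp add: C_def)
  have pw: "(real p ^ e) powr \<eta> = (real p powr \<eta>) ^ e" if "p > 0" for p e :: nat
    using that by (simp add: powr_power flip: powr_realpow)
       (simp add: powr_powr powr_realpow[symmetric] mult.commute)
  have big: "real e + 1 \<le> (real p ^ e) powr \<eta>" if "prime p" "p > P" for p e :: nat
  proof -
    have "2 powr (1 / \<eta>) \<le> real p" using that by (simp add: P_def) linarith
    then have "(2 powr (1 / \<eta>)) powr \<eta> \<le> real p powr \<eta>" using \<eta> by (intro powr_mono2) auto
    then have "2 \<le> real p powr \<eta>" using \<eta> by (simp add: powr_powr)
    then have "2 ^ e \<le> (real p powr \<eta>) ^ e" by (intro power_mono) auto
    moreover have "real e + 1 \<le> 2 ^ e" by (induction e) auto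
    ultimately show ?thesis using pw[of p e] that prime_gt_0_nat by auto
  qed
  have small: "real e + 1 \<le> C * (real p ^ e) powr \<eta>" if "prime p" for p e :: nat
  proof -
    have p2: "real p \<ge> 2" using that prime_ge_2_nat by auto
    have "1 + real e * (\<eta> * ln 2) \<le> exp (real e * (\<eta> * ln 2))" by (rule exp_ge_add_one_self)
    also have "\<dots> = (2 ^ e) powr \<eta>" by (simp add: powr_def ln_realpow mult_ac)
    also have "\<dots> \<le> (real p ^ e) powr \<eta>" using p2 \<eta> by (intro powr_mono2 power_mono) auto
    finally have *: "1 + real e * (\<eta> * ln 2) \<le> (real p ^ e) powr \<eta>" .
    have "real e + 1 \<le> C * (1 + real e * (\<eta> * ln 2))"
      using \<eta> by (simp add: C_def field_simps)
    also have "\<dots> \<le> C * (real p ^ e) powr \<eta>" using * C1 by (intro mult_left_mono) auto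
    finally show ?thesis .
  qed
  show ?thesis
  proof (intro exI[of _ "C ^ P"] conjI allI impI)
    fix n :: nat assume n: "n > 0"
    have "{p. prime p \<and> p dvd n \<and> p \<le> P} \<subseteq> {1..P}" by (auto dest: prime_gt_0_nat)
    then have "card {p. prime p \<and> p dvd n \<and> p \<le> P} \<le> P" using card_mono[of "{1..P}"] by fastforce
    then have "C ^ card {p. prime p \<and> p dvd n \<and> p \<le> P} \<le> C ^ P" using C1 by (intro power_increasing)
    then have "C ^ card {p. prime p \<and> p dvd n \<and> p \<le> P} * real n powr \<eta> \<le> C ^ P * real n powr \<eta>"
      by (intro mult_right_mono) auto
    moreover have "real (card {d. d dvd n}) \<le> C ^ card {p. prime p \<and> p dvd n \<and> p \<le> P} * real n powr \<eta>"
      by (rule card_divisors_le_prod[OF \<eta> C1 n]) (use big small in auto)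
    ultimately show "real (card {d. d dvd n}) \<le> C ^ P * real n powr \<eta>" by linarith
  qed (use C1 in auto)
qed

section \<open>Close pairs of products\<close>

text \<open>
  Grouping by \<open>g = gcd a b\<close>: the ratio is unchanged when \<open>g\<close> is removed.
\<close>

lemma close_sum_gcd:
  "close_sum d {1..N} (\<lambda>_. 1) \<theta> = (\<Sum>g\<in>{1..N}. real (card (close_coprime d (N div g) \<theta>)))"
proof -
  define S where "S = {(a, b). a \<in> {1..N} \<and> b \<in> {1..N} \<and> \<bar>ln (real a) - ln (real b) - \<theta>\<bar> \<le> d}"
  have finS: "finite S" by (rule finite_subset[of _ "{1..N} \<times> {1..N}"]) (auto simp: S_def)
  have "close_sum d {1..N} (\<lambda>_. 1) \<theta> = (\<Sum>x\<in>{1..N}\<times>{1..N}. if x \<in> S then 1 else 0)"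
    unfolding close_sum_def sum.cartesian_product by (intro sum.cong refl) (auto simp: S_def split: if_splits)
  also have "\<dots> = real (card S)"
    by (subst sum.inter_restrict[symmetric]) (auto simp: S_def Int_def intro!: arg_cong[where f = card])
  also have "\<dots> = (\<Sum>g\<in>{1..N}. real (card {x\<in>S. gcd (fst x) (snd x) = g}))"
  proof -
    have "(\<Sum>x\<in>S. 1::nat) = (\<Sum>g\<in>{1..N}. \<Sum>x\<in>{x\<in>S. gcd (fst x) (snd x) = g}. 1)"
    proof (rule sum.group[symmetric, OF finS])
      show "(\<lambda>x. gcd (fst x) (snd x)) ` S \<subseteq> {1..N}"
      proof
        fix g assume "g \<in> (\<lambda>x. gcd (fst x) (snd x)) ` S"
        then obtain a b where ab: "a \<in> {1..N}" "b \<in> {1..N}" "g = gcd a b" by (auto simp: S_def)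
        then have "g dvd a" "g > 0" "a > 0" by auto
        then show "g \<in> {1..N}" using ab(1) dvd_imp_le[of g a] by auto
      qed
    qed auto
    then have "card S = (\<Sum>g\<in>{1..N}. card {x\<in>S. gcd (fst x) (snd x) = g})"
      by (simp only: card_eq_sum)
    then show ?thesis by (simp only: of_nat_sum)
  qed
  also have "\<dots> = (\<Sum>g\<in>{1..N}. real (card (close_coprime d (N div g) \<theta>)))"
  proof (intro sum.cong refl arg_cong[where f = real])
    fix g assume g: "g \<in> {1..N}"
    have "bij_betw (\<lambda>(a, b). (g * a, g * b)) (close_coprime d (N div g) \<theta>) {x\<in>S. gcd (fst x) (snd x) = g}"
    proof (rule bij_betw_imageI)
      show "inj_on (\<lambda>(a, b). (g * a, g * b)) (close_coprime d (N div g) \<theta>)" using g by (auto simp: inj_on_def)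
      have le: "g * a \<le> N \<longleftrightarrow> a \<le> N div g" for a using g
        by (simp add: less_eq_div_iff_mult_less_eq mult.commute)
      have ln: "ln (real (g * a)) - ln (real (g * b)) = ln (real a) - ln (real b)" if "a > 0" "b > 0" for a b
        using that g by (simp add: ln_mult)
      show "(\<lambda>(a, b). (g * a, g * b)) ` close_coprime d (N div g) \<theta> = {x\<in>S. gcd (fst x) (snd x) = g}"
      proof (intro equalityI subsetI)
        fix x assume "x \<in> (\<lambda>(a, b). (g * a, g * b)) ` close_coprime d (N div g) \<theta>"
        then obtain a b where "x = (g * a, g * b)" "(a, b) \<in> close_coprime d (N div g) \<theta>" by auto
        then show "x \<in> {x\<in>S. gcd (fst x) (snd x) = g}"
          using ln[of a b] le[of a] le[of b] g
          by (auto simp: close_coprime_def S_def gcd_mult_distrib_nat[symmetric] coprime_iff_gcd_eq_1)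
      next
        fix x assume x: "x \<in> {x\<in>S. gcd (fst x) (snd x) = g}"
        obtain a b where ab: "x = (a, b)" by fastforce
        have gab: "gcd a b = g" using x ab by simp
        then obtain a' b' where ab': "a = g * a'" "b = g * b'" by (metis dvd_def gcd_dvd1 gcd_dvd2)
        have "g * gcd a' b' = g" using gab ab' by (simp add: gcd_mult_distrib_nat)
        then have "coprime a' b'" using g by (simp add: coprime_iff_gcd_eq_1)
        moreover have "a' > 0" "b' > 0" using x ab ab' by (auto simp: S_def intro!: Nat.gr0I)
        ultimately have "(a', b') \<in> close_coprime d (N div g) \<theta>"
          using x ab ab' ln[of a' b'] le[of a'] le[of b'] by (auto simp: close_coprime_def S_def)
        then show "x \<in> (\<lambda>(a, b). (g * a, g * b)) ` close_coprime d (N div g) \<theta>" using ab ab' by force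
      qed
    qed
    then show "card {x\<in>S. gcd (fst x) (snd x) = g} = card (close_coprime d (N div g) \<theta>)"
      by (simp add: bij_betw_same_card)
  qed
  finally show ?thesis .
qed

lemma card_close_coprime_le_close_sum:
  "real (card (close_coprime d Y \<theta>)) \<le> close_sum d {1..Y} (\<lambda>_. 1) \<theta>"
proof (cases "Y = 0")
  case True then show ?thesis by (simp add: close_coprime_def close_sum_def)
next
  case False
  have "real (card (close_coprime d (Y div 1) \<theta>)) \<le> (\<Sum>g\<in>{1..Y}. real (card (close_coprime d (Y div g) \<theta>)))"
    using False by (intro member_le_sum) auto
  then show ?thesis unfolding close_sum_gcd by simp
qed

lemma sum_inverse_squares_le: "(\<Sum>g\<in>{1..n}. 1 / (real g)\<^sup>2) \<le> 2"
proof -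
  have "(\<Sum>g\<in>{1..n}. 1 / (real g)\<^sup>2) \<le> 2 - 1 / real n" if "n > 0" for n using that
  proof (induction n)
    case (Suc n)
    show ?case
    proof (cases "n = 0")
      case False
      have "1 / (real (Suc n))\<^sup>2 \<le> 1 / (real n * real (Suc n))"
        using False by (intro divide_left_mono) (auto simp: power2_eq_square)
      also have "\<dots> = 1 / real n - 1 / real (Suc n)" using False by (simp add: field_simps)
      finally show ?thesis using Suc False by simp
    qed simp
  qed simp
  moreover have "2 - 1 / real n \<le> 2" by simp
  ultimately show ?thesis by (cases "n = 0") (simp, metis neq0_conv order_trans)
qed

lemma harmonic_sum_le: "N > 0 \<Longrightarrow> (\<Sum>g\<in>{1..N}. 1 / real g) \<le> 1 + ln (real N)"
proof (induction N)
  case (Suc n)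
  show ?case
  proof (cases "n = 0")
    case False
    have "ln (real n / real (Suc n)) \<le> real n / real (Suc n) - 1" using False by (intro ln_le_minus_one) auto
    then have "1 / real (Suc n) \<le> ln (real (Suc n)) - ln (real n)" using False by (simp add: ln_div field_simps)
    then show ?thesis using Suc False by simp
  qed simp
qed simp

definition pair_count :: "real \<Rightarrow> nat set \<Rightarrow> nat \<Rightarrow> real" where
  "pair_count T M N = energy (2 * pi / T) (M \<times> {1..N}) log_prod (\<lambda>_. 1)"

lemma pair_count_eq:
  "pair_count T M N = (\<Sum>m1\<in>M. \<Sum>m2\<in>M. close_sum (2 * pi / T) {1..N} (\<lambda>_. 1) (ln (real m2) - ln (real m1)))"
proof -
  have "(\<lambda>_::nat \<times> nat. 1::real) = (\<lambda>(m, n). 1)" by auto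
  then show ?thesis unfolding pair_count_def by (simp only: energy_log_prod)
qed

lemma pair_count_nonneg: "pair_count T M N \<ge> 0"
  unfolding pair_count_def by (intro energy_nonneg) auto

text \<open>
  A greatest common divisor \<open>g \<le> N / B\<close> leaves reduced fractions with terms up to \<open>N / g\<close>, counted by
  their spacing. For \<open>g > N / B\<close> the spacing is too expensive (its trivial term \<open>1\<close> would be counted
  \<open>N\<close> times), so coprimality is forgotten and the solutions are counted by \<open>pair_count\<close> at
  \<open>N div g < B\<close>, where the hypothesis applies.
\<close>

lemma pair_count_step:
  assumes T: "T > 0" and B: "B \<ge> 1" and N: "N > 0" and F: "F \<ge> 0"
    and FB: "\<And>Y. 0 < Y \<Longrightarrow> real Y \<le> B \<Longrightarrow> pair_count T M Y \<le> F * real Y"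
  shows "pair_count T M N \<le> (real (card M))\<^sup>2 * (real N / B + 8 * pi / T * (real N)\<^sup>2) + real N * F * (1 + ln (real N))"
proof -
  define d where "d = 2 * pi / T"
  have d: "d \<ge> 0" using T by (simp add: d_def)
  define G1 where "G1 = {g\<in>{1..N}. real g \<le> real N / B}"
  define G2 where "G2 = {g\<in>{1..N}. \<not> real g \<le> real N / B}"
  have split: "close_sum d {1..N} (\<lambda>_. 1) \<theta> \<le> (real N / B + 4 * d * (real N)\<^sup>2) + (\<Sum>g\<in>G2. close_sum d {1..N div g} (\<lambda>_. 1) \<theta>)" for \<theta>
  proof -
    have "close_sum d {1..N} (\<lambda>_. 1) \<theta> = (\<Sum>g\<in>G1. real (card (close_coprime d (N div g) \<theta>))) + (\<Sum>g\<in>G2. real (card (close_coprime d (N div g) \<theta>)))"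
      unfolding close_sum_gcd by (subst sum.union_disjoint[symmetric]) (auto simp: G1_def G2_def intro!: sum.cong)
    also have "(\<Sum>g\<in>G1. real (card (close_coprime d (N div g) \<theta>))) \<le> (\<Sum>g\<in>G1. 1 + 2 * d * (real N)\<^sup>2 * (1 / (real g)\<^sup>2))"
    proof (intro sum_mono)
      fix g assume g: "g \<in> G1"
      have "real (N div g) \<le> real N / real g" by (rule of_nat_div_le_of_nat)
      then have "(real (N div g))\<^sup>2 \<le> (real N / real g)\<^sup>2" by (intro power_mono) auto
      then have "2 * d * (real (N div g))\<^sup>2 \<le> 2 * d * (real N / real g)\<^sup>2" using d by (intro mult_left_mono) auto
      then show "real (card (close_coprime d (N div g) \<theta>)) \<le> 1 + 2 * d * (real N)\<^sup>2 * (1 / (real g)\<^sup>2)"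
        using card_close_coprime_le[OF d, of "N div g" \<theta>] by (simp add: power_divide)
    qed
    also have "\<dots> = real (card G1) + 2 * d * (real N)\<^sup>2 * (\<Sum>g\<in>G1. 1 / (real g)\<^sup>2)"
      by (simp add: sum.distrib sum_distrib_left)
    also have "\<dots> \<le> real N / B + 2 * d * (real N)\<^sup>2 * 2"
    proof (intro add_mono mult_left_mono)
      have "G1 \<subseteq> {1..nat \<lfloor>real N / B\<rfloor>}" unfolding G1_def using B by (auto simp: le_nat_floor)
      then have "card G1 \<le> card {1..nat \<lfloor>real N / B\<rfloor>}" by (intro card_mono) auto
      moreover have "real N / B \<ge> 0" using B by simp
      ultimately show "real (card G1) \<le> real N / B" by (simp, linarith)
      have "(\<Sum>g\<in>G1. 1 / (real g)\<^sup>2) \<le> (\<Sum>g\<in>{1..N}. 1 / (real g)\<^sup>2)"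
        by (intro sum_mono2) (auto simp: G1_def)
      then show "(\<Sum>g\<in>G1. 1 / (real g)\<^sup>2) \<le> 2" using sum_inverse_squares_le[of N] by linarith
    qed (use d in auto)
    also have "(\<Sum>g\<in>G2. real (card (close_coprime d (N div g) \<theta>))) \<le> (\<Sum>g\<in>G2. close_sum d {1..N div g} (\<lambda>_. 1) \<theta>)"
      by (intro sum_mono card_close_coprime_le_close_sum)
    finally show ?thesis by simp
  qed
  have "pair_count T M N \<le> (\<Sum>m1\<in>M. \<Sum>m2\<in>M. (real N / B + 4 * d * (real N)\<^sup>2) + (\<Sum>g\<in>G2. close_sum d {1..N div g} (\<lambda>_. 1) (ln (real m2) - ln (real m1))))"
    unfolding pair_count_eq d_def[symmetric] by (intro sum_mono split)
  also have "\<dots> = (real (card M))\<^sup>2 * (real N / B + 4 * d * (real N)\<^sup>2) +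
      (\<Sum>g\<in>G2. pair_count T M (N div g))"
  proof -
    have "(\<Sum>m1\<in>M. \<Sum>m2\<in>M. \<Sum>g\<in>G2. f m1 m2 g) = (\<Sum>g\<in>G2. \<Sum>m1\<in>M. \<Sum>m2\<in>M. f m1 m2 g)" for f :: "nat \<Rightarrow> nat \<Rightarrow> nat \<Rightarrow> real"
      by (subst sum.swap, subst (2) sum.swap) (rule refl)
    then show ?thesis unfolding pair_count_eq d_def[symmetric] sum.distrib by (simp add: power2_eq_square distrib_left mult_ac)
  qed
  also have "(\<Sum>g\<in>G2. pair_count T M (N div g)) \<le> (\<Sum>g\<in>G2. F * real N * (1 / real g))"
  proof (intro sum_mono)
    fix g assume g: "g \<in> G2"
    have le: "real (N div g) \<le> real N / real g" by (rule of_nat_div_le_of_nat)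
    have "real N / real g \<le> B" using g B by (auto simp: G2_def field_simps)
    moreover have "N div g > 0" using g by (auto simp: G2_def div_greater_zero_iff)
    ultimately have "pair_count T M (N div g) \<le> F * real (N div g)" using le by (intro FB) auto
    also have "\<dots> \<le> F * (real N / real g)" using le F by (intro mult_left_mono) auto
    finally show "pair_count T M (N div g) \<le> F * real N * (1 / real g)" by simp
  qed
  also have "(\<Sum>g\<in>G2. F * real N * (1 / real g)) = F * real N * (\<Sum>g\<in>G2. 1 / real g)" by (simp only: sum_distrib_left)
  also have "F * real N * (\<Sum>g\<in>G2. 1 / real g) \<le> F * real N * (1 + ln (real N))"
  proof (intro mult_left_mono)
    have "(\<Sum>g\<in>G2. 1 / real g) \<le> (\<Sum>g\<in>{1..N}. 1 / real g)" by (intro sum_mono2) (auto simp: G2_def)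
    also have "\<dots> \<le> 1 + ln (real N)" using N by (rule harmonic_sum_le)
    finally show "(\<Sum>g\<in>G2. 1 / real g) \<le> 1 + ln (real N)" .
  qed (use F in auto)
  finally show ?thesis by (simp add: d_def mult_ac)
qed

lemma expsum_log_square:
  "(expsum {1..Y} (\<lambda>n. ln (real n)) (\<lambda>_. 1) t)\<^sup>2
     = expsum {1..Y\<^sup>2} (\<lambda>n. ln (real n)) (\<lambda>n. of_nat (card {(a, b). a \<in> {1..Y} \<and> b \<in> {1..Y} \<and> a * b = n})) t"
proof -
  have "(expsum {1..Y} (\<lambda>n. ln (real n)) (\<lambda>_. 1) t)\<^sup>2 = (\<Sum>(a,b)\<in>{1..Y} \<times> {1..Y}. cis (- (ln (real (a * b)) * t)))"
    unfolding power2_eq_square expsum_def sum_product sum.cartesian_product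
    by (intro sum.cong refl) (auto simp: cis_mult ln_mult algebra_simps)
  also have "\<dots> = (\<Sum>n\<in>{1..Y\<^sup>2}. \<Sum>(a,b)\<in>{x \<in> {1..Y} \<times> {1..Y}. fst x * snd x = n}. cis (- (ln (real (a * b)) * t)))"
  proof (rule sum.group[symmetric])
    show "(\<lambda>x. fst x * snd x) ` ({1..Y} \<times> {1..Y}) \<subseteq> {1..Y\<^sup>2}"
      by (auto simp: power2_eq_square intro: mult_mono)
  qed auto
  also have "\<dots> = expsum {1..Y\<^sup>2} (\<lambda>n. ln (real n)) (\<lambda>n. of_nat (card {(a, b). a \<in> {1..Y} \<and> b \<in> {1..Y} \<and> a * b = n})) t"
    unfolding expsum_def
  proof (intro sum.cong refl)
    fix n
    have "(\<Sum>(a,b)\<in>{x \<in> {1..Y} \<times> {1..Y}. fst x * snd x = n}. cis (- (ln (real (a * b)) * t)))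
       = (\<Sum>(a,b)\<in>{x \<in> {1..Y} \<times> {1..Y}. fst x * snd x = n}. cis (- (ln (real n) * t)))"
      by (intro sum.cong refl) auto
    also have "\<dots> = of_nat (card {x \<in> {1..Y} \<times> {1..Y}. fst x * snd x = n}) * cis (- (ln (real n) * t))"
      by (simp add: case_prod_beta)
    moreover have "{x \<in> {1..Y} \<times> {1..Y}. fst x * snd x = n} = {(a, b). a \<in> {1..Y} \<and> b \<in> {1..Y} \<and> a * b = n}" by auto
    ultimately show "(\<Sum>(a,b)\<in>{x \<in> {1..Y} \<times> {1..Y}. fst x * snd x = n}. cis (- (ln (real (a * b)) * t)))
       = of_nat (card {(a, b). a \<in> {1..Y} \<and> b \<in> {1..Y} \<and> a * b = n}) * cis (- (ln (real n) * t))" by simp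
  qed
  finally show ?thesis .
qed

lemma card_factorizations_le:
  fixes n Y :: nat
  assumes "n > 0"
  shows "card {(a, b). a \<in> {1..Y} \<and> b \<in> {1..Y} \<and> a * b = n} \<le> card {d. d dvd n}"
proof (rule card_inj_on_le[where f = fst])
  show "inj_on fst {(a, b). a \<in> {1..Y} \<and> b \<in> {1..Y} \<and> a * b = n}"
  proof (rule inj_onI)
    fix x y
    assume "x \<in> {(a, b). a \<in> {1..Y} \<and> b \<in> {1..Y} \<and> a * b = n}"
      and "y \<in> {(a, b). a \<in> {1..Y} \<and> b \<in> {1..Y} \<and> a * b = n}" and "fst x = fst y"
    then have "fst x * snd x = n" "fst x * snd y = n" "fst x \<in> {1..Y}" by (auto simp: case_prod_beta)
    then have "snd x = snd y" by auto
    then show "x = y" using \<open>fst x = fst y\<close> by (rule prod_eqI[rotated])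
  qed
qed (use assms in auto)

lemma energy_const: "energy d A l (\<lambda>_. D) = D\<^sup>2 * energy d A l (\<lambda>_. 1)"
  unfolding energy_def sum_distrib_left
  by (rule sum.cong[OF refl], rule sum.cong[OF refl]) (simp add: power2_eq_square)

text \<open>
  Squaring the polynomial over \<open>n \<le> Y\<close> doubles the length on the logarithmic scale at the cost of
  coefficients that count factorizations, hence are at most \<open>D\<close>. The inequality
  \<open>|Q|\<^sup>2 \<le> \<mu> + |Q|\<^sup>4 / \<mu>\<close> replaces Cauchy-Schwarz and leaves \<open>\<mu>\<close> free.
\<close>

lemma pair_count_square:
  assumes adm: "admissible_set T M \<epsilon>" and lam: "\<mu> > 0"
    and D: "\<And>n. 0 < n \<Longrightarrow> n \<le> Y\<^sup>2 \<Longrightarrow> real (card {d. d dvd n}) \<le> D"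
  shows "pair_count T M Y \<le> 52480 * \<mu> * real (card M) + 1280 * D\<^sup>2 / \<mu> * pair_count T M (Y\<^sup>2)"
proof -
  note fin = admissible_set_finite[OF adm]
  have T: "T > 0" using fin by simp
  let ?ln = "\<lambda>n. ln (real n)"
  define m where "m t = cmod (expsum M ?ln (\<lambda>_. 1) t)" for t
  define q where "q t = cmod (expsum {1..Y} ?ln (\<lambda>_. 1) t)" for t
  have cont: "continuous_on S m" "continuous_on S q" for S unfolding m_def q_def by (intro continuous_intros)+
  have "T * pair_count T M Y \<le> 32 * integral {0..T} (\<lambda>t. (cmod (expsum (M \<times> {1..Y}) log_prod (\<lambda>_. 1) t))\<^sup>2)"
    unfolding pair_count_def using energy_le_mean_square[of "M \<times> {1..Y}" T "\<lambda>_. 1" log_prod] fin T by simp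
  also have "(\<lambda>t. (cmod (expsum (M \<times> {1..Y}) log_prod (\<lambda>_. 1) t))\<^sup>2) = (\<lambda>t. (m t * q t)\<^sup>2)"
    unfolding m_def q_def norm_mult[symmetric] expsum_mult_log by (simp add: case_prod_unfold)
  also have "integral {0..T} (\<lambda>t. (m t * q t)\<^sup>2) \<le> integral {0..T} (\<lambda>t. \<mu> * (m t)\<^sup>2 + 1 / \<mu> * (m t * (q t)\<^sup>2)\<^sup>2)"
  proof (intro integral_le integrable_continuous_real continuous_intros cont)
    fix t
    have "2 * \<mu> * (q t)\<^sup>2 \<le> \<mu>\<^sup>2 + ((q t)\<^sup>2)\<^sup>2" by (rule sum_squares_bound)
    moreover have "2 * \<mu> * (q t)\<^sup>2 \<ge> \<mu> * (q t)\<^sup>2" using lam by simp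
    ultimately have "\<mu> * (q t)\<^sup>2 \<le> \<mu>\<^sup>2 + ((q t)\<^sup>2)\<^sup>2" by linarith
    then have "1 / \<mu> * (\<mu> * (q t)\<^sup>2) \<le> 1 / \<mu> * (\<mu>\<^sup>2 + ((q t)\<^sup>2)\<^sup>2)" using lam by (intro mult_left_mono) auto
    then have "(q t)\<^sup>2 \<le> \<mu> + 1 / \<mu> * ((q t)\<^sup>2)\<^sup>2" using lam by (simp add: distrib_left power2_eq_square)
    then have "(m t)\<^sup>2 * (q t)\<^sup>2 \<le> (m t)\<^sup>2 * (\<mu> + 1 / \<mu> * ((q t)\<^sup>2)\<^sup>2)" by (intro mult_left_mono) auto
    then show "(m t * q t)\<^sup>2 \<le> \<mu> * (m t)\<^sup>2 + 1 / \<mu> * (m t * (q t)\<^sup>2)\<^sup>2"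
      by (simp add: power_mult_distrib algebra_simps)
  qed
  also have "\<dots> = \<mu> * integral {0..T} (\<lambda>t. (m t)\<^sup>2) + 1 / \<mu> * integral {0..T} (\<lambda>t. (m t * (q t)\<^sup>2)\<^sup>2)"
    using lam by (subst integral_add) (auto intro!: integrable_continuous_real continuous_intros cont)
  also have "integral {0..T} (\<lambda>t. (m t)\<^sup>2) \<le> 1640 * T * real (card M)"
    unfolding m_def by (rule mean_square_M_le[OF adm])
  also have "integral {0..T} (\<lambda>t. (m t * (q t)\<^sup>2)\<^sup>2) \<le> 40 * T * (D\<^sup>2 * pair_count T M (Y\<^sup>2))"
  proof -
    let ?r = "\<lambda>n. of_nat (card {(a, b). a \<in> {1..Y} \<and> b \<in> {1..Y} \<and> a * b = n}) :: complex"
    have "m t * (q t)\<^sup>2 = cmod (expsum (M \<times> {1..Y\<^sup>2}) log_prod (\<lambda>(_, n). ?r n) t)" for t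
      unfolding m_def q_def norm_power[symmetric] expsum_log_square norm_mult[symmetric] expsum_mult_log by simp
    then have "integral {0..T} (\<lambda>t. (m t * (q t)\<^sup>2)\<^sup>2)
       = integral {0..T} (\<lambda>t. (cmod (expsum (M \<times> {1..Y\<^sup>2}) log_prod (\<lambda>(_, n). ?r n) t))\<^sup>2)" by simp
    also have "\<dots> \<le> 40 * T * energy (2 * pi / T) (M \<times> {1..Y\<^sup>2}) log_prod (\<lambda>_. D)"
    proof (rule mean_square_le_energy)
      fix x assume "x \<in> M \<times> {1..Y\<^sup>2}"
      then obtain k n where x: "x = (k, n)" "0 < n" "n \<le> Y\<^sup>2" by auto
      then show "cmod ((\<lambda>(_, n). ?r n) x) \<le> D"
        using card_factorizations_le[of n Y] D[of n]
        by (simp only: case_prod_conv norm_of_nat x) (meson of_nat_le_iff order_trans)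
    qed (use fin T in auto)
    finally show ?thesis unfolding pair_count_def energy_const[of _ _ _ D] .
  qed
  finally have "T * pair_count T M Y \<le> 32 * (\<mu> * (1640 * T * real (card M)) + 1 / \<mu> * (40 * T * (D\<^sup>2 * pair_count T M (Y\<^sup>2))))"
    using lam by (simp add: add_mono mult_left_mono divide_right_mono)
  also have "\<dots> = T * (52480 * \<mu> * real (card M) + 1280 * D\<^sup>2 / \<mu> * pair_count T M (Y\<^sup>2))"
    by (simp add: algebra_simps)
  finally show ?thesis using T by (simp only: mult_le_cancel_left_pos)
qed

text \<open>
  At the \<open>y0 \<le> B\<close> that maximises \<open>F = E(y0) / y0\<close>, squaring expresses \<open>E(y0)\<close> through \<open>E(y0\<^sup>2)\<close>, which
  \<open>pair_count_step\<close> bounds in terms of \<open>F\<close> again. Here \<open>\<mu>\<close> is large enough for the coefficient of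
  \<open>F\<close> to be at most \<open>1/2\<close>. The parameter \<open>K\<close> trades the two remaining terms against each other.
\<close>

lemma pair_count_le_small_range:
  assumes adm: "admissible_set T M \<epsilon>" and B: "B \<ge> 1" and K: "K \<ge> 1" and D1: "D \<ge> 1"
    and D: "\<And>n. 0 < n \<Longrightarrow> real n \<le> B\<^sup>2 \<Longrightarrow> real (card {d. d dvd n}) \<le> D"
    and Y: "0 < Y" "real Y \<le> B"
  shows "pair_count T M Y \<le> (268697600 * (D\<^sup>2 * (1 + 2 * ln B)) * K * real (card M)
            + (real (card M))\<^sup>2 * (1 / B + 8 * pi / T * B\<^sup>2) / K) * real Y"
proof -
  note fin = admissible_set_finite[OF adm]
  have T: "T > 0" using fin by simp
  define R where "R = real (card M)"
  define X where "X = R\<^sup>2 * (1 / B + 8 * pi / T * B\<^sup>2)"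
  define L where "L = 1 + 2 * ln B"
  have L1: "L \<ge> 1" using B by (simp add: L_def)
  have X0: "X \<ge> 0" using B T by (simp add: X_def)
  define S where "S = {1..nat \<lfloor>B\<rfloor>}"
  have S: "y \<in> S \<longleftrightarrow> 0 < y \<and> real y \<le> B" for y using B by (auto simp: S_def le_nat_floor) linarith
  define f where "f y = pair_count T M y / real y" for y
  define F where "F = Max (f ` S)"
  have "Y \<in> S" using S Y by blast
  then have finS: "finite (f ` S)" "f ` S \<noteq> {}" unfolding S_def by blast+
  then have "F \<in> f ` S" unfolding F_def by (rule Max_in)
  then obtain y0 where y0: "0 < y0" "real y0 \<le> B" and Fy0: "F = f y0" using S by auto
  have F0: "F \<ge> 0" unfolding Fy0 f_def by (simp add: pair_count_nonneg)
  have FB: "pair_count T M y \<le> F * real y" if "0 < y" "real y \<le> B" for y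
  proof -
    have "f y \<le> F" unfolding F_def using that S finS by (intro Max_ge) auto
    then show ?thesis using that by (simp add: f_def field_simps)
  qed
  \<comment> \<open>With this choice the factor \<open>1280 * D\<^sup>2 / \<mu>\<close> from squaring equals \<open>1 / (2 * L * K)\<close>.\<close>
  define \<mu> where "\<mu> = 2560 * D\<^sup>2 * L * K"
  have DLK: "D\<^sup>2 * L * K > 0" using D1 L1 K by simp
  have mu: "\<mu> > 0" using DLK by (simp add: \<mu>_def mult.assoc)
  have y0sq: "(real y0)\<^sup>2 \<le> B\<^sup>2" using y0 by (intro power_mono) auto
  have big: "pair_count T M (y0\<^sup>2) \<le> (real y0)\<^sup>2 * (X + F * L)"
  proof -
    have "pair_count T M (y0\<^sup>2) \<le> (real (card M))\<^sup>2 * (real (y0\<^sup>2) / B + 8 * pi / T * (real (y0\<^sup>2))\<^sup>2) + real (y0\<^sup>2) * F * (1 + ln (real (y0\<^sup>2)))"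
      by (rule pair_count_step[OF T B _ F0 FB]) (use y0 in auto)
    also have "\<dots> = (real y0)\<^sup>2 * (R\<^sup>2 * (1 / B + 8 * pi / T * (real y0)\<^sup>2) + F * (1 + ln (real (y0\<^sup>2))))"
      by (simp add: R_def algebra_simps power2_eq_square)
    also have "\<dots> \<le> (real y0)\<^sup>2 * (R\<^sup>2 * (1 / B + 8 * pi / T * B\<^sup>2) + F * L)"
    proof -
      have "ln (real (y0\<^sup>2)) = 2 * ln (real y0)" using y0 by (simp add: ln_realpow)
      also have "\<dots> \<le> 2 * ln B" using y0 B by simp
      finally have "1 + ln (real (y0\<^sup>2)) \<le> L" by (simp add: L_def)
      then show ?thesis using F0 T y0sq by (intro mult_left_mono add_mono) auto
    qed
    finally show ?thesis by (simp add: X_def)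
  qed
  have "pair_count T M y0 \<le> 52480 * (real y0 * \<mu>) * real (card M) + 1280 * D\<^sup>2 / (real y0 * \<mu>) * pair_count T M (y0\<^sup>2)"
  proof (rule pair_count_square[OF adm])
    fix n assume "0 < n" "n \<le> y0\<^sup>2"
    then have "real n \<le> B\<^sup>2" using y0sq by (metis of_nat_le_iff of_nat_power order_trans)
    then show "real (card {d. d dvd n}) \<le> D" using D \<open>0 < n\<close> by blast
  qed (use mu y0 in auto)
  also have "\<dots> \<le> 52480 * (real y0 * \<mu>) * R + 1280 * D\<^sup>2 / (real y0 * \<mu>) * ((real y0)\<^sup>2 * (X + F * L))"
    unfolding R_def using big mu y0 by (intro add_mono mult_left_mono divide_nonneg_nonneg) auto
  also have "\<dots> = real y0 * (52480 * \<mu> * R + 1280 * D\<^sup>2 / \<mu> * (X + F * L))"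
  proof -
    have "1280 * D\<^sup>2 / (real y0 * \<mu>) * ((real y0)\<^sup>2 * W) = real y0 * (1280 * D\<^sup>2 / \<mu> * W)" for W
      using y0 by (simp add: power2_eq_square)
    then show ?thesis by (simp only: distrib_left mult_ac)
  qed
  finally have "F \<le> 52480 * \<mu> * R + 1280 * D\<^sup>2 / \<mu> * (X + F * L)"
    using y0 unfolding Fy0 f_def by (simp add: divide_le_eq mult.commute)
  also have "1280 * D\<^sup>2 / \<mu> * (X + F * L) \<le> X / K / 2 + F / 2"
  proof -
    have "1280 * D\<^sup>2 / \<mu> = 1 / (2 * L * K)" using DLK D1 by (simp add: \<mu>_def)
    then have "1280 * D\<^sup>2 / \<mu> * (X + F * L) = 1 / (2 * L * K) * (X + F * L)" by (simp only:)
    also have "\<dots> = X / (2 * K * L) + F / (2 * K)"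
      using L1 K by (simp add: field_simps)
    also have "\<dots> \<le> X / (2 * K * 1) + F / (2 * 1)"
      using X0 F0 L1 K by (intro add_mono divide_left_mono mult_left_mono) auto
    finally show ?thesis by simp
  qed
  finally have "F \<le> 104960 * \<mu> * R + X / K" by simp
  then have "F * real Y \<le> (104960 * \<mu> * R + X / K) * real Y" by (intro mult_right_mono) auto
  moreover have "pair_count T M Y \<le> F * real Y" by (rule FB[OF Y])
  ultimately have "pair_count T M Y \<le> (104960 * \<mu> * R + X / K) * real Y" by linarith
  then show ?thesis by (simp add: \<mu>_def R_def X_def L_def mult_ac)
qed

lemma ln_le_powr_div:
  assumes "a > 0" "x \<ge> (1::real)"
  shows "ln x \<le> x powr a / a"
proof -
  have "a * ln x = ln (x powr a)" using assms by (simp add: ln_powr)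
  also have "\<dots> \<le> x powr a - 1" using assms by (intro ln_le_minus_one) auto
  finally show ?thesis using assms by (simp add: field_simps)
qed

text \<open>
  The bound with both parameters free. Applying \<open>pair_count_le_small_range\<close> with \<open>K\<close> enlarged by
  a power of \<open>N * T\<close> moves all losses of size \<open>(N * T) powr \<eta>\<close> onto the term \<open>N * R\<close>, so that the terms
  with \<open>R\<^sup>2\<close> stay free of them.
\<close>

theorem pair_count_le:
  assumes \<eta>: "\<eta> > (0::real)"
  shows "\<exists>C>0. \<forall>T M \<epsilon> N B K. admissible_set T M \<epsilon> \<and> 0 < N \<and> 1 \<le> B \<and> B \<le> T \<and> 1 \<le> K \<longrightarrow>
     pair_count T M N \<le> C * ((real (card M))\<^sup>2 * real N / B + (real (card M))\<^sup>2 * (real N)\<^sup>2 / T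
        + real N * (real N * T) powr \<eta> * K * real (card M) + real N * (real (card M))\<^sup>2 * B\<^sup>2 / (T * K))"
proof -
  \<comment> \<open>Seven factors of size \<open>(N * T) powr a\<close> arise: five from the divisor
      bound and the logarithm of the cut, two from \<open>1 + ln N\<close> and the enlarged \<open>K\<close>.\<close>
  define a where "a = \<eta> / 7"
  have a: "a > 0" using \<eta> by (simp add: a_def)
  obtain C1' where C1': "C1' > 0" "\<And>n. n > 0 \<Longrightarrow> real (card {d. d dvd n}) \<le> C1' * real n powr a"
    using card_divisors_le_powr[OF a] by blast
  define C1 where "C1 = max 1 C1'"
  have C1: "C1 \<ge> 1" "\<And>n. n > 0 \<Longrightarrow> real (card {d. d dvd n}) \<le> C1 * real n powr a"
  proof -
    fix n :: nat assume "n > 0"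
    then have "real (card {d. d dvd n}) \<le> C1' * real n powr a" by (rule C1')
    also have "\<dots> \<le> C1 * real n powr a" by (intro mult_right_mono) (auto simp: C1_def)
    finally show "real (card {d. d dvd n}) \<le> C1 * real n powr a" .
  qed (simp add: C1_def)
  define C2 where "C2 = C1\<^sup>2 * (1 + 2 / a)"
  define C3 where "C3 = 1 + 1 / a"
  have C3: "C3 \<ge> 1" using a by (simp add: C3_def)
  have C2: "C2 \<ge> 0" using a by (simp add: C2_def)
  define C where "C = 268697600 * C2 * C3\<^sup>2 + 60"
  have C60: "C \<ge> 60" using C2 by (simp add: C_def)
  show ?thesis
  proof (intro exI[of _ C] conjI allI impI)
    show "C > 0" using C60 by simp
    fix T M \<epsilon> N B K
    assume "admissible_set T M \<epsilon> \<and> 0 < (N::nat) \<and> 1 \<le> B \<and> B \<le> T \<and> (1::real) \<le> K"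
    then have adm: "admissible_set T M \<epsilon>" and N: "0 < N" and B: "1 \<le> B" "B \<le> T" and K: "1 \<le> K" by auto
    have T: "T \<ge> 20" using admissible_set_finite[OF adm] by simp
    define R where "R = real (card M)"
    have R0: "R \<ge> 0" by (simp add: R_def)
    define P where "P = (real N * T) powr a"
    have NT: "real N * T \<ge> 1" using N T mult_mono[of 1 "real N" 1 T] by simp
    have P1: "P \<ge> 1" unfolding P_def using NT a by (intro ge_one_powr_ge_zero) auto
    have TN: "T \<le> real N * T" using N T by simp
    have Ta: "T powr a \<le> P" unfolding P_def using TN T a by (intro powr_mono2) auto
    have T1a: "T powr a \<ge> 1" using T a by (intro ge_one_powr_ge_zero) auto
    have NN: "real N \<le> real N * T" using N T by simp
    have Na: "real N powr a \<le> P" unfolding P_def using NN N a by (intro powr_mono2) auto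
    define D where "D = C1 * (T powr a)\<^sup>2"
    have D1: "D \<ge> 1" unfolding D_def using C1 T1a mult_mono[of 1 C1 1 "(T powr a)\<^sup>2"] by simp
    have D: "real (card {d. d dvd n}) \<le> D" if "0 < n" "real n \<le> B\<^sup>2" for n
    proof -
      have "real n \<le> T\<^sup>2" using that B power_mono[of B T 2] by linarith
      then have "real n powr a \<le> (T\<^sup>2) powr a" using a by (intro powr_mono2) auto
      also have "\<dots> = (T powr a)\<^sup>2" using T by (simp add: power2_eq_square powr_mult)
      finally have "C1 * real n powr a \<le> D" unfolding D_def using C1 by (intro mult_left_mono) auto
      then show ?thesis using C1(2)[OF that(1)] by linarith
    qed
    have DL: "D\<^sup>2 * (1 + 2 * ln B) \<le> C2 * P ^ 5"
    proof -
      have "ln B \<le> ln T" using B by simp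
      also have "\<dots> \<le> T powr a / a" using a T by (intro ln_le_powr_div) auto
      also have "\<dots> \<le> P / a" using Ta a by (intro divide_right_mono) auto
      finally have "1 + 2 * ln B \<le> P + 2 * (P / a)" using P1 by linarith
      also have "\<dots> = (1 + 2 / a) * P" by (simp add: algebra_simps)
      finally have 1: "1 + 2 * ln B \<le> (1 + 2 / a) * P" .
      have "D \<le> C1 * P\<^sup>2" unfolding D_def using Ta C1 by (intro mult_left_mono power_mono) auto
      then have "D\<^sup>2 \<le> (C1 * P\<^sup>2)\<^sup>2" using D1 by (intro power_mono) auto
      then have "D\<^sup>2 * (1 + 2 * ln B) \<le> (C1 * P\<^sup>2)\<^sup>2 * ((1 + 2 / a) * P)"
        using 1 B by (intro mult_mono) auto
      also have "\<dots> = C2 * P ^ 5" by (simp add: C2_def power2_eq_square eval_nat_numeral mult_ac)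
      finally show ?thesis .
    qed
    define K' where "K' = K * (C3 * P)"
    have C3P: "C3 * P \<ge> 1" using C3 P1 mult_mono[of 1 C3 1 P] by simp
    have K': "K' \<ge> 1" unfolding K'_def using K C3P mult_mono[of 1 K 1 "C3 * P"] by simp
    define X where "X = R\<^sup>2 * (1 / B + 8 * pi / T * B\<^sup>2)"
    have X0: "X \<ge> 0" using B T by (simp add: X_def)
    define F where "F = 268697600 * (D\<^sup>2 * (1 + 2 * ln B)) * K' * R + X / K'"
    have F0: "F \<ge> 0" using B K' R0 X0 by (auto simp: F_def)
    have Fle: "F \<le> 268697600 * (C2 * P ^ 5) * K' * R + X / K'"
      unfolding F_def using DL K' R0 by (intro add_mono mult_right_mono mult_left_mono) auto
    have lnN: "1 + ln (real N) \<le> C3 * P"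
    proof -
      have "ln (real N) \<le> real N powr a / a" using a N by (intro ln_le_powr_div) auto
      also have "\<dots> \<le> P / a" using Na a by (intro divide_right_mono) auto
      finally have "1 + ln (real N) \<le> P + P / a" using P1 by linarith
      then show ?thesis by (simp add: C3_def algebra_simps)
    qed
    have "pair_count T M N \<le> (real (card M))\<^sup>2 * (real N / B + 8 * pi / T * (real N)\<^sup>2) + real N * F * (1 + ln (real N))"
      by (rule pair_count_step[OF _ B(1) N F0])
         (use pair_count_le_small_range[OF adm B(1) K' D1 D] T in \<open>auto simp: F_def X_def R_def\<close>)
    also have "\<dots> \<le> R\<^sup>2 * (real N / B + 8 * pi / T * (real N)\<^sup>2) + real N * (268697600 * (C2 * P ^ 5) * K' * R + X / K') * (C3 * P)"
      unfolding R_def[symmetric] using lnN Fle F0 N P1 by (intro add_mono mult_mono order_refl mult_nonneg_nonneg) auto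
    also have "real N * (268697600 * (C2 * P ^ 5) * K' * R + X / K') * (C3 * P)
        = 268697600 * C2 * C3\<^sup>2 * (real N * (P ^ 7) * K * R) + real N * (X / K)"
      using C3 P1 K by (simp add: K'_def field_simps power2_eq_square eval_nat_numeral)
    also have "P ^ 7 = (real N * T) powr \<eta>"
    proof -
      have "P ^ 7 = (real N * T) powr (of_nat 7 * a)" unfolding P_def using N T by (intro powr_power) auto
      then show ?thesis by (simp add: a_def)
    qed
    also have "R\<^sup>2 * (real N / B + 8 * pi / T * (real N)\<^sup>2) + (268697600 * C2 * C3\<^sup>2 * (real N * ((real N * T) powr \<eta>) * K * R) + real N * (X / K))
       \<le> C * (R\<^sup>2 * real N / B + R\<^sup>2 * (real N)\<^sup>2 / T + real N * (real N * T) powr \<eta> * K * R + real N * R\<^sup>2 * B\<^sup>2 / (T * K))"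
    proof -
      define t1 where "t1 = R\<^sup>2 * real N / B"
      define t2 where "t2 = R\<^sup>2 * (real N)\<^sup>2 / T"
      define t3 where "t3 = real N * (real N * T) powr \<eta> * K * R"
      define t4 where "t4 = real N * R\<^sup>2 * B\<^sup>2 / (T * K)"
      have t: "t1 \<ge> 0" "t2 \<ge> 0" "t3 \<ge> 0" "t4 \<ge> 0"
        using B T K R0 by (auto simp: t1_def t2_def t3_def t4_def)
      have "real N * (X / K) = t1 / K + 8 * pi * t4"
        using B T K by (simp add: X_def t1_def t4_def field_simps)
      also have "\<dots> \<le> t1 + 32 * t4"
        using t K pi_less_4 by (intro add_mono mult_right_mono) (auto simp: divide_le_eq mult_left_le mult_le_cancel_left1)
      finally have 1: "real N * (X / K) \<le> t1 + 32 * t4" .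
      have "R\<^sup>2 * (real N / B + 8 * pi / T * (real N)\<^sup>2) = t1 + 8 * pi * t2"
        by (simp add: t1_def t2_def algebra_simps)
      also have "\<dots> \<le> t1 + 32 * t2"
        using t pi_less_4 by (intro add_mono mult_right_mono) auto
      finally have 2: "R\<^sup>2 * (real N / B + 8 * pi / T * (real N)\<^sup>2) \<le> t1 + 32 * t2" .
      have "C * t1 \<ge> 60 * t1" "C * t2 \<ge> 60 * t2" "C * t4 \<ge> 60 * t4"
        using C60 t by (auto intro: mult_right_mono)
      moreover have "C * t3 \<ge> 268697600 * C2 * C3\<^sup>2 * t3" using t by (intro mult_right_mono) (auto simp: C_def)
      ultimately have "R\<^sup>2 * (real N / B + 8 * pi / T * (real N)\<^sup>2) + (268697600 * C2 * C3\<^sup>2 * t3 + real N * (X / K))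
         \<le> C * t1 + C * t2 + C * t3 + C * t4" using 1 2 t by linarith
      then show ?thesis by (simp add: distrib_left t1_def[symmetric] t2_def[symmetric] t3_def[symmetric] t4_def[symmetric])
    qed
    finally show "pair_count T M N \<le> C * ((real (card M))\<^sup>2 * real N / B + (real (card M))\<^sup>2 * (real N)\<^sup>2 / T
        + real N * (real N * T) powr \<eta> * K * real (card M) + real N * (real (card M))\<^sup>2 * B\<^sup>2 / (T * K))"
      unfolding R_def .
  qed
qed

lemma admissible_card_le:
  assumes "admissible_set T M \<epsilon>"
  shows "real (card M) \<le> T"
proof -
  have "M \<subseteq> {1..nat \<lfloor>T\<rfloor>}" using assms unfolding admissible_set_def by (auto simp: le_nat_floor Suc_le_eq)
  then have "card M \<le> nat \<lfloor>T\<rfloor>" using card_mono[of "{1..nat \<lfloor>T\<rfloor>}" M] by simp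
  then show ?thesis using admissible_set_finite[OF assms] by linarith
qed

section \<open>The mean value bounds that hold unconditionally\<close>

lemma dirichlet_poly_mult_Qpoly:
  assumes "admissible_set T M \<epsilon>"
  shows "dirichlet_poly M \<epsilon> (\<i> * of_real t) * Qpoly N q (\<i> * of_real t)
    = expsum (M \<times> {1..N}) log_prod (\<lambda>(m, n). \<epsilon> m * of_real (q n)) t"
  using admissible_set_finite[OF assms]
  by (simp add: Qpoly_def dirichlet_poly_imaginary expsum_mult_log)

theorem mean_I_le_count_J:
  assumes adm: "admissible_set T M \<epsilon>" and q: "admissible_coeffs N q"
  shows "mean_I T M \<epsilon> (Qpoly N q) \<le> 40 * (T * count_J T M N q)"
proof -
  note fin = admissible_set_finite[OF adm]
  have "mean_I T M \<epsilon> (Qpoly N q) \<le> 40 * T * energy (2 * pi / T) (M \<times> {1..N}) log_prod (\<lambda>(m, n). q n)"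
    unfolding mean_I_def dirichlet_poly_mult_Qpoly[OF adm]
  proof (rule mean_square_le_energy)
    fix x assume "x \<in> M \<times> {1..N}"
    then obtain m n where x: "x = (m, n)" "m \<in> M" "n \<in> {1..N}" by auto
    then have "cmod (\<epsilon> m) \<le> 1" "0 \<le> q n" using adm q by (auto simp: admissible_set_def admissible_coeffs_def)
    then show "cmod (case x of (m, n) \<Rightarrow> \<epsilon> m * of_real (q n)) \<le> (case x of (m, n) \<Rightarrow> q n)"
      by (simp add: x norm_mult mult_left_le_one_le)
  qed (use fin in auto)
  then show ?thesis using fin by (simp add: count_J_eq_energy)
qed

theorem count_J_le_mean_I:
  assumes adm: "admissible_set T M \<epsilon>" and q: "admissible_coeffs N q" and 1: "\<forall>m\<in>M. \<epsilon> m = 1"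
  shows "T * count_J T M N q \<le> 32 * mean_I T M \<epsilon> (Qpoly N q)"
proof -
  note fin = admissible_set_finite[OF adm]
  have "T * energy (2 * pi / T) (M \<times> {1..N}) log_prod (\<lambda>(m, n). q n)
     \<le> 32 * integral {0..T} (\<lambda>t. (cmod (expsum (M \<times> {1..N}) log_prod (\<lambda>x. of_real (case x of (m, n) \<Rightarrow> q n)) t))\<^sup>2)"
    by (rule energy_le_mean_square) (use fin q in \<open>auto simp: admissible_coeffs_def\<close>)
  also have "(\<lambda>t. expsum (M \<times> {1..N}) log_prod (\<lambda>x. of_real (case x of (m, n) \<Rightarrow> q n)) t)
      = (\<lambda>t. expsum (M \<times> {1..N}) log_prod (\<lambda>(m, n). \<epsilon> m * of_real (q n)) t)"
    unfolding expsum_def using 1 by (intro ext sum.cong) auto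
  then have "(\<lambda>t. (cmod (expsum (M \<times> {1..N}) log_prod (\<lambda>x. of_real (case x of (m, n) \<Rightarrow> q n)) t))\<^sup>2)
     = (\<lambda>t. (cmod (dirichlet_poly M \<epsilon> (\<i> * of_real t) * Qpoly N q (\<i> * of_real t)))\<^sup>2)"
    unfolding dirichlet_poly_mult_Qpoly[OF adm] by metis
  finally show ?thesis using fin by (simp add: count_J_eq_energy mean_I_def)
qed

text \<open>
  Replacing every \<open>q n\<close> by \<open>1\<close> can only increase the count.
\<close>

lemma mean_I_le_pair_count:
  assumes adm: "admissible_set T M \<epsilon>" and q: "admissible_coeffs N q"
  shows "mean_I T M \<epsilon> (Qpoly N q) \<le> 40 * T * pair_count T M N"
proof -
  note fin = admissible_set_finite[OF adm]
  have "count_J T M N q \<le> pair_count T M N"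
    unfolding pair_count_def count_J_eq_energy[OF fin(1,2)]
    by (rule energy_mono) (use fin q in \<open>auto simp: admissible_coeffs_def\<close>)
  then have "40 * (T * count_J T M N q) \<le> 40 * (T * pair_count T M N)" using fin by simp
  then show ?thesis using mean_I_le_count_J[OF adm q] by simp
qed

text \<open>
  With \<open>Z = R powr (7/4) * T powr (-1/4)\<close>, the cut \<open>B = (R * T) powr (1/4)\<close> gives
  \<open>R\<^sup>2 / B = Z\<close> and \<open>R\<^sup>2 * B\<^sup>2 / T = Z\<^sup>2 / R\<close>. Taking \<open>K = max 1 (Z / R)\<close> brings all terms of
  \<open>pair_count_le\<close> down to \<open>N * (R + Z)\<close>.
\<close>

theorem mean_I_unconditional:
  assumes \<eta>: "\<eta> > (0::real)"
  shows "\<exists>C>0. \<forall>T M \<epsilon> N q. admissible_set T M \<epsilon> \<and> admissible_coeffs N q \<longrightarrow>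
        mean_I T M \<epsilon> (Qpoly N q) \<le>
          C * ((real N)\<^sup>2 * (real (card M))\<^sup>2
               + (real N * T) powr \<eta> * (real N * real (card M) * T
                   + real N * real (card M) powr (7 / 4) * T powr (3 / 4)))"
proof -
  obtain C where C: "C > 0" and main: "\<And>T M \<epsilon> N B K. admissible_set T M \<epsilon> \<Longrightarrow> 0 < N \<Longrightarrow> 1 \<le> B \<Longrightarrow> B \<le> T \<Longrightarrow> 1 \<le> K \<Longrightarrow>
     pair_count T M N \<le> C * ((real (card M))\<^sup>2 * real N / B + (real (card M))\<^sup>2 * (real N)\<^sup>2 / T
        + real N * (real N * T) powr \<eta> * K * real (card M) + real N * (real (card M))\<^sup>2 * B\<^sup>2 / (T * K))"
    using pair_count_le[OF \<eta>] by blast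
  show ?thesis
  proof (intro exI[of _ "120 * C"] conjI allI impI)
    show "120 * C > 0" using C by simp
    fix T M \<epsilon> N q
    assume "admissible_set T M \<epsilon> \<and> admissible_coeffs N q"
    then have adm: "admissible_set T M \<epsilon>" and q: "admissible_coeffs N q" by auto
    note fin = admissible_set_finite[OF adm]
    have N: "N > 0" using q by (simp add: admissible_coeffs_def)
    have T: "T \<ge> 20" using fin by simp
    define R where "R = real (card M)"
    have RT: "R \<le> T" using admissible_card_le[OF adm] by (simp add: R_def)
    define Q where "Q = (real N * T) powr \<eta>"
    have NT: "real N * T \<ge> 1" using N T mult_mono[of 1 "real N" 1 T] by simp
    have Q1: "Q \<ge> 1" unfolding Q_def using NT \<eta> by (intro ge_one_powr_ge_zero) auto
    have "mean_I T M \<epsilon> (Qpoly N q) \<le> 120 * C * ((real N)\<^sup>2 * R\<^sup>2 + Q * (real N * R * T + real N * R powr (7/4) * T powr (3/4)))"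
    proof (cases "card M = 0")
      case True
      then have "M = {}" using fin by simp
      then show ?thesis by (simp add: mean_I_def dirichlet_poly_def R_def)
    next
      case False
      then have R1: "R \<ge> 1" by (simp add: R_def)
      define B where "B = (R * T) powr (1/4)"
      define Z where "Z = R powr (7/4) * T powr (-1/4)"
      define K where "K = max 1 (Z / R)"
      have RT1: "R * T \<ge> 1" using R1 T mult_mono[of 1 R 1 T] by simp
      have B1: "1 \<le> B" unfolding B_def using RT1 by (intro ge_one_powr_ge_zero) auto
      have BT: "B \<le> T"
      proof -
        have "R * T \<le> T * T" using RT T by (intro mult_right_mono) auto
        then have "B \<le> (T * T) powr (1/4)" unfolding B_def using RT1 by (intro powr_mono2) auto
        also have "\<dots> = T powr (1/2)" using T by (simp add: powr_mult powr_add[symmetric])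
        also have "\<dots> \<le> T powr 1" using T by (intro powr_mono) auto
        finally show ?thesis using T by simp
      qed
      have Z0: "Z > 0" using R1 T by (simp add: Z_def)
      have e1: "R\<^sup>2 / B = Z"
      proof -
        have "R\<^sup>2 = R powr 2" using R1 by simp
        then show ?thesis using R1 T unfolding B_def Z_def
          by (simp add: powr_mult powr_divide powr_minus divide_simps powr_add[symmetric])
      qed
      have e2: "R\<^sup>2 * B\<^sup>2 / T = Z\<^sup>2 / R"
      proof -
        have "B\<^sup>2 = R powr (1/2) * T powr (1/2)" using R1 T
          by (simp add: B_def powr_mult power_mult_distrib powr_power)
        moreover have "Z\<^sup>2 = R powr (7/2) * T powr (-1/2)" using R1 T
          by (simp add: Z_def powr_mult power_mult_distrib powr_power)
        moreover have "R\<^sup>2 * R powr (1/2) * R = R powr (7/2)"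
          using R1 powr_add[of R 3 "1/2"] by (simp add: eval_nat_numeral mult_ac)
        moreover have "T powr (1/2) = T powr (-1/2) * T"
          using T powr_add[of T "-1/2" 1] by simp
        ultimately show ?thesis using R1 T by (simp add: field_simps)
      qed
      have TZ: "T * Z = R powr (7/4) * T powr (3/4)"
        using T powr_add[of T "-1/4" 1] by (simp add: Z_def mult_ac)
      have K: "K \<ge> 1" "K * R \<le> R + Z" "Z\<^sup>2 / (R * K) \<le> Z"
      proof -
        show "K \<ge> 1" by (simp add: K_def)
        show "K * R \<le> R + Z" using R1 Z0 by (simp add: K_def max_def)
        have "Z / R \<le> K" by (simp add: K_def)
        then have "Z \<le> R * K" using R1 by (simp add: field_simps)
        then have "Z * Z \<le> Z * (R * K)" using Z0 by (intro mult_left_mono) auto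
        then show "Z\<^sup>2 / (R * K) \<le> Z" using R1 by (simp add: divide_le_eq power2_eq_square K_def)
      qed
      have "pair_count T M N \<le> C * (R\<^sup>2 * real N / B + R\<^sup>2 * (real N)\<^sup>2 / T + real N * Q * K * R + real N * R\<^sup>2 * B\<^sup>2 / (T * K))"
        using main[OF adm N B1 BT K(1)] unfolding R_def Q_def .
      also have "\<dots> = C * (real N * (R\<^sup>2 / B) + R\<^sup>2 * (real N)\<^sup>2 / T + real N * Q * (K * R) + real N * ((R\<^sup>2 * B\<^sup>2 / T) / K))"
        by (simp add: mult_ac)
      also have "\<dots> \<le> C * (real N * Z + R\<^sup>2 * (real N)\<^sup>2 / T + real N * Q * (R + Z) + real N * Z)"
        unfolding e1 e2 using K Q1 C by (intro mult_left_mono add_mono) auto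
      also have "\<dots> \<le> C * (R\<^sup>2 * (real N)\<^sup>2 / T + 3 * (real N * Q * (R + Z)))"
      proof -
        have "real N * Z \<le> real N * Q * (R + Z)"
          using Q1 Z0 R1 mult_mono[of 1 Q Z "R + Z"] by (simp add: mult.assoc mult_left_mono)
        then have "real N * Z + R\<^sup>2 * (real N)\<^sup>2 / T + real N * Q * (R + Z) + real N * Z
           \<le> R\<^sup>2 * (real N)\<^sup>2 / T + 3 * (real N * Q * (R + Z))" by linarith
        then show ?thesis using C by (intro mult_left_mono) auto
      qed
      finally have "40 * T * pair_count T M N \<le> 40 * T * (C * (R\<^sup>2 * (real N)\<^sup>2 / T + 3 * (real N * Q * (R + Z))))"
        using T by (intro mult_left_mono) auto
      also have "\<dots> = 40 * C * (R\<^sup>2 * (real N)\<^sup>2 + 3 * (Q * (real N * R * T + real N * (T * Z))))"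
        using T by (simp add: field_simps)
      also have "\<dots> \<le> 120 * C * ((real N)\<^sup>2 * R\<^sup>2 + Q * (real N * R * T + real N * R powr (7/4) * T powr (3/4)))"
        unfolding TZ using C by (simp add: algebra_simps)
      finally show ?thesis using mean_I_le_pair_count[OF adm q] by linarith
    qed
    then show "mean_I T M \<epsilon> (Qpoly N q) \<le>
          120 * C * ((real N)\<^sup>2 * (real (card M))\<^sup>2
               + (real N * T) powr \<eta> * (real N * real (card M) * T
                   + real N * real (card M) powr (7 / 4) * T powr (3 / 4)))" by (simp add: R_def Q_def)
  qed
qed

text \<open>
  For \<open>N \<ge> T powr (2/3)\<close> the cut \<open>B = T powr (1/3)\<close> makes both terms with \<open>B\<close> at most
  \<open>N\<^sup>2 * R\<^sup>2 / T\<close>. For \<open>R \<le> T powr (1/3)\<close> the second term of the general bound is dominated by the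
  first.
\<close>

theorem mean_I_extreme_ranges:
  assumes \<eta>: "\<eta> > (0::real)"
  shows "\<exists>C>0. \<forall>T M \<epsilon> N q. admissible_set T M \<epsilon> \<and> admissible_coeffs N q \<and>
        (real N \<ge> T powr (2 / 3) \<or> real (card M) \<le> T powr (1 / 3)) \<longrightarrow>
        mean_I T M \<epsilon> (Qpoly N q) \<le>
          C * ((real N)\<^sup>2 * (real (card M))\<^sup>2
               + (real N * T) powr \<eta> * (real N * real (card M) * T))"
proof -
  obtain C where C: "C > 0" and main: "\<And>T M \<epsilon> N B K. admissible_set T M \<epsilon> \<Longrightarrow> 0 < N \<Longrightarrow> 1 \<le> B \<Longrightarrow> B \<le> T \<Longrightarrow> 1 \<le> K \<Longrightarrow>
     pair_count T M N \<le> C * ((real (card M))\<^sup>2 * real N / B + (real (card M))\<^sup>2 * (real N)\<^sup>2 / T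
        + real N * (real N * T) powr \<eta> * K * real (card M) + real N * (real (card M))\<^sup>2 * B\<^sup>2 / (T * K))"
    using pair_count_le[OF \<eta>] by blast
  obtain C' where C': "C' > 0" and uncond: "\<And>T M \<epsilon> N q. admissible_set T M \<epsilon> \<Longrightarrow> admissible_coeffs N q \<Longrightarrow>
        mean_I T M \<epsilon> (Qpoly N q) \<le>
          C' * ((real N)\<^sup>2 * (real (card M))\<^sup>2
               + (real N * T) powr \<eta> * (real N * real (card M) * T
                   + real N * real (card M) powr (7 / 4) * T powr (3 / 4)))"
    using mean_I_unconditional[OF \<eta>] by blast
  show ?thesis
  proof (intro exI[of _ "120 * C + 2 * C'"] conjI allI impI)
    show "120 * C + 2 * C' > 0" using C C' by simp
    fix T M \<epsilon> N q
    assume asm: "admissible_set T M \<epsilon> \<and> admissible_coeffs N q \<and> (real N \<ge> T powr (2 / 3) \<or> real (card M) \<le> T powr (1 / 3))"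
    then have adm: "admissible_set T M \<epsilon>" and q: "admissible_coeffs N q" by auto
    note fin = admissible_set_finite[OF adm]
    have N: "N > 0" using q by (simp add: admissible_coeffs_def)
    have T: "T \<ge> 20" using fin by simp
    define R where "R = real (card M)"
    define Q where "Q = (real N * T) powr \<eta>"
    define E where "E = (real N)\<^sup>2 * R\<^sup>2 + Q * (real N * R * T)"
    have R0: "R \<ge> 0" by (simp add: R_def)
    have Q0: "Q \<ge> 0" by (simp add: Q_def)
    have E0: "E \<ge> 0" using R0 Q0 T by (auto simp: E_def)
    have "mean_I T M \<epsilon> (Qpoly N q) \<le> 120 * C * E \<or> mean_I T M \<epsilon> (Qpoly N q) \<le> 2 * C' * E"
    proof (cases "real N \<ge> T powr (2/3)")
      case True
      define B where "B = T powr (1/3)"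
      have B1: "1 \<le> B" unfolding B_def using T by (intro ge_one_powr_ge_zero) auto
      have BT: "B \<le> T" unfolding B_def using T powr_mono[of "1/3" 1 T] by simp
      have BN: "T / B = T powr (2/3)" "B\<^sup>2 = T powr (2/3)" using T
        by (simp_all add: B_def power2_eq_square powr_add[symmetric] powr_diff[symmetric] powr_mult_base powr_divide)
           (use powr_diff[of T 1 "1/3"] in simp)?
      have "pair_count T M N \<le> C * (R\<^sup>2 * real N / B + R\<^sup>2 * (real N)\<^sup>2 / T + real N * Q * 1 * R + real N * R\<^sup>2 * B\<^sup>2 / (T * 1))"
        using main[OF adm N B1 BT, of 1] unfolding R_def Q_def by simp
      then have "40 * T * pair_count T M N \<le> 40 * T * (C * (R\<^sup>2 * real N / B + R\<^sup>2 * (real N)\<^sup>2 / T + real N * Q * 1 * R + real N * R\<^sup>2 * B\<^sup>2 / (T * 1)))"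
        using T by (intro mult_left_mono) auto
      also have "\<dots> = 40 * C * (R\<^sup>2 * real N * (T / B) + R\<^sup>2 * (real N)\<^sup>2 + Q * (real N * R * T) + R\<^sup>2 * real N * B\<^sup>2)"
        using T B1 by (simp add: field_simps)
      also have "\<dots> \<le> 40 * C * (R\<^sup>2 * real N * real N + R\<^sup>2 * (real N)\<^sup>2 + Q * (real N * R * T) + R\<^sup>2 * real N * real N)"
        unfolding BN using True C R0 Q0 by (intro mult_left_mono add_mono) auto
      also have "\<dots> = 40 * C * (3 * ((real N)\<^sup>2 * R\<^sup>2) + Q * (real N * R * T))" by (simp add: power2_eq_square)
      also have "\<dots> \<le> 40 * C * (3 * E)" unfolding E_def using C R0 Q0 T by (intro mult_left_mono) auto
      finally show ?thesis using mean_I_le_pair_count[OF adm q] by linarith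
    next
      case False
      then have RT: "R \<le> T powr (1/3)" using asm by (auto simp: R_def)
      have "R powr (7/4) * T powr (3/4) \<le> R * T"
      proof (cases "R = 0")
        case False
        then have R: "R > 0" using R0 by simp
        have "R powr (3/4) \<le> (T powr (1/3)) powr (3/4)" using RT R by (intro powr_mono2) auto
        also have "\<dots> = T powr (1/4)" using T by (simp add: powr_powr)
        finally have "R * R powr (3/4) * T powr (3/4) \<le> R * T powr (1/4) * T powr (3/4)"
          using R by (intro mult_right_mono mult_left_mono) auto
        moreover have "R * R powr (3/4) = R powr (7/4)" using R powr_add[of R 1 "3/4"] by simp
        moreover have "T powr (1/4) * T powr (3/4) = T" using T powr_add[of T "1/4" "3/4"] by simp
        ultimately show ?thesis by (simp add: mult.assoc)
      qed simp
      then have "real N * (R powr (7/4) * T powr (3/4)) \<le> real N * (R * T)" by (intro mult_left_mono) auto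
      then have *: "Q * (real N * R * T + real N * R powr (7/4) * T powr (3/4)) \<le> Q * (2 * (real N * R * T))"
        using Q0 by (intro mult_left_mono) (auto simp: mult_ac)
      then have "(real N)\<^sup>2 * R\<^sup>2 + Q * (real N * R * T + real N * R powr (7/4) * T powr (3/4)) \<le> 2 * E"
      proof -
        have "(real N)\<^sup>2 * R\<^sup>2 + Q * (real N * R * T + real N * R powr (7/4) * T powr (3/4))
            \<le> 2 * ((real N)\<^sup>2 * R\<^sup>2) + Q * (2 * (real N * R * T))" using * by (intro add_mono) auto
        also have "\<dots> = 2 * E" unfolding E_def by (simp only: distrib_left mult.left_commute)
        finally show ?thesis .
      qed
      then have "C' * ((real N)\<^sup>2 * R\<^sup>2 + Q * (real N * R * T + real N * R powr (7/4) * T powr (3/4))) \<le> C' * (2 * E)"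
        using C' by (intro mult_left_mono) auto
      then show ?thesis using uncond[OF adm q] unfolding R_def Q_def by linarith
    qed
    moreover have "120 * C * E \<le> (120 * C + 2 * C') * E" "2 * C' * E \<le> (120 * C + 2 * C') * E"
      using C C' E0 by (auto intro: mult_right_mono)
    ultimately have "mean_I T M \<epsilon> (Qpoly N q) \<le> (120 * C + 2 * C') * E" by linarith
    then show "mean_I T M \<epsilon> (Qpoly N q) \<le> (120 * C + 2 * C') * ((real N)\<^sup>2 * (real (card M))\<^sup>2
               + (real N * T) powr \<eta> * (real N * real (card M) * T))"
      by (simp add: E_def R_def Q_def)
  qed
qed

section \<open>Powers of a Dirichlet polynomial over primes\<close>

text \<open>
  The number of ways to write \<open>n\<close> as an ordered product of \<open>k\<close> elements of \<open>P\<close>, that is, the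
  coefficients of the \<open>k\<close>-th power of \<open>\<Sum>p\<in>P. p powr (- s)\<close>. The recursion splits off the first factor.
\<close>

fun prod_reps :: "nat set \<Rightarrow> nat \<Rightarrow> nat \<Rightarrow> nat" where
  "prod_reps P 0 n = (if n = 1 then 1 else 0)"
| "prod_reps P (Suc k) n = (\<Sum>p\<in>{p\<in>P. p dvd n}. prod_reps P k (n div p))"

lemma prod_reps_support:
  assumes "\<And>p. p \<in> P \<Longrightarrow> 0 < p \<and> p \<le> y" and "prod_reps P k n \<noteq> 0"
  shows "0 < n \<and> n \<le> y ^ k"
  using assms(2)
proof (induction k arbitrary: n)
  case 0 then show ?case by (auto split: if_splits)
next
  case (Suc k)
  obtain p where "p \<in> {p\<in>P. p dvd n}" "prod_reps P k (n div p) \<noteq> 0"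
    using Suc.prems unfolding prod_reps.simps(2) by (rule sum.not_neutral_contains_not_neutral)
  then have p: "p \<in> P" "p dvd n" "prod_reps P k (n div p) \<noteq> 0" by auto
  have "0 < n div p" "n div p \<le> y ^ k" using Suc.IH[OF p(3)] by auto
  moreover have "0 < p" "p \<le> y" using assms(1) p(1) by auto
  ultimately have "0 < p * (n div p)" "p * (n div p) \<le> y * y ^ k" by (auto intro: mult_le_mono)
  then show ?case using p(2) by simp
qed

lemma expsum_primes_power:
  assumes P: "finite P" "\<And>p. p \<in> P \<Longrightarrow> 0 < p \<and> p \<le> y" and Y: "y ^ k \<le> Y"
  shows "(expsum P (\<lambda>n. ln (real n)) (\<lambda>_. 1) t) ^ k
     = expsum {1..Y} (\<lambda>n. ln (real n)) (\<lambda>n. of_nat (prod_reps P k n)) t"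
  using Y
proof (induction k arbitrary: Y)
  case 0
  then have "expsum {1..Y} (\<lambda>n. ln (real n)) (\<lambda>n. of_nat (prod_reps P 0 n)) t
     = (\<Sum>n\<in>{1}. of_nat (prod_reps P 0 n) * cis (- (ln (real n) * t)))"
    unfolding expsum_def by (intro sum.mono_neutral_right) auto
  then show ?case by simp
next
  case (Suc k)
  let ?r = "prod_reps P k"
  let ?e = "\<lambda>n. cis (- (ln (real n) * t))"
  have "(expsum P (\<lambda>n. ln (real n)) (\<lambda>_. 1) t) ^ Suc k
     = (\<Sum>p\<in>P. ?e p) * (\<Sum>n\<in>{1..y ^ k}. of_nat (?r n) * ?e n)"
    using Suc.IH[OF order_refl] by (simp add: expsum_def)
  also have "\<dots> = (\<Sum>(p, n)\<in>P \<times> {1..y ^ k}. of_nat (?r n) * ?e (p * n))"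
    unfolding sum_product sum.cartesian_product
  proof (intro sum.cong refl, clarify)
    fix p n assume "p \<in> P" "n \<in> {1..y ^ k}"
    then have "p > 0" "n > 0" using P(2) by auto
    then have "?e (p * n) = ?e p * ?e n" by (simp add: ln_mult cis_mult algebra_simps)
    then show "?e p * (of_nat (?r n) * ?e n) = of_nat (?r n) * ?e (p * n)" by (simp only: mult.left_commute)
  qed
  also have "\<dots> = (\<Sum>m\<in>{1..Y}. \<Sum>(p, n)\<in>{x\<in>P \<times> {1..y ^ k}. fst x * snd x = m}. of_nat (?r n) * ?e (p * n))"
  proof (rule sum.group[symmetric])
    show "(\<lambda>x. fst x * snd x) ` (P \<times> {1..y ^ k}) \<subseteq> {1..Y}"
    proof (intro image_subsetI)
      fix x assume "x \<in> P \<times> {1..y ^ k}"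
      then have x: "0 < fst x" "fst x \<le> y" "0 < snd x" "snd x \<le> y ^ k" using P(2) by auto
      then have "fst x * snd x \<le> y ^ Suc k" by (simp add: mult_le_mono)
      then show "fst x * snd x \<in> {1..Y}" using Suc.prems x by simp
    qed
  qed (use P in auto)
  also have "\<dots> = (\<Sum>m\<in>{1..Y}. of_nat (prod_reps P (Suc k) m) * ?e m)"
  proof (intro sum.cong refl)
    fix m assume m: "m \<in> {1..Y}"
    have "(\<Sum>(p, n)\<in>{x\<in>P \<times> {1..y ^ k}. fst x * snd x = m}. of_nat (?r n) * ?e (p * n))
        = (\<Sum>x\<in>{x\<in>P \<times> {1..y ^ k}. fst x * snd x = m}. of_nat (?r (snd x))) * ?e m"
      unfolding sum_distrib_right by (intro sum.cong refl) auto
    also have "(\<Sum>x\<in>{x\<in>P \<times> {1..y ^ k}. fst x * snd x = m}. of_nat (?r (snd x)))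
       = (\<Sum>p\<in>{p\<in>P. p dvd m \<and> m div p \<le> y ^ k}. complex_of_nat (?r (m div p)))"
    proof (rule sum.reindex_bij_witness[where i = "\<lambda>p. (p, m div p)" and j = fst])
      fix a assume a: "a \<in> {x\<in>P \<times> {1..y ^ k}. fst x * snd x = m}"
      then have "0 < fst a" using P(2) by auto
      then have d: "m div fst a = snd a" using a by auto
      show "(fst a, m div fst a) = a" using d by (simp add: prod_eq_iff)
      show "fst a \<in> {p\<in>P. p dvd m \<and> m div p \<le> y ^ k}" using a d by auto
      show "complex_of_nat (?r (m div fst a)) = of_nat (?r (snd a))" using d by simp
    next
      fix b assume b: "b \<in> {p\<in>P. p dvd m \<and> m div p \<le> y ^ k}"
      then have "0 < m div b" using m by (auto simp: dvd_div_eq_0_iff intro!: Nat.gr0I)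
      then show "(b, m div b) \<in> {x\<in>P \<times> {1..y ^ k}. fst x * snd x = m}" using b by auto
    qed simp
    also have "\<dots> = (\<Sum>p\<in>{p\<in>P. p dvd m}. complex_of_nat (?r (m div p)))"
      using P prod_reps_support[of P y k, OF P(2)] by (intro sum.mono_neutral_left) auto
    also have "\<dots> = of_nat (prod_reps P (Suc k) m)" by simp
    finally show "(\<Sum>(p, n)\<in>{x\<in>P \<times> {1..y ^ k}. fst x * snd x = m}. of_nat (?r n) * ?e (p * n))
       = of_nat (prod_reps P (Suc k) m) * ?e m" .
  qed
  finally show ?case by (simp add: expsum_def)
qed

text \<open>
  If \<open>p\<close> divides the product then, by unique factorization, \<open>p\<close> is one of the \<open>k + 1\<close> factors;
  choose its position and remove it.
\<close>

lemma prod_reps_prime_divisor: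
  assumes P: "finite P" "\<And>p. p \<in> P \<Longrightarrow> prime p" and p: "p \<in> P" "p dvd n"
  shows "prod_reps P (Suc k) n \<le> (k + 1) * prod_reps P k (n div p)"
  using p(2)
proof (induction k arbitrary: n)
  case 0
  have "prod_reps P (Suc 0) n \<le> (\<Sum>q\<in>{q\<in>P. q dvd n}. if q = p then prod_reps P 0 (n div p) else 0)"
    unfolding prod_reps.simps(2)
  proof (intro sum_mono)
    fix q assume q: "q \<in> {q\<in>P. q dvd n}"
    show "prod_reps P 0 (n div q) \<le> (if q = p then prod_reps P 0 (n div p) else 0)"
    proof (cases "q = p")
      case False
      have "n \<noteq> q"
      proof
        assume "n = q"
        then have "p dvd q" using 0 by simp
        then show False using False p(1) q P(2) by (metis (no_types, lifting) mem_Collect_eq primes_dvd_imp_eq)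
      qed
      then have "n div q \<noteq> 1" using q by (metis (no_types, lifting) dvd_mult_div_cancel mem_Collect_eq mult.right_neutral)
      then show ?thesis using False by simp
    qed simp
  qed
  also have "\<dots> \<le> prod_reps P 0 (n div p)" using P(1) by (simp del: prod_reps.simps)
  finally show ?case by simp
next
  case (Suc k)
  let ?S = "{q\<in>P. q dvd n}"
  have fin: "finite ?S" using P(1) by simp
  have pS: "p \<in> ?S" using p(1) Suc.prems by simp
  have "prod_reps P (Suc (Suc k)) n = prod_reps P (Suc k) (n div p) + (\<Sum>q\<in>?S - {p}. prod_reps P (Suc k) (n div q))"
    unfolding prod_reps.simps(2)[of P "Suc k"] using sum.remove[OF fin pS] .
  also have "(\<Sum>q\<in>?S - {p}. prod_reps P (Suc k) (n div q)) \<le> (\<Sum>q\<in>?S - {p}. (k + 1) * prod_reps P k (n div p div q))"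
  proof (intro sum_mono)
    fix q assume q: "q \<in> ?S - {p}"
    then have "coprime p q" using P(2) p(1) by (intro primes_coprime) auto
    then have "p dvd n div q" using q Suc.prems
      by (metis (no_types, lifting) DiffD1 coprime_dvd_mult_right_iff dvd_mult_div_cancel mem_Collect_eq)
    then have "prod_reps P (Suc k) (n div q) \<le> (k + 1) * prod_reps P k (n div q div p)" by (rule Suc.IH)
    also have "n div q div p = n div p div q" by (metis div_mult2_eq mult.commute)
    finally show "prod_reps P (Suc k) (n div q) \<le> (k + 1) * prod_reps P k (n div p div q)" .
  qed
  also have "\<dots> = (k + 1) * (\<Sum>q\<in>?S - {p}. prod_reps P k (n div p div q))" by (rule sum_distrib_left[symmetric])
  also have "(k + 1) * (\<Sum>q\<in>?S - {p}. prod_reps P k (n div p div q)) \<le> (k + 1) * (\<Sum>q\<in>{q\<in>P. q dvd n div p}. prod_reps P k (n div p div q))"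
  proof (intro mult_le_mono2 sum_mono2)
    show "?S - {p} \<subseteq> {q\<in>P. q dvd n div p}"
    proof
      fix q assume q: "q \<in> ?S - {p}"
      then have "coprime q p" using P(2) p(1) by (intro primes_coprime) auto
      then have "q dvd n div p" using q Suc.prems
        by (metis (no_types, lifting) DiffD1 coprime_dvd_mult_right_iff dvd_mult_div_cancel mem_Collect_eq)
      then show "q \<in> {q\<in>P. q dvd n div p}" using q by simp
    qed
  qed (use P(1) in auto)
  also have "\<dots> = (k + 1) * prod_reps P (Suc k) (n div p)" by simp
  finally show ?case by (simp add: algebra_simps del: prod_reps.simps)
qed

lemma prod_reps_le_fact:
  assumes P: "finite P" "\<And>p. p \<in> P \<Longrightarrow> prime p"
  shows "prod_reps P k n \<le> fact k"
proof (induction k arbitrary: n)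
  case (Suc k)
  show ?case
  proof (cases "{p\<in>P. p dvd n} = {}")
    case True
    then show ?thesis by (simp only: prod_reps.simps(2)) simp
  next
    case False
    then obtain p where p: "p \<in> P" "p dvd n" by blast
    have "prod_reps P (Suc k) n \<le> (k + 1) * prod_reps P k (n div p)" by (rule prod_reps_prime_divisor[OF P p])
    also have "\<dots> \<le> (k + 1) * fact k" using Suc by (intro mult_le_mono) auto
    finally show ?thesis by simp
  qed
qed simp

lemma prod_reps_prime_dvd:
  assumes P: "\<And>p. p \<in> P \<Longrightarrow> prime p" and "prod_reps P k n \<noteq> 0" "prime p" "p dvd n"
  shows "p \<in> P"
  using assms(2,4)
proof (induction k arbitrary: n)
  case 0 then show ?case using assms(3) by (auto split: if_splits)
next
  case (Suc k)
  obtain q where "q \<in> {q\<in>P. q dvd n}" "prod_reps P k (n div q) \<noteq> 0"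
    using Suc.prems(1) unfolding prod_reps.simps(2) by (rule sum.not_neutral_contains_not_neutral)
  then have q: "q \<in> P" "q dvd n" "prod_reps P k (n div q) \<noteq> 0" by auto
  have "n = q * (n div q)" using q(2) by simp
  then have "p dvd q \<or> p dvd n div q" using Suc.prems(2) assms(3) by (metis prime_dvd_mult_iff)
  then show ?case using Suc.IH[OF q(3)] q(1) P assms(3) primes_dvd_imp_eq by blast
qed

text \<open>
  If two products have a common factor then they share a prime \<open>p \<in> P\<close>. Removing it from both sides
  keeps the ratio and loses at most a factor \<open>Suc k\<close> on each side.
\<close>

lemma close_sum_prod_reps:
  assumes P: "finite P" "\<And>p. p \<in> P \<Longrightarrow> prime p"
  shows "close_sum d {1..Y} (\<lambda>n. real (prod_reps P (Suc k) n)) \<theta>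
    \<le> (fact (Suc k))\<^sup>2 * real (card (close_coprime d Y \<theta>))
      + (real (Suc k))\<^sup>2 * real (card P) * close_sum d {1..Y} (\<lambda>n. real (prod_reps P k n)) \<theta>"
proof -
  define r where "r n = real (prod_reps P (Suc k) n)" for n
  define r' where "r' n = real (prod_reps P k n)" for n
  define cl where "cl a b \<longleftrightarrow> \<bar>ln (real a) - ln (real b) - \<theta>\<bar> \<le> d" for a b :: nat
  define h where "h x = (case x of (a, b) \<Rightarrow> if cl a b then r' a * r' b else 0)" for x
  have h0: "h x \<ge> 0" for x by (auto simp: h_def r'_def split: prod.split)
  have clp: "cl (p * a) (p * b) = cl a b" if "p > 0" "a > 0" "b > 0" for p a b
    using that by (simp add: cl_def ln_mult)
  let ?S = "{1..Y} \<times> {1..Y}"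
  have "close_sum d {1..Y} r \<theta> = (\<Sum>(a, b)\<in>?S. if cl a b then r a * r b else 0)"
    unfolding close_sum_def cl_def sum.cartesian_product ..
  also have "\<dots> \<le> (\<Sum>x\<in>?S. (if x \<in> close_coprime d Y \<theta> then (fact (Suc k))\<^sup>2 else 0)
       + (\<Sum>p\<in>P. if p dvd fst x \<and> p dvd snd x then (real (Suc k))\<^sup>2 * h (fst x div p, snd x div p) else 0))"
  proof (intro sum_mono)
    fix x assume "x \<in> ?S"
    then obtain a b where x: "x = (a, b)" "a \<in> {1..Y}" "b \<in> {1..Y}" by auto
    define s where "s = (\<Sum>p\<in>P. if p dvd a \<and> p dvd b then (real (Suc k))\<^sup>2 * h (a div p, b div p) else 0)"
    have s0: "s \<ge> 0" unfolding s_def using h0 by (intro sum_nonneg) auto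
    have "(if cl a b then r a * r b else 0) \<le> (if (a, b) \<in> close_coprime d Y \<theta> then (fact (Suc k))\<^sup>2 else 0) + s"
    proof (cases "cl a b \<and> r a \<noteq> 0 \<and> r b \<noteq> 0")
      case False
      then show ?thesis using s0 by auto
    next
      case True
      show ?thesis
      proof (cases "coprime a b")
        case True
        then have "(a, b) \<in> close_coprime d Y \<theta>" using x \<open>cl a b \<and> _\<close> by (auto simp: close_coprime_def cl_def)
        moreover have "r c \<le> fact (Suc k)" for c
        proof -
          have "real (prod_reps P (Suc k) c) \<le> real (fact (Suc k))"
            using prod_reps_le_fact[OF P] by (simp only: of_nat_le_iff)
          then show ?thesis by (simp only: r_def of_nat_fact)
        qed
        then have "r a * r b \<le> fact (Suc k) * fact (Suc k)" by (intro mult_mono) (auto simp: r_def simp del: fact_Suc prod_reps.simps)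
        ultimately show ?thesis using s0 by (simp add: power2_eq_square del: fact_Suc)
      next
        case False
        then have "gcd a b \<noteq> 1" by (simp add: coprime_iff_gcd_eq_1)
        then obtain p where "prime p" "p dvd gcd a b" using prime_factor_nat by blast
        then have p: "prime p" "p dvd a" "p dvd b" by simp_all
        have pP: "p \<in> P" using True by (intro prod_reps_prime_dvd[OF P(2) _ p(1,2), where k = "Suc k"]) (auto simp: r_def simp del: prod_reps.simps)
        have p0: "p > 0" using p(1) prime_gt_0_nat by blast
        have ab: "a = p * (a div p)" "b = p * (b div p)" using p by simp_all
        have pos: "a div p > 0" "b div p > 0" using x ab by (auto intro!: Nat.gr0I)
        have "cl (a div p) (b div p)" using clp[OF p0 pos] ab True by simp
        then have hh: "h (a div p, b div p) = r' (a div p) * r' (b div p)" by (simp add: h_def)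
        have "r c \<le> real (Suc k) * r' (c div p)" if "p dvd c" for c
          using prod_reps_prime_divisor[OF P pP that, of k] unfolding r_def r'_def
          by (simp only: of_nat_mult[symmetric] of_nat_le_iff) simp
        then have "r a * r b \<le> (real (Suc k) * r' (a div p)) * (real (Suc k) * r' (b div p))"
          using p by (intro mult_mono) (auto simp: r_def r'_def simp del: prod_reps.simps)
        also have "\<dots> = (real (Suc k))\<^sup>2 * h (a div p, b div p)" by (simp add: hh power2_eq_square)
        also have "\<dots> \<le> s"
        proof -
          have "(if p dvd a \<and> p dvd b then (real (Suc k))\<^sup>2 * h (a div p, b div p) else 0) \<le> s"
            unfolding s_def by (rule member_le_sum[OF pP]) (use h0 P in auto)
          then show ?thesis using p by simp
        qed
        finally have "r a * r b \<le> s" .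
        moreover have "0 \<le> (if (a, b) \<in> close_coprime d Y \<theta> then (fact (Suc k))\<^sup>2 else (0::real))" by simp
        moreover have "(if cl a b then r a * r b else 0) = r a * r b" using True by simp
        ultimately show ?thesis by linarith
      qed
    qed
    then show "(case x of (a, b) \<Rightarrow> if cl a b then r a * r b else 0) \<le> (if x \<in> close_coprime d Y \<theta> then (fact (Suc k))\<^sup>2 else 0)
       + (\<Sum>p\<in>P. if p dvd fst x \<and> p dvd snd x then (real (Suc k))\<^sup>2 * h (fst x div p, snd x div p) else 0)"
      by (simp only: x s_def case_prod_conv fst_conv snd_conv)
  qed
  also have "\<dots> = (\<Sum>x\<in>?S. if x \<in> close_coprime d Y \<theta> then (fact (Suc k))\<^sup>2 else 0)
      + (\<Sum>p\<in>P. \<Sum>x\<in>?S. if p dvd fst x \<and> p dvd snd x then (real (Suc k))\<^sup>2 * h (fst x div p, snd x div p) else 0)"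
    unfolding sum.distrib by (rule arg_cong2[where f = "(+)"], rule refl, rule sum.swap)
  also have "(\<Sum>x\<in>?S. if x \<in> close_coprime d Y \<theta> then (fact (Suc k))\<^sup>2 else 0) = (fact (Suc k))\<^sup>2 * real (card (close_coprime d Y \<theta>))"
  proof -
    have "?S \<inter> close_coprime d Y \<theta> = close_coprime d Y \<theta>" by (auto simp: close_coprime_def)
    then show ?thesis by (subst sum.inter_restrict[symmetric]) auto
  qed
  also have "(\<Sum>p\<in>P. \<Sum>x\<in>?S. if p dvd fst x \<and> p dvd snd x then (real (Suc k))\<^sup>2 * h (fst x div p, snd x div p) else 0)
     \<le> (\<Sum>p\<in>P. (real (Suc k))\<^sup>2 * close_sum d {1..Y} r' \<theta>)"
  proof (intro sum_mono)
    fix p assume "p \<in> P"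
    then have p0: "p > 0" using P(2) prime_gt_0_nat by blast
    have "(\<Sum>x\<in>?S. if p dvd fst x \<and> p dvd snd x then (real (Suc k))\<^sup>2 * h (fst x div p, snd x div p) else 0)
       = (\<Sum>x\<in>{x\<in>?S. p dvd fst x \<and> p dvd snd x}. (real (Suc k))\<^sup>2 * h (fst x div p, snd x div p))"
      by (subst sum.inter_filter[symmetric]) auto
    also have "\<dots> \<le> (\<Sum>x\<in>?S. (real (Suc k))\<^sup>2 * h x)"
    proof (rule sum_le_included[where i = "\<lambda>(a, b). (p * a, p * b)"])
      show "\<forall>x\<in>{x\<in>?S. p dvd fst x \<and> p dvd snd x}. \<exists>y\<in>?S. (case y of (a, b) \<Rightarrow> (p * a, p * b)) = x \<and>
         (real (Suc k))\<^sup>2 * h (fst x div p, snd x div p) \<le> (real (Suc k))\<^sup>2 * h y"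
      proof
        fix x assume x: "x \<in> {x\<in>?S. p dvd fst x \<and> p dvd snd x}"
        then obtain a b where ab: "fst x = p * a" "snd x = p * b" by (auto elim!: dvdE)
        then have "a > 0" "b > 0" "a \<le> fst x" "b \<le> snd x" using x p0 by (auto intro!: Nat.gr0I)
        then have "(a, b) \<in> ?S" using x by auto
        then show "\<exists>y\<in>?S. (case y of (a, b) \<Rightarrow> (p * a, p * b)) = x \<and>
         (real (Suc k))\<^sup>2 * h (fst x div p, snd x div p) \<le> (real (Suc k))\<^sup>2 * h y"
          using ab p0 by (intro bexI[of _ "(a, b)"]) (auto simp: prod_eq_iff)
      qed
    qed (use h0 in auto)
    also have "\<dots> = (real (Suc k))\<^sup>2 * close_sum d {1..Y} r' \<theta>"
      unfolding close_sum_def sum.cartesian_product sum_distrib_left by (simp add: h_def cl_def)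
    finally show "(\<Sum>x\<in>?S. if p dvd fst x \<and> p dvd snd x then (real (Suc k))\<^sup>2 * h (fst x div p, snd x div p) else 0)
       \<le> (real (Suc k))\<^sup>2 * close_sum d {1..Y} r' \<theta>" .
  qed
  also have "\<dots> = (real (Suc k))\<^sup>2 * real (card P) * close_sum d {1..Y} r' \<theta>" by simp
  finally show ?thesis unfolding r_def r'_def by simp
qed

lemma mult_power_le_add_powers:
  fixes u v :: real
  assumes "u \<ge> 0" "v \<ge> 0"
  shows "v * u ^ k \<le> u ^ Suc k + v ^ Suc k"
proof (cases "v \<le> u")
  case True
  then have "v * u ^ k \<le> u * u ^ k" using assms by (intro mult_right_mono) auto
  then show ?thesis using assms by (simp add: add_increasing2)
next
  case False
  then have "v * u ^ k \<le> v * v ^ k" using assms by (intro mult_left_mono power_mono) auto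
  then show ?thesis using assms by (simp add: add_increasing)
qed

text \<open>
  With \<open>u = |\<Sum>p. p powr (- \<i> * t)|\<^sup>2\<close>, the shared primes contribute at most \<open>k\<^sup>2 * x\<close> times the
  energy for \<open>k - 1\<close>, where \<open>x = N powr (1/k)\<close>. In terms of mean values this is an integral of
  \<open>v * u ^ (k - 1)\<close> against \<open>|M|\<^sup>2\<close>, bounded by those of \<open>u ^ k\<close> and \<open>v ^ k\<close>. The constant in \<open>v\<close>
  is chosen so that the first one can be absorbed, and \<open>v ^ k\<close> is a constant times \<open>N\<close>.
\<close>

theorem mean_I_prime_power:
  assumes k: "k > (0::nat)"
  shows "\<exists>C>0. \<forall>T M \<epsilon> N. admissible_set T M \<epsilon> \<and> 0 < N \<longrightarrow>
        mean_I T M \<epsilon> (prime_Qpoly N k) \<le>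
          C * ((real N)\<^sup>2 * (real (card M))\<^sup>2 + (real (card M))\<^sup>2 * T
               + real N * real (card M) * T)"
proof -
  obtain j where j: "k = Suc j" using k by (cases k) auto
  define c where "c = 2560 * (real k)\<^sup>2"
  define C where "C = 1120 * (fact k)\<^sup>2 + 1640 * c ^ k"
  have C0: "C > 0" using k by (simp add: C_def c_def add_pos_pos)
  show ?thesis
  proof (intro exI[of _ C] conjI allI impI)
    show "C > 0" by fact
    fix T M \<epsilon> N
    assume "admissible_set T M \<epsilon> \<and> 0 < (N::nat)"
    then have adm: "admissible_set T M \<epsilon>" and N: "0 < N" by auto
    note fin = admissible_set_finite[OF adm]
    have T: "T > 0" using fin by simp
    define R where "R = real (card M)"
    define x where "x = real N powr (1 / real k)"
    have x0: "x > 0" using N by (simp add: x_def)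
    have xk: "x ^ k = real N" using N k by (simp add: x_def powr_power)
    define P where "P = {p. prime p \<and> real N powr (1 / real k) / 2 < real p \<and> real p \<le> real N powr (1 / real k)}"
    define y where "y = nat \<lfloor>x\<rfloor>"
    have yx: "real y \<le> x" using x0 by (simp add: y_def)
    have Py: "0 < p \<and> p \<le> y" if "p \<in> P" for p
      using that prime_gt_0_nat by (auto simp: P_def y_def x_def[symmetric] le_nat_floor)
    have Psub: "P \<subseteq> {1..y}" using Py by (auto simp: Suc_le_eq)
    then have finP: "finite P" by (rule finite_subset) simp
    have cardP: "real (card P) \<le> x" using card_mono[OF _ Psub] yx by simp
    have primeP: "prime p" if "p \<in> P" for p using that by (simp add: P_def)
    have yk: "y ^ k \<le> N"
    proof -
      have "real (y ^ k) \<le> x ^ k" using yx by (simp add: power_mono)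
      then show ?thesis using xk by (simp only: of_nat_le_iff)
    qed
    have yj: "y ^ j \<le> N"
    proof (cases "y = 0")
      case True then show ?thesis using N by (cases j) auto
    next
      case False
      then have "y ^ j \<le> y ^ k" by (intro power_increasing) (auto simp: j)
      then show ?thesis using yk by simp
    qed
    define m where "m t = cmod (expsum M (\<lambda>n. ln (real n)) (\<lambda>_. 1) t)" for t
    define u where "u t = (cmod (expsum P (\<lambda>n. ln (real n)) (\<lambda>_. 1) t))\<^sup>2" for t
    have cont: "continuous_on S m" "continuous_on S u" for S unfolding m_def u_def by (intro continuous_intros)+
    define E where "E i = energy (2 * pi / T) (M \<times> {1..N}) log_prod (\<lambda>(m, n). real (prod_reps P i n))" for i
    have pow: "(cmod (expsum P (\<lambda>n. ln (real n)) (\<lambda>_. 1) t))\<^sup>2 ^ i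
       = (cmod (expsum {1..N} (\<lambda>n. ln (real n)) (\<lambda>n. of_nat (prod_reps P i n)) t))\<^sup>2" if "y ^ i \<le> N" for i t
    proof -
      have "(cmod z)\<^sup>2 ^ i = (cmod (z ^ i))\<^sup>2" for z
        by (simp add: norm_power mult.commute flip: power_mult)
      then show ?thesis by (simp only: expsum_primes_power[OF finP Py that])
    qed
    have upper: "integral {0..T} (\<lambda>t. (cmod (expsum M (\<lambda>n. ln (real n)) a t))\<^sup>2 * u t ^ k) \<le> 40 * T * E k"
      if a: "\<And>m. m \<in> M \<Longrightarrow> cmod (a m) \<le> 1" for a
    proof -
      have "(cmod (expsum M (\<lambda>n. ln (real n)) a t))\<^sup>2 * u t ^ k
         = (cmod (expsum (M \<times> {1..N}) log_prod (\<lambda>(m, n). a m * of_nat (prod_reps P k n)) t))\<^sup>2" for t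
        unfolding u_def pow[OF yk] power_mult_distrib[symmetric] norm_mult[symmetric] expsum_mult_log ..
      then have "integral {0..T} (\<lambda>t. (cmod (expsum M (\<lambda>n. ln (real n)) a t))\<^sup>2 * u t ^ k)
         = integral {0..T} (\<lambda>t. (cmod (expsum (M \<times> {1..N}) log_prod (\<lambda>(m, n). a m * of_nat (prod_reps P k n)) t))\<^sup>2)"
        by simp
      also have "\<dots> \<le> 40 * T * E k" unfolding E_def
        by (rule mean_square_le_energy) (use fin T a in \<open>auto simp: norm_mult mult_left_le_one_le\<close>)
      finally show ?thesis .
    qed
    have lower: "T * E j \<le> 32 * integral {0..T} (\<lambda>t. (m t)\<^sup>2 * u t ^ j)"
    proof -
      have "T * E j \<le> 32 * integral {0..T} (\<lambda>t. (cmod (expsum (M \<times> {1..N}) log_prod (\<lambda>x. of_real (case x of (m, n) \<Rightarrow> real (prod_reps P j n))) t))\<^sup>2)"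
        unfolding E_def by (rule energy_le_mean_square) (use fin T in auto)
      also have "(\<lambda>x. complex_of_real (case x of (m, n) \<Rightarrow> real (prod_reps P j n))) = (\<lambda>(m::nat, n). 1 * of_nat (prod_reps P j n))"
        by auto
      finally show ?thesis unfolding m_def u_def pow[OF yj] power_mult_distrib[symmetric] norm_mult[symmetric] expsum_mult_log .
    qed
    define A where "A = (fact k)\<^sup>2 * R\<^sup>2 * (1 + 4 * pi / T * (real N)\<^sup>2)"
    have step: "E k \<le> A + (real k)\<^sup>2 * x * E j"
    proof -
      have Ej: "E i = (\<Sum>m1\<in>M. \<Sum>m2\<in>M. close_sum (2 * pi / T) {1..N} (\<lambda>n. real (prod_reps P i n)) (ln (real m2) - ln (real m1)))" for i
        unfolding E_def by (rule energy_log_prod)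
      have E0: "E i \<ge> 0" for i unfolding E_def by (rule energy_nonneg) auto
      have "E k \<le> (\<Sum>m1\<in>M. \<Sum>m2\<in>M. (fact k)\<^sup>2 * (1 + 4 * pi / T * (real N)\<^sup>2)
         + (real k)\<^sup>2 * real (card P) * close_sum (2 * pi / T) {1..N} (\<lambda>n. real (prod_reps P j n)) (ln (real m2) - ln (real m1)))"
        unfolding Ej[of k]
      proof (intro sum_mono)
        fix m1 m2
        define th where "th = ln (real m2) - ln (real m1)"
        have "(fact k)\<^sup>2 * real (card (close_coprime (2 * pi / T) N th)) \<le> (fact k)\<^sup>2 * (1 + 4 * pi / T * (real N)\<^sup>2)"
          using card_close_coprime_le[of "2 * pi / T" N th] T by (intro mult_left_mono) auto
        then show "close_sum (2 * pi / T) {1..N} (\<lambda>n. real (prod_reps P k n)) (ln (real m2) - ln (real m1))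
          \<le> (fact k)\<^sup>2 * (1 + 4 * pi / T * (real N)\<^sup>2)
         + (real k)\<^sup>2 * real (card P) * close_sum (2 * pi / T) {1..N} (\<lambda>n. real (prod_reps P j n)) (ln (real m2) - ln (real m1))"
          using close_sum_prod_reps[OF finP primeP, of "2 * pi / T" N j th] unfolding j th_def by linarith
      qed
      also have "\<dots> = A + (real k)\<^sup>2 * real (card P) * E j"
        unfolding Ej[of j] A_def R_def by (simp add: sum.distrib sum_distrib_left power2_eq_square mult_ac)
      also have "(real k)\<^sup>2 * real (card P) * E j \<le> (real k)\<^sup>2 * x * E j"
        using cardP E0 by (intro mult_right_mono mult_left_mono) auto
      finally show ?thesis by simp
    qed
    \<comment> \<open>The factor 2560 makes \<open>k\<^sup>2 * x * 32 = v / 80\<close>, so that after the upper bound with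
      constant 40 exactly half of the energy comes back.\<close>
    define v where "v = c * x"
    have v0: "v \<ge> 0" using x0 by (simp add: v_def c_def)
    have u0: "u t \<ge> 0" for t by (simp add: u_def)
    have "v * integral {0..T} (\<lambda>t. (m t)\<^sup>2 * u t ^ j) = integral {0..T} (\<lambda>t. v * ((m t)\<^sup>2 * u t ^ j))" by simp
    also have "\<dots> \<le> integral {0..T} (\<lambda>t. (m t)\<^sup>2 * u t ^ k + v ^ k * (m t)\<^sup>2)"
    proof (intro integral_le integrable_continuous_real continuous_intros cont)
      fix t
      have "(m t)\<^sup>2 * (v * u t ^ j) \<le> (m t)\<^sup>2 * (u t ^ k + v ^ k)"
        unfolding j by (intro mult_left_mono mult_power_le_add_powers u0 v0) auto
      then show "v * ((m t)\<^sup>2 * u t ^ j) \<le> (m t)\<^sup>2 * u t ^ k + v ^ k * (m t)\<^sup>2" by (simp add: algebra_simps)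
    qed
    also have "\<dots> = integral {0..T} (\<lambda>t. (m t)\<^sup>2 * u t ^ k) + v ^ k * integral {0..T} (\<lambda>t. (m t)\<^sup>2)"
      by (subst integral_add) (auto intro!: integrable_continuous_real continuous_intros cont)
    also have "\<dots> \<le> 40 * T * E k + v ^ k * (1640 * T * R)"
      using upper[of "\<lambda>_. 1"] mean_square_M_le[OF adm] v0 unfolding m_def R_def
      by (intro add_mono mult_left_mono) auto
    finally have int: "v * integral {0..T} (\<lambda>t. (m t)\<^sup>2 * u t ^ j) \<le> 40 * T * E k + v ^ k * (1640 * T * R)" .
    have "T * ((real k)\<^sup>2 * x * E j) = (real k)\<^sup>2 * x * (T * E j)" by simp
    also have "\<dots> \<le> (real k)\<^sup>2 * x * (32 * integral {0..T} (\<lambda>t. (m t)\<^sup>2 * u t ^ j))"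
      using x0 lower by (intro mult_left_mono) auto
    also have "\<dots> = v * integral {0..T} (\<lambda>t. (m t)\<^sup>2 * u t ^ j) / 80" by (simp add: v_def c_def)
    also have "\<dots> \<le> (40 * T * E k + v ^ k * (1640 * T * R)) / 80" using int by (intro divide_right_mono) auto
    finally have "T * ((real k)\<^sup>2 * x * E j) \<le> (40 * T * E k + v ^ k * (1640 * T * R)) / 80" .
    then have "T * E k \<le> T * A + (40 * T * E k + v ^ k * (1640 * T * R)) / 80"
    proof -
      have "T * E k \<le> T * A + T * ((real k)\<^sup>2 * x * E j)"
        using mult_left_mono[OF step, of T] T by (simp only: distrib_left)
      then show ?thesis using \<open>T * ((real k)\<^sup>2 * x * E j) \<le> _\<close> by linarith
    qed
    then have "40 * T * E k \<le> 80 * (T * A) + 1640 * v ^ k * (T * R)" by (simp add: field_simps)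
    also have "\<dots> = 80 * (fact k)\<^sup>2 * (R\<^sup>2 * T + 4 * pi * ((real N)\<^sup>2 * R\<^sup>2)) + 1640 * c ^ k * (real N * R * T)"
      using T by (simp add: A_def v_def power_mult_distrib xk field_simps)
    also have "\<dots> \<le> 80 * (fact k)\<^sup>2 * (14 * (R\<^sup>2 * T) + 14 * ((real N)\<^sup>2 * R\<^sup>2)) + 1640 * c ^ k * (real N * R * T)"
      using T pi_approx by (intro add_mono mult_left_mono mult_right_mono order_refl) auto
    also have "\<dots> \<le> C * ((real N)\<^sup>2 * R\<^sup>2 + R\<^sup>2 * T + real N * R * T)"
    proof -
      have "1120 * (fact k)\<^sup>2 * (R\<^sup>2 * T + (real N)\<^sup>2 * R\<^sup>2) \<le> C * (R\<^sup>2 * T + (real N)\<^sup>2 * R\<^sup>2)"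
        using T by (intro mult_right_mono) (auto simp: C_def c_def)
      moreover have "1640 * c ^ k * (real N * R * T) \<le> C * (real N * R * T)"
        using T by (intro mult_right_mono) (auto simp: C_def R_def)
      ultimately show ?thesis by (simp add: algebra_simps)
    qed
    finally have main: "40 * T * E k \<le> C * ((real N)\<^sup>2 * R\<^sup>2 + R\<^sup>2 * T + real N * R * T)" .
    have "mean_I T M \<epsilon> (prime_Qpoly N k) = integral {0..T} (\<lambda>t. (1 / fact k)\<^sup>2 * ((cmod (expsum M (\<lambda>n. ln (real n)) \<epsilon> t))\<^sup>2 * u t ^ k))"
    proof -
      have 0: "0 \<notin> P" using Py by blast
      show ?thesis
        unfolding mean_I_def prime_Qpoly_def P_def[symmetric] dirichlet_poly_imaginary[OF 0] dirichlet_poly_imaginary[OF fin(2)] u_def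
        by (simp add: norm_mult norm_power norm_divide power_mult_distrib power_divide power_commutes power_mult[symmetric] mult_ac)
    qed
    also have "\<dots> = (1 / fact k)\<^sup>2 * integral {0..T} (\<lambda>t. (cmod (expsum M (\<lambda>n. ln (real n)) \<epsilon> t))\<^sup>2 * u t ^ k)" by simp
    also have "\<dots> \<le> 1 * integral {0..T} (\<lambda>t. (cmod (expsum M (\<lambda>n. ln (real n)) \<epsilon> t))\<^sup>2 * u t ^ k)"
    proof (intro mult_right_mono integral_nonneg integrable_continuous_real continuous_intros cont)
      show "(1 / fact k)\<^sup>2 \<le> (1::real)" by (intro power_le_one) (auto simp: fact_ge_1)
    qed (use u0 in auto)
    also have "\<dots> \<le> 40 * T * E k" using upper[of \<epsilon>] adm by (simp add: admissible_set_def)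
    finally show "mean_I T M \<epsilon> (prime_Qpoly N k) \<le>
          C * ((real N)\<^sup>2 * (real (card M))\<^sup>2 + (real (card M))\<^sup>2 * T
               + real N * real (card M) * T)" using main unfolding R_def by linarith
  qed
qed

section \<open>Gaussian averages on the critical line\<close>

lemma gauss_integrable: "integrable lborel (\<lambda>u. std_normal_density u *\<^sub>R cis (u * x))"
proof (rule Bochner_Integration.integrable_bound)
  show "integrable lborel std_normal_density" using integrable_std_normal_moment[of 0] by simp
  show "AE u in lborel. norm (std_normal_density u *\<^sub>R cis (u * x)) \<le> norm (std_normal_density u)" by simp
  have "(\<lambda>u. cis (u * x)) \<in> borel_measurable borel"
    by (intro borel_measurable_continuous_onI continuous_intros)
  then show "(\<lambda>u. std_normal_density u *\<^sub>R cis (u * x)) \<in> borel_measurable lborel" by simp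
qed

lemma gauss_fourier: "(LINT u|lborel. std_normal_density u *\<^sub>R cis (u * x)) = of_real (exp (- x\<^sup>2 / 2))"
proof -
  have "(\<lambda>u. cis (u * x)) \<in> borel_measurable borel"
    by (intro borel_measurable_continuous_onI continuous_intros)
  then have "(LINT u|lborel. std_normal_density u *\<^sub>R cis (u * x)) = (LINT u|std_normal_distribution. cis (u * x))"
    by (subst integral_density) auto
  also have "\<dots> = char std_normal_distribution x"
    by (simp add: char_def cis_conv_exp mult.commute)
  finally show ?thesis by (simp add: char_std_normal_distribution)
qed

text \<open>
  This represents \<open>1 / (1 - s)\<close> on the critical line as a superposition of characters, which makes
  the Gaussian average of the pole term explicit.
\<close>

lemma laplace_line:
  fixes v :: real
  shows "set_integrable lborel {0<..} (\<lambda>y::real. exp (- y / 2))"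
    and "(LINT y:{0<..}|lborel. exp (- of_real y * (1/2 - \<i> * of_real v))) = 1 / (1/2 - \<i> * of_real v)"
proof -
  have e: "einterval 0 \<infinity> = {0<..}" by (auto simp: einterval_def zero_ereal_def)
  have lim0: "((\<lambda>y::real. exp (- y / 2)) \<longlongrightarrow> 0) at_top" by real_asymp
  have "set_integrable lborel (einterval 0 \<infinity>) (\<lambda>y. exp (- y / 2))"
  proof (rule interval_integral_FTC_nonneg)
    show "(((\<lambda>y. - 2 * exp (- y / 2)) \<circ> real_of_ereal) \<longlongrightarrow> -2) (at_right 0)"
      unfolding zero_ereal_def ereal_tendsto_simps by (auto intro!: tendsto_eq_intros)
    show "(((\<lambda>y. - 2 * exp (- y / 2)) \<circ> real_of_ereal) \<longlongrightarrow> 0) (at_left \<infinity>)"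
      unfolding ereal_tendsto_simps using tendsto_mult[OF tendsto_const[of "-2::real"] lim0] by simp
  qed (auto intro!: derivative_eq_intros)
  then show 1: "set_integrable lborel {0<..} (\<lambda>y::real. exp (- y / 2))" unfolding e .
  define w where "w = 1/2 - \<i> * of_real v"
  have w: "w \<noteq> 0" by (auto simp: w_def complex_eq_iff)
  have nrm: "cmod (exp (- of_real y * w)) = exp (- y / 2)" for y by (simp add: w_def)
  have "(LBINT y=0..\<infinity>. exp (- of_real y * w)) = 0 - (- 1 / w)"
  proof (rule interval_integral_FTC_integrable[where F = "\<lambda>y. - exp (- of_real y * w) / w"])
    show "set_integrable lborel (einterval 0 \<infinity>) (\<lambda>y. exp (- of_real y * w))"
      unfolding e
    proof (rule set_integrable_bound[OF 1])
      show "set_borel_measurable lborel {0<..} (\<lambda>y. exp (- of_real y * w))"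
        unfolding set_borel_measurable_def by measurable
    qed (simp add: w_def)
    show "(((\<lambda>y. - exp (- of_real y * w) / w) \<circ> real_of_ereal) \<longlongrightarrow> - 1 / w) (at_right 0)"
      unfolding zero_ereal_def ereal_tendsto_simps using w by (auto intro!: tendsto_eq_intros)
    show "(((\<lambda>y. - exp (- of_real y * w) / w) \<circ> real_of_ereal) \<longlongrightarrow> 0) (at_left \<infinity>)"
      unfolding ereal_tendsto_simps
    proof (rule tendsto_norm_zero_cancel)
      have "((\<lambda>y. exp (- y / 2) / cmod w) \<longlongrightarrow> 0 / cmod w) at_top"
        using w by (intro tendsto_divide lim0 tendsto_const) auto
      then show "((\<lambda>y. norm (- exp (- of_real y * w) / w)) \<longlongrightarrow> 0) at_top"
        by (simp only: norm_divide norm_minus_cancel nrm) simp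
    qed
    show "((\<lambda>y. - exp (- of_real y * w) / w) has_vector_derivative exp (- of_real x * w)) (at x)" for x
      using w by (auto intro!: derivative_eq_intros has_vector_derivative_real_field simp: field_simps)
  qed (auto intro!: continuous_intros)
  then show "(LINT y:{0<..}|lborel. exp (- of_real y * (1/2 - \<i> * of_real v))) = 1 / (1/2 - \<i> * of_real v)"
    using w by (simp add: interval_lebesgue_integral_def e w_def[symmetric])
qed

text \<open>
  The integrand is the pole term \<open>Y powr (1 - s) / (1 - s)\<close> at \<open>s = 1/2 + \<i> * (t + u)\<close>, twisted by
  \<open>V powr (1/2 + \<i> * u)\<close>. Writing \<open>1 / (1 - s)\<close> as a Laplace integral over \<open>y > 0\<close> and integrating
  over \<open>u\<close> first leaves \<open>V\<close> times the Fourier integral at \<open>t\<close> of a Gaussian centred at \<open>c\<close> over the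
  half-line \<open>y > 0\<close>. The full line gives \<open>exp (- t\<^sup>2 / 2)\<close> and the missing half-line gives
  at most \<open>exp (- c\<^sup>2 / 2)\<close>.
\<close>

lemma gauss_pole_le:
  fixes t V Y c :: real
  assumes V: "V > 0" and Y: "Y > 0" and c: "c = ln Y - ln V - 1/2" "c \<ge> 0"
  shows "cmod (LINT u|lborel. std_normal_density u *\<^sub>R (exp ((1/2 + \<i> * of_real u) * of_real (ln V))
            * (exp ((1/2 - \<i> * of_real (t + u)) * of_real (ln Y)) / (1/2 - \<i> * of_real (t + u)))))
          \<le> 4 * V * (exp (- t\<^sup>2 / 2) + exp (- c\<^sup>2 / 2))"
proof -
  define L where "L = ln Y - ln V"
  define \<phi> where "\<phi> = std_normal_density"
  have phi0: "\<phi> u \<ge> 0" for u by (simp add: \<phi>_def)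
  have phi_int: "integrable lborel \<phi>" "integral\<^sup>L lborel \<phi> = 1"
    using integrable_std_normal_moment[of 0] integral_std_normal_moment_even[of 0] by (simp_all add: \<phi>_def)
  have [measurable]: "\<phi> \<in> borel_measurable borel" unfolding \<phi>_def by simp
  have [measurable]: "cis \<in> borel_measurable borel"
    by (intro borel_measurable_continuous_onI continuous_intros)
  define a where "a y = exp ((ln V + ln Y - y) / 2)" for y
  \<comment> \<open>The common integrand for both orders of integration;
      \<open>cis (u * (y - L))\<close> collects the dependence on both variables.\<close>
  define f where "f u y = (\<phi> u * (indicator {0<..} y * a y)) *\<^sub>R (cis (- t * (ln Y - y)) * cis (u * (y - L)))" for u y
  have fm: "case_prod f \<in> borel_measurable (lborel \<Otimes>\<^sub>M lborel)"
    unfolding f_def a_def by measurable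
  have a_eq: "a y = exp ((ln V + ln Y) / 2) * exp (- y / 2)" for y
    by (simp add: a_def exp_add[symmetric] field_simps)
  have a_int: "integrable lborel (\<lambda>y. indicator {0<..} y * a y)"
  proof -
    have "integrable lborel (\<lambda>y. exp ((ln V + ln Y) / 2) * (indicator {0<..} y * exp (- y / 2)))"
      using laplace_line(1) unfolding set_integrable_def by (intro integrable_mult_right) simp
    then show ?thesis by (simp add: a_eq mult_ac)
  qed
  have a0: "indicator {0<..} y * a y \<ge> 0" for y by (simp add: a_def)
  have nf: "norm (f u y) = \<phi> u * (indicator {0<..} y * a y)" for u y
    using phi0 a0 by (simp add: f_def norm_mult)
  have int1: "integrable lborel (\<lambda>u. \<phi> u * K)" for K using phi_int by simp
  have f_int: "integrable (lborel \<Otimes>\<^sub>M lborel) (case_prod f)"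
  proof (rule lborel_pair.Fubini_integrable[OF fm])
    show "integrable lborel (\<lambda>u. LINT y|lborel. norm (case (u, y) of (u, y) \<Rightarrow> f u y))"
      using int1 by (simp add: nf)
    show "AE u in lborel. integrable lborel (\<lambda>y. case (u, y) of (u, y) \<Rightarrow> f u y)"
    proof (rule AE_I2)
      fix u :: real
      have "integrable lborel (\<lambda>y. \<phi> u * (indicator {0<..} y * a y))" using a_int by simp
      then show "integrable lborel (\<lambda>y. case (u, y) of (u, y) \<Rightarrow> f u y)"
        by (rule Bochner_Integration.integrable_bound) (use fm in \<open>auto simp: nf\<close>)
    qed
  qed
  have swap: "(LINT u|lborel. (LINT y|lborel. f u y)) = (LINT y|lborel. (LINT u|lborel. f u y))"
    by (rule lborel_pair.Fubini_integral[OF f_int, symmetric])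
  have left: "(LINT y|lborel. f u y) = \<phi> u *\<^sub>R (exp ((1/2 + \<i> * of_real u) * of_real (ln V))
            * (exp ((1/2 - \<i> * of_real (t + u)) * of_real (ln Y)) / (1/2 - \<i> * of_real (t + u))))" for u
  proof -
    define E where "E = \<phi> u *\<^sub>R (exp ((1/2 + \<i> * of_real u) * of_real (ln V)) * exp ((1/2 - \<i> * of_real (t + u)) * of_real (ln Y)))"
    have "f u y = E * (indicator {0<..} y *\<^sub>R exp (- of_real y * (1/2 - \<i> * of_real (t + u))))" for y
    proof -
      have "complex_of_real (a y) * (cis (- t * (ln Y - y)) * cis (u * (y - L)))
         = exp ((1/2 + \<i> * of_real u) * of_real (ln V)) * exp ((1/2 - \<i> * of_real (t + u)) * of_real (ln Y)) * exp (- of_real y * (1/2 - \<i> * of_real (t + u)))"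
        unfolding a_def cis_conv_exp exp_of_real[symmetric] exp_add[symmetric]
        by (rule arg_cong[where f = exp]) (simp add: L_def field_simps)
      then show ?thesis by (simp add: f_def E_def scaleR_conv_of_real mult_ac)
    qed
    then have "(LINT y|lborel. f u y) = E * (LINT y:{0<..}|lborel. exp (- of_real y * (1/2 - \<i> * of_real (t + u))))"
      unfolding set_lebesgue_integral_def by (simp only: integral_mult_right_zero)
    also have "\<dots> = E * (1 / (1/2 - \<i> * of_real (t + u)))" by (simp only: laplace_line(2))
    finally show ?thesis by (simp add: E_def scaleR_conv_of_real)
  qed
  \<comment> \<open>Completing the square in \<open>a y * exp (- (y - L)\<^sup>2 / 2)\<close> moves the centre from
      \<open>L\<close> to \<open>c\<close> and leaves the factor \<open>V * exp (1/8)\<close>; the square root is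
      the normalisation of the density.\<close>
  define K where "K = V * exp (1/8) * sqrt (2 * pi)"
  have K0: "K \<ge> 0" using V by (simp add: K_def)
  define g where "g y = cis (- t * (ln Y - y))" for y
  have gm[measurable]: "g \<in> borel_measurable borel" unfolding g_def by measurable
  have right: "(LINT u|lborel. f u y) = K *\<^sub>R ((indicator {0<..} y * \<phi> (y - c)) *\<^sub>R g y)" for y
  proof -
    have "(LINT u|lborel. f u y) = (LINT u|lborel. (indicator {0<..} y * a y) *\<^sub>R (g y * (\<phi> u *\<^sub>R cis (u * (y - L)))))"
      by (simp add: f_def g_def scaleR_conv_of_real mult_ac)
    also have "\<dots> = (indicator {0<..} y * a y) *\<^sub>R (g y * of_real (exp (- (y - L)\<^sup>2 / 2)))"
      by (simp only: gauss_fourier \<phi>_def integral_scaleR_right integral_mult_right_zero)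
    also have "\<dots> = (indicator {0<..} y * (a y * exp (- (y - L)\<^sup>2 / 2))) *\<^sub>R g y"
      by (simp add: scaleR_conv_of_real mult_ac)
    also have "a y * exp (- (y - L)\<^sup>2 / 2) = K * \<phi> (y - c)"
    proof -
      have "a y * exp (- (y - L)\<^sup>2 / 2) = exp (ln V + 1/8 - (y - c)\<^sup>2 / 2)"
        unfolding a_def exp_add[symmetric]
        by (rule arg_cong[where f = exp]) (simp add: c L_def field_simps power2_eq_square)
      also have "\<dots> = V * exp (1/8) * exp (- (y - c)\<^sup>2 / 2)" 
      proof -
        have "ln V + 1/8 - (y - c)\<^sup>2 / 2 = ln V + 1/8 + - (y - c)\<^sup>2 / 2" by simp
        then show ?thesis using V by (simp only: exp_add exp_ln)
      qed
      also have "\<dots> = K * \<phi> (y - c)" by (simp add: K_def \<phi>_def std_normal_density_def)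
      finally show ?thesis .
    qed
    finally show ?thesis by (simp add: scaleR_conv_of_real mult_ac)
  qed
  have shift: "integrable lborel (\<lambda>y. \<phi> (y - c))"
    using lborel_integrable_real_affine[OF phi_int(1), of 1 "- c"] by simp
  have shift_g: "integrable lborel (\<lambda>y. \<phi> (y - c) *\<^sub>R g y)"
    by (rule Bochner_Integration.integrable_bound[OF shift]) (auto simp: g_def)
  have tail_int: "integrable lborel (\<lambda>y. (indicator {..0} y * \<phi> (y - c)) *\<^sub>R g y)"
    by (rule Bochner_Integration.integrable_bound[OF shift]) (auto simp: g_def indicator_def phi0)
  have "(LINT y|lborel. (indicator {0<..} y * \<phi> (y - c)) *\<^sub>R g y)
      = (LINT y|lborel. \<phi> (y - c) *\<^sub>R g y - (indicator {..0} y * \<phi> (y - c)) *\<^sub>R g y)"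
    by (intro Bochner_Integration.integral_cong) (auto simp: indicator_def)
  also have "\<dots> = (LINT y|lborel. \<phi> (y - c) *\<^sub>R g y) - (LINT y|lborel. (indicator {..0} y * \<phi> (y - c)) *\<^sub>R g y)"
    by (rule Bochner_Integration.integral_diff[OF shift_g tail_int])
  also have "cmod \<dots> \<le> cmod (LINT y|lborel. \<phi> (y - c) *\<^sub>R g y) + cmod (LINT y|lborel. (indicator {..0} y * \<phi> (y - c)) *\<^sub>R g y)"
    by (rule norm_triangle_ineq4)
  also have "cmod (LINT y|lborel. \<phi> (y - c) *\<^sub>R g y) = exp (- t\<^sup>2 / 2)"
  proof -
    have "(LINT y|lborel. \<phi> (y - c) *\<^sub>R g y) = (LINT y|lborel. \<phi> y *\<^sub>R g (c + y))"
      using lborel_integral_real_affine[of 1 "\<lambda>y. \<phi> (y - c) *\<^sub>R g y" c] by simp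
    also have "\<dots> = (LINT y|lborel. cis (- t * (ln Y - c)) * (\<phi> y *\<^sub>R cis (y * t)))"
      by (intro Bochner_Integration.integral_cong) (auto simp: g_def cis_mult algebra_simps)
    also have "\<dots> = cis (- t * (ln Y - c)) * of_real (exp (- t\<^sup>2 / 2))"
      by (simp only: gauss_fourier \<phi>_def integral_mult_right_zero)
    finally show ?thesis by (simp add: norm_mult)
  qed
  also have "cmod (LINT y|lborel. (indicator {..0} y * \<phi> (y - c)) *\<^sub>R g y) \<le> exp (- c\<^sup>2 / 2)"
  proof -
    have "cmod (LINT y|lborel. (indicator {..0} y * \<phi> (y - c)) *\<^sub>R g y) \<le> (LINT y|lborel. exp (- c\<^sup>2 / 2) * \<phi> y)"
    proof (rule Bochner_Integration.integral_norm_bound_integral[OF tail_int])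
      show "integrable lborel (\<lambda>y. exp (- c\<^sup>2 / 2) * \<phi> y)" using phi_int by simp
      fix y :: real
      have "\<phi> (y - c) \<le> exp (- c\<^sup>2 / 2) * \<phi> y" if "y \<le> 0"
      proof -
        have "y * c \<le> 0" using that c by (simp add: mult_nonpos_nonneg)
        then have "- (y - c)\<^sup>2 / 2 \<le> - c\<^sup>2 / 2 + - y\<^sup>2 / 2" by (simp add: power2_diff mult.commute)
        then have "exp (- (y - c)\<^sup>2 / 2) \<le> exp (- c\<^sup>2 / 2) * exp (- y\<^sup>2 / 2)" by (simp only: exp_add[symmetric] exp_le_cancel_iff)
        then show ?thesis by (simp add: \<phi>_def std_normal_density_def divide_right_mono)
      qed
      then show "norm ((indicator {..0} y * \<phi> (y - c)) *\<^sub>R g y) \<le> exp (- c\<^sup>2 / 2) * \<phi> y"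
        by (auto simp: indicator_def g_def phi0)
    qed
    then show ?thesis using phi_int by simp
  qed
  finally have B: "cmod (LINT y|lborel. (indicator {0<..} y * \<phi> (y - c)) *\<^sub>R g y) \<le> exp (- t\<^sup>2 / 2) + exp (- c\<^sup>2 / 2)"
    by simp
  have K4: "K \<le> 4 * V"
  proof -
    have "exp (1/8 :: real) \<le> 1 + 1/8 + (1/8)\<^sup>2" by (rule exp_bound) auto
    then have 1: "exp (1/8 :: real) \<le> 5/4" by (simp add: power2_eq_square)
    have 2: "sqrt (2 * pi) \<le> 3" using pi_less_4 by (intro real_le_lsqrt) auto
    have "exp (1/8) * sqrt (2 * pi) \<le> 5/4 * 3" by (intro mult_mono 1 2) auto
    then have "V * (exp (1/8) * sqrt (2 * pi)) \<le> V * 4" using V by (intro mult_left_mono) auto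
    then show ?thesis by (simp add: K_def mult_ac)
  qed
  have "(LINT u|lborel. (LINT y|lborel. f u y)) = K *\<^sub>R (LINT y|lborel. (indicator {0<..} y * \<phi> (y - c)) *\<^sub>R g y)"
    unfolding swap right by (simp only: integral_scaleR_right)
  then have "cmod (LINT u|lborel. (LINT y|lborel. f u y)) = K * cmod (LINT y|lborel. (indicator {0<..} y * \<phi> (y - c)) *\<^sub>R g y)"
    using K0 by simp
  also have "\<dots> \<le> 4 * V * (exp (- t\<^sup>2 / 2) + exp (- c\<^sup>2 / 2))"
    using K0 K4 B by (intro mult_mono) auto
  finally show ?thesis unfolding left by (simp add: \<phi>_def)
qed

section \<open>Partial sums of zeta on the critical line\<close>

lemma zeta_term_summable:
  assumes s: "s \<in> zeta_dom"
  shows "summable (\<lambda>n. real (Suc n) powr (- Re s - 1))" "summable (\<lambda>n. zeta_term n s)"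
proof -
  have "Re s > 0" using s by (simp add: zeta_dom_def)
  then have "summable (\<lambda>n. real n powr (- Re s - 1))"
    using summable_real_powr_iff[of "- Re s - 1"] by simp
  then show 1: "summable (\<lambda>n. real (Suc n) powr (- Re s - 1))" by (subst summable_Suc_iff)
  show "summable (\<lambda>n. zeta_term n s)"
    by (rule summable_comparison_test'[OF summable_mult[OF 1, of "norm s"]]) (use norm_zeta_term_le[OF s] in auto)
qed

text \<open>
  Uniqueness of the continuation identifies zeta with the series that converges in \<open>Re s > 0\<close>.
\<close>

lemma zeta_eq_zeta_terms:
  assumes s: "s \<in> zeta_dom"
  shows "zeta s = (\<Sum>i. zeta_term i s) + 1 / (s - 1)"
proof -
  define F where "F s = (if s \<in> zeta_dom then (\<Sum>i. zeta_term i s) + 1 / (s - 1) else 0)" for s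
  have "(\<lambda>s. \<Sum>i. zeta_term i s) holomorphic_on zeta_dom"
    by (rule holomorphic_uniform_sequence[OF open_zeta_dom _ zeta_term_uniform_limit])
       (auto simp: zeta_term_def zeta_dom_def intro!: holomorphic_intros)
  then have "(\<lambda>s. (\<Sum>i. zeta_term i s) + 1 / (s - 1)) holomorphic_on zeta_dom"
    by (intro holomorphic_intros) (auto simp: zeta_dom_def)
  then have "F holomorphic_on zeta_dom" by (rule holomorphic_transform) (simp add: F_def)
  moreover have "(\<lambda>n. of_nat (Suc n) powr (- s)) sums F s" if "1 < Re s" for s
    using zeta_term_sums[OF that] that by (auto simp: F_def zeta_dom_def)
  ultimately have "zeta_continuation F" by (auto simp: zeta_continuation_def F_def)
  then have "zeta = F" using zeta_continuation_unique zeta_continuation_zeta by blast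
  then have "zeta s = F s" by (rule fun_cong)
  also have "\<dots> = (\<Sum>i. zeta_term i s) + 1 / (s - 1)" using s by (simp add: F_def)
  finally show ?thesis .
qed

definition pole_part :: "real \<Rightarrow> real \<Rightarrow> complex" where
  "pole_part Y v = exp ((1/2 - \<i> * of_real v) * of_real (ln Y)) / (1/2 - \<i> * of_real v)"

text \<open>
  The partial sum of the series for zeta at \<open>1/2 + \<i> * v\<close>, corrected by the pole term. On the critical
  line the partial sums alone diverge; the corrected ones converge to zeta.
\<close>

definition zeta_approx :: "nat \<Rightarrow> real \<Rightarrow> complex" where
  "zeta_approx X v = (\<Sum>n\<in>{1..X}. exp (- (1/2 + \<i> * of_real v) * of_real (ln (real n)))) - pole_part (real X + 1) v"

text \<open>
  Summing \<open>zeta_term\<close> up to \<open>X\<close> telescopes to the corrected partial sum, and the tail of the series is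
  at most \<open>|s|\<close> times the tail of \<open>\<Sum>n. n powr (- 3/2)\<close>.
\<close>

lemma zeta_approx_le:
  "\<exists>\<tau>. \<tau> \<longlonglongrightarrow> 0 \<and> (\<forall>X v. cmod (zeta_approx X v) \<le> cmod (zeta (1/2 + \<i> * of_real v)) + (1 + \<bar>v\<bar>) * \<tau> X)"
proof -
  define f where "f n = real (Suc n) powr (- (3/2))" for n
  have hd: "(1/2 + \<i> * of_real v) \<in> zeta_dom" for v by (auto simp: zeta_dom_def complex_eq_iff)
  have re: "- Re (1/2 + \<i> * of_real v) - 1 = - (3/2)" for v by simp
  have sf: "summable f" using zeta_term_summable(1)[OF hd[of 0]] unfolding re f_def .
  define \<tau> where "\<tau> X = (\<Sum>i. f (i + X))" for X
  have sfX: "summable (\<lambda>i. f (i + X))" for X using sf by (simp add: summable_iff_shift)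
  have "\<tau> = (\<lambda>X. suminf f - sum f {..<X})"
    unfolding \<tau>_def by (intro ext suminf_minus_initial_segment[OF sf])
  moreover have "(\<lambda>X. suminf f - sum f {..<X}) \<longlonglongrightarrow> suminf f - suminf f"
    by (intro tendsto_diff tendsto_const summable_LIMSEQ sf)
  ultimately have lim: "\<tau> \<longlonglongrightarrow> 0" by simp
  have "cmod (zeta_approx X v) \<le> cmod (zeta (1/2 + \<i> * of_real v)) + (1 + \<bar>v\<bar>) * \<tau> X" for X v
  proof -
    define s where "s = 1/2 + \<i> * of_real v"
    have s: "s \<in> zeta_dom" using hd by (simp add: s_def)
    have s1: "s \<noteq> 1" using s by (simp add: zeta_dom_def)
    have pw: "of_nat n powr z = exp (z * of_real (ln (real n)))" if "n > 0" for n and z :: complex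
      using that by (simp add: powr_def Ln_of_nat)
    have sums: "(\<Sum>n\<in>{1..X}. exp (- s * of_real (ln (real n)))) = (\<Sum>i<X. of_nat (Suc i) powr (- s))"
      by (rule sum.reindex_bij_witness[where i = Suc and j = "\<lambda>n. n - 1"]) (auto simp: pw)
    have "(\<Sum>i<X. zeta_term i s) = (\<Sum>i<X. of_nat (Suc i) powr (- s))
        - (\<Sum>i<X. of_nat (Suc (Suc i)) powr (1 - s) - of_nat (Suc i) powr (1 - s)) / (1 - s)"
      unfolding zeta_term_def sum_divide_distrib by (rule sum_subtractf)
    also have "(\<Sum>i<X. of_nat (Suc (Suc i)) powr (1 - s) - of_nat (Suc i) powr (1 - s)) = of_nat (Suc X) powr (1 - s) - of_nat (Suc 0) powr (1 - s)"
      by (rule sum_lessThan_telescope)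
    also have "of_nat (Suc X) powr (1 - s) = exp ((1/2 - \<i> * of_real v) * of_real (ln (real X + 1)))"
      by (subst pw) (auto simp: s_def add.commute)
    finally have 1: "(\<Sum>i<X. zeta_term i s) = (\<Sum>n\<in>{1..X}. exp (- s * of_real (ln (real n)))) - pole_part (real X + 1) v + 1 / (1 - s)"
      unfolding sums[symmetric] pole_part_def using s1 by (simp add: s_def diff_divide_distrib)
    have "zeta s = (\<Sum>i. zeta_term (i + X) s) + (\<Sum>i<X. zeta_term i s) + 1 / (s - 1)"
      unfolding zeta_eq_zeta_terms[OF s] using suminf_split_initial_segment[OF zeta_term_summable(2)[OF s], of X] by simp
    also have "1 / (s - 1) = - (1 / (1 - s))" using s1 by (simp add: field_simps)
    finally have "zeta_approx X v = zeta s - (\<Sum>i. zeta_term (i + X) s)"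
      unfolding 1 zeta_approx_def s_def[symmetric] by simp
    then have "cmod (zeta_approx X v) \<le> cmod (zeta s) + cmod (\<Sum>i. zeta_term (i + X) s)"
      using norm_triangle_ineq4 by simp
    also have "cmod (\<Sum>i. zeta_term (i + X) s) \<le> (\<Sum>i. (1 + \<bar>v\<bar>) * f (i + X))"
    proof (rule norm_suminf_le)
      fix i
      have "cmod (zeta_term (i + X) s) \<le> cmod s * f (i + X)"
        using norm_zeta_term_le[OF s, of "i + X"] by (simp add: f_def s_def)
      also have "\<dots> \<le> (1 + \<bar>v\<bar>) * f (i + X)"
      proof (rule mult_right_mono)
        have "cmod s \<le> cmod (1/2) + cmod (\<i> * of_real v)" unfolding s_def by (rule norm_triangle_ineq)
        then show "cmod s \<le> 1 + \<bar>v\<bar>" by (simp add: norm_mult)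
      qed (simp add: f_def)
      finally show "cmod (zeta_term (i + X) s) \<le> (1 + \<bar>v\<bar>) * f (i + X)" .
    qed (intro summable_mult sfX)
    also have "\<dots> = (1 + \<bar>v\<bar>) * \<tau> X" unfolding \<tau>_def by (rule suminf_mult[OF sfX])
    finally show ?thesis by (simp add: s_def)
  qed
  then show ?thesis using lim by blast
qed

text \<open>
  A bump around \<open>n = V\<close>: equal to \<open>sqrt (V / n) * exp (- (ln (V / n))\<^sup>2 / 2)\<close> for \<open>V, n > 0\<close>.
\<close>

definition smooth_weight :: "real \<Rightarrow> nat \<Rightarrow> real" where
  "smooth_weight V n = exp ((ln V - ln (real n)) / 2 - (ln V - ln (real n))\<^sup>2 / 2)"

lemma pole_part_continuous: "continuous_on A (\<lambda>u. pole_part Y (t + u))"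
  unfolding pole_part_def by (intro continuous_intros) (auto simp: complex_eq_iff)

lemma norm_pole_part_le: "cmod (pole_part Y v) \<le> 2 * exp (ln Y / 2)"
proof -
  define r where "r = cmod (1/2 - \<i> * of_real v)"
  have "1/2 \<le> r" using abs_Re_le_cmod[of "1/2 - \<i> * of_real v"] by (simp add: r_def)
  then have "exp (ln Y / 2) / r \<le> exp (ln Y / 2) / (1/2)" by (intro divide_left_mono) auto
  then show ?thesis by (simp add: pole_part_def norm_divide r_def)
qed

text \<open>
  By the Fourier transform of the Gaussian, \<open>smooth_weight V n * n powr (- \<i> * t)\<close> is the average of
  \<open>V powr (1/2 + \<i> * u) * n powr (- 1/2 - \<i> * (t + u))\<close> over a standard normal \<open>u\<close>. Summing over
  \<open>n \<le> X\<close> gives the average of \<open>zeta_approx\<close> plus that of the pole term. A bound of polynomial growth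
  for the former survives the average, because the Gaussian has finite second moment.
\<close>

theorem smooth_sum_le:
  fixes t V c \<eta> C0 \<tau> :: real
  assumes V: "V > 0" and c: "c = ln (real X + 1) - ln V - 1/2" "c \<ge> 0"
    and eta: "0 < \<eta>" "\<eta> \<le> 1" and C0: "C0 \<ge> 0" and tau: "\<tau> \<ge> 0"
    and approx: "\<And>v. cmod (zeta_approx X v) \<le> C0 * (1 + \<bar>v\<bar>) powr \<eta> + (1 + \<bar>v\<bar>) * \<tau>"
  shows "cmod (expsum {1..X} (\<lambda>n. ln (real n)) (\<lambda>n. of_real (smooth_weight V n)) t)
     \<le> 3 * sqrt V * (C0 * (1 + \<bar>t\<bar>) powr \<eta> + (1 + \<bar>t\<bar>) * \<tau>) + 4 * V * (exp (- t\<^sup>2 / 2) + exp (- c\<^sup>2 / 2))"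
proof -
  define \<phi> where "\<phi> = std_normal_density"
  have phi0: "\<phi> u \<ge> 0" for u by (simp add: \<phi>_def)
  have phi_int: "integrable lborel \<phi>" using integrable_std_normal_moment[of 0] by (simp add: \<phi>_def)
  have [measurable]: "\<phi> \<in> borel_measurable borel" unfolding \<phi>_def by simp
  define G where "G u = exp ((1/2 + \<i> * of_real u) * of_real (ln V))" for u
  have G: "cmod (G u) = sqrt V" for u
  proof -
    have "cmod (G u) = exp (ln V / 2)" by (simp add: G_def)
    also have "\<dots> = exp (ln (sqrt V))" using V by (simp add: ln_sqrt)
    also have "\<dots> = sqrt V" using V by simp
    finally show ?thesis .
  qed
  define Y where "Y = real X + 1"
  have Y: "Y > 0" by (simp add: Y_def)
  define summand where "summand n u = \<phi> u *\<^sub>R (G u * exp (- (1/2 + \<i> * of_real (t + u)) * of_real (ln (real n))))" for n :: nat and u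
  have summand_eq: "summand n u = (of_real (exp ((ln V - ln (real n)) / 2)) * cis (- (ln (real n) * t))) * (\<phi> u *\<^sub>R cis (u * (ln V - ln (real n))))" for n u
  proof -
    have "G u * exp (- (1/2 + \<i> * of_real (t + u)) * of_real (ln (real n)))
       = of_real (exp ((ln V - ln (real n)) / 2)) * cis (- (ln (real n) * t)) * cis (u * (ln V - ln (real n)))"
      unfolding G_def cis_conv_exp exp_of_real[symmetric] exp_add[symmetric]
      by (rule arg_cong[where f = exp]) (simp add: field_simps)
    then show ?thesis unfolding summand_def scaleR_conv_of_real by (simp only: mult_ac)
  qed
  have summand_int: "integrable lborel (summand n)" for n
    unfolding summand_eq[abs_def] \<phi>_def by (intro integrable_mult_right gauss_integrable)
  have summand_integral: "integral\<^sup>L lborel (summand n) = of_real (smooth_weight V n) * cis (- (ln (real n) * t))" for n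
  proof -
    have "integral\<^sup>L lborel (summand n) = (of_real (exp ((ln V - ln (real n)) / 2)) * cis (- (ln (real n) * t))) * of_real (exp (- (ln V - ln (real n))\<^sup>2 / 2))"
      unfolding summand_eq[abs_def] \<phi>_def by (simp only: integral_mult_right_zero gauss_fourier)
    also have "\<dots> = of_real (exp ((ln V - ln (real n)) / 2) * exp (- (ln V - ln (real n))\<^sup>2 / 2)) * cis (- (ln (real n) * t))"
      by (simp add: mult_ac)
    also have "exp ((ln V - ln (real n)) / 2) * exp (- (ln V - ln (real n))\<^sup>2 / 2) = smooth_weight V n"
      unfolding smooth_weight_def exp_add[symmetric] by simp
    finally show ?thesis .
  qed
  define pole where "pole u = \<phi> u *\<^sub>R (G u * pole_part Y (t + u))" for u
  have pole_int: "integrable lborel pole"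
  proof (rule Bochner_Integration.integrable_bound)
    show "integrable lborel (\<lambda>u. \<phi> u * (sqrt V * (2 * exp (ln Y / 2))))" using phi_int by simp
    show "AE u in lborel. norm (pole u) \<le> norm (\<phi> u * (sqrt V * (2 * exp (ln Y / 2))))"
      using norm_pole_part_le phi0 V by (auto simp: pole_def norm_mult G intro!: mult_left_mono)
    have "(\<lambda>u. G u * pole_part Y (t + u)) \<in> borel_measurable borel"
      unfolding G_def by (intro borel_measurable_continuous_onI continuous_intros pole_part_continuous)
    then show "pole \<in> borel_measurable lborel" unfolding pole_def by simp
  qed
  define main where "main u = \<phi> u *\<^sub>R (G u * zeta_approx X (t + u))" for u
  have main_eq: "main = (\<lambda>u. (\<Sum>n\<in>{1..X}. summand n u) - pole u)"
    by (simp add: main_def summand_def pole_def zeta_approx_def Y_def fun_eq_iff right_diff_distrib scaleR_diff_right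
          sum_distrib_left scaleR_sum_right)
  have main_int: "integrable lborel main"
    unfolding main_eq by (intro Bochner_Integration.integrable_diff Bochner_Integration.integrable_sum summand_int pole_int)
  have "integral\<^sup>L lborel main = (\<Sum>n\<in>{1..X}. integral\<^sup>L lborel (summand n)) - integral\<^sup>L lborel pole"
    unfolding main_eq
    by (subst Bochner_Integration.integral_diff) (auto intro!: summand_int pole_int Bochner_Integration.integral_sum)
  then have "expsum {1..X} (\<lambda>n. ln (real n)) (\<lambda>n. of_real (smooth_weight V n)) t = integral\<^sup>L lborel main + integral\<^sup>L lborel pole"
    unfolding summand_integral expsum_def by simp
  then have "cmod (expsum {1..X} (\<lambda>n. ln (real n)) (\<lambda>n. of_real (smooth_weight V n)) t)
     \<le> cmod (integral\<^sup>L lborel main) + cmod (integral\<^sup>L lborel pole)"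
    by (simp add: norm_triangle_ineq)
  moreover have "cmod (integral\<^sup>L lborel pole) \<le> 4 * V * (exp (- t\<^sup>2 / 2) + exp (- c\<^sup>2 / 2))"
    unfolding pole_def G_def pole_part_def \<phi>_def using gauss_pole_le[OF V Y, of c t] c by (simp add: Y_def)
  moreover have "cmod (integral\<^sup>L lborel main) \<le> 3 * sqrt V * (C0 * (1 + \<bar>t\<bar>) powr \<eta> + (1 + \<bar>t\<bar>) * \<tau>)"
  proof -
    define K where "K = sqrt V * (C0 * (1 + \<bar>t\<bar>) powr \<eta> + (1 + \<bar>t\<bar>) * \<tau>)"
    have m2: "integrable lborel (\<lambda>u. \<phi> u * u\<^sup>2)" "(LINT u|lborel. \<phi> u * u\<^sup>2) = 1"
      using integrable_std_normal_moment[of 2] integral_std_normal_moment_even[of 1] by (simp_all add: \<phi>_def)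
    have m0: "integral\<^sup>L lborel \<phi> = 1" using integral_std_normal_moment_even[of 0] by (simp add: \<phi>_def)
    have eq: "K * (2 * \<phi> u + \<phi> u * u\<^sup>2) = \<phi> u * (K * (2 + u\<^sup>2))" for u by (simp add: algebra_simps)
    have "cmod (integral\<^sup>L lborel main) \<le> (LINT u|lborel. K * (2 * \<phi> u + \<phi> u * u\<^sup>2))"
    proof (rule Bochner_Integration.integral_norm_bound_integral[OF main_int])
      show "integrable lborel (\<lambda>u. K * (2 * \<phi> u + \<phi> u * u\<^sup>2))" using phi_int m2 by simp
      fix u :: real
      have tri: "1 + \<bar>t + u\<bar> \<le> (1 + \<bar>t\<bar>) * (1 + \<bar>u\<bar>)"
      proof -
        have "(1 + \<bar>t\<bar>) * (1 + \<bar>u\<bar>) = 1 + \<bar>t\<bar> + \<bar>u\<bar> + \<bar>t\<bar> * \<bar>u\<bar>" by (simp add: algebra_simps)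
        moreover have "0 \<le> \<bar>t\<bar> * \<bar>u\<bar>" by simp
        ultimately show ?thesis using abs_triangle_ineq[of t u] by linarith
      qed
      have u2: "1 + \<bar>u\<bar> \<le> 2 + u\<^sup>2"
      proof -
        have "0 \<le> (\<bar>u\<bar> - 1)\<^sup>2" by simp
        then have "2 * \<bar>u\<bar> \<le> u\<^sup>2 + 1" by (simp add: power2_diff)
        then show ?thesis using zero_le_power2[of u] by linarith
      qed
      have "(1 + \<bar>t + u\<bar>) powr \<eta> \<le> ((1 + \<bar>t\<bar>) * (1 + \<bar>u\<bar>)) powr \<eta>"
        using tri eta by (intro powr_mono2) auto
      also have "\<dots> = (1 + \<bar>t\<bar>) powr \<eta> * (1 + \<bar>u\<bar>) powr \<eta>" by (simp add: powr_mult)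
      also have "\<dots> \<le> (1 + \<bar>t\<bar>) powr \<eta> * (1 + \<bar>u\<bar>) powr 1"
        using eta by (intro mult_left_mono powr_mono) auto
      also have "\<dots> \<le> (1 + \<bar>t\<bar>) powr \<eta> * (2 + u\<^sup>2)" using u2 by (intro mult_left_mono) auto
      finally have 1: "C0 * (1 + \<bar>t + u\<bar>) powr \<eta> \<le> C0 * ((1 + \<bar>t\<bar>) powr \<eta> * (2 + u\<^sup>2))"
        using C0 by (intro mult_left_mono) auto
      have "1 + \<bar>t + u\<bar> \<le> (1 + \<bar>t\<bar>) * (2 + u\<^sup>2)"
        using tri u2 mult_left_mono[OF u2, of "1 + \<bar>t\<bar>"] by simp
      then have 2: "(1 + \<bar>t + u\<bar>) * \<tau> \<le> (1 + \<bar>t\<bar>) * (2 + u\<^sup>2) * \<tau>" using tau by (intro mult_right_mono) auto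
      have "cmod (zeta_approx X (t + u)) \<le> (C0 * (1 + \<bar>t\<bar>) powr \<eta> + (1 + \<bar>t\<bar>) * \<tau>) * (2 + u\<^sup>2)"
        using approx[of "t + u"] 1 2 by (simp add: algebra_simps)
      then have "sqrt V * cmod (zeta_approx X (t + u)) \<le> K * (2 + u\<^sup>2)"
        unfolding K_def mult.assoc using V by (intro mult_left_mono) auto
      then have "\<phi> u * (sqrt V * cmod (zeta_approx X (t + u))) \<le> \<phi> u * (K * (2 + u\<^sup>2))"
        using phi0 by (intro mult_left_mono) auto
      then show "norm (main u) \<le> K * (2 * \<phi> u + \<phi> u * u\<^sup>2)"
        unfolding eq main_def by (simp add: norm_mult G phi0)
    qed
    also have "\<dots> = K * 3" using phi_int m2 m0 by simp
    finally show ?thesis by (simp add: K_def mult_ac)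
  qed
  ultimately show ?thesis by linarith
qed

section \<open>The mean value under the Lindelof Hypothesis\<close>

text \<open>
  A single bump is small for \<open>n\<close> far below \<open>V\<close>, so one bump for each dyadic scale below \<open>N\<close> is used. The
  \<open>N\<close> scales are more than enough, since \<open>N < 2 ^ N\<close>.
\<close>

definition dyadic_weight :: "nat \<Rightarrow> nat \<Rightarrow> real" where
  "dyadic_weight N n = (\<Sum>j<N. 2 * smooth_weight (real N / 2 ^ j) n)"

lemma smooth_weight_nonneg: "smooth_weight V n \<ge> 0" by (simp add: smooth_weight_def)

lemma dyadic_weight_ge_1:
  assumes n: "n \<in> {1..N}"
  shows "dyadic_weight N n \<ge> 1"
proof -
  define P where "P j \<longleftrightarrow> real N / 2 ^ j < 2 * real n" for j :: nat
  have "N < 2 ^ N" by (rule less_exp)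
  then have "real N < 2 ^ N" by (metis of_nat_less_iff of_nat_numeral of_nat_power)
  then have "real N / 2 ^ N < 1" by simp
  moreover have "1 \<le> real n" using n by simp
  ultimately have "P N" unfolding P_def by linarith
  define j where "j = (LEAST j. P j)"
  have Pj: "P j" unfolding j_def using \<open>P N\<close> by (rule LeastI)
  have jle: "real n \<le> real N / 2 ^ j"
  proof (cases j)
    case 0 then show ?thesis using n by simp
  next
    case (Suc i)
    then have "\<not> P i" unfolding j_def by (metis lessI not_less_Least)
    then show ?thesis by (simp add: P_def Suc field_simps)
  qed
  have jN: "j < N"
  proof (rule ccontr)
    assume "\<not> j < N"
    then have "(2::real) ^ N \<le> 2 ^ j" by (intro power_increasing) auto
    then have "real N < 2 ^ j" using \<open>real N < 2 ^ N\<close> by linarith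
    then have "real N / 2 ^ j < 1" by simp
    moreover have "1 \<le> real n" using n by simp
    ultimately show False using jle by linarith
  qed
  define V where "V = real N / 2 ^ j"
  have Vn: "real n \<le> V" "V < 2 * real n" using jle Pj by (simp_all add: V_def P_def)
  have n0: "real n > 0" using n by simp
  define x where "x = ln V - ln (real n)"
  have x0: "x \<ge> 0" using Vn n0 by (simp add: x_def)
  have "ln V \<le> ln (2 * real n)" using Vn n0 by simp
  then have "x \<le> ln 2" using n0 by (simp add: x_def ln_mult)
  then have x1: "x \<le> 1" using ln_2_less_1 by linarith
  then have "x\<^sup>2 \<le> x * 1" unfolding power2_eq_square using x0 by (intro mult_left_mono) auto
  then have "0 \<le> x / 2 - x\<^sup>2 / 2" by simp
  then have "1 \<le> smooth_weight V n" unfolding smooth_weight_def x_def[symmetric] by simp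
  then have "1 \<le> 2 * smooth_weight V n" by simp
  also have "\<dots> \<le> dyadic_weight N n"
    unfolding dyadic_weight_def V_def using jN
    by (intro member_le_sum[of j "{..<N}" "\<lambda>j. 2 * smooth_weight (real N / 2 ^ j) n"]) (auto simp: smooth_weight_nonneg)
  finally show ?thesis .
qed

lemma geometric_sum_le:
  fixes q :: real
  assumes "0 \<le> q" "q < 1"
  shows "(\<Sum>j<n. q ^ j) \<le> 1 / (1 - q)"
proof -
  have "(\<Sum>j<n. q ^ j) = (1 - q ^ n) / (1 - q)" using assms by (simp add: sum_gp_strict)
  also have "\<dots> \<le> 1 / (1 - q)" using assms by (intro divide_right_mono) auto
  finally show ?thesis .
qed

text \<open>
  The contributions of the dyadic scales \<open>V = N / 2 ^ j\<close> form geometric series in \<open>sqrt V\<close> and in \<open>V\<close>, so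
  no logarithm is lost. The length \<open>X\<close> may depend on \<open>T\<close> and \<open>N\<close> in any way, because it does not occur in
  the bound; it is taken so large that the tail of zeta and of the pole term are negligible.
\<close>

theorem lindelof_smooth_sum:
  assumes LH: lindelof_hypothesis and eta: "0 < \<eta>" "\<eta> \<le> 1"
  shows "\<exists>K>0. \<forall>T N. 20 \<le> T \<and> 0 < N \<longrightarrow> (\<exists>X\<ge>N. \<forall>t\<in>{0..T}.
     cmod (expsum {1..X} (\<lambda>n. ln (real n)) (\<lambda>n. of_real (dyadic_weight N n)) t)
       \<le> 16 * real N * exp (- t\<^sup>2 / 2) + K * sqrt (real N) * T powr \<eta>)"
proof -
  obtain C0' where C0': "\<And>t::real. norm (zeta (1 / 2 + \<i> * of_real t)) \<le> C0' * (1 + \<bar>t\<bar>) powr \<eta>"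
    using LH eta unfolding lindelof_hypothesis_def by blast
  define C0 where "C0 = max C0' 0"
  have C00: "C0 \<ge> 0" by (simp add: C0_def)
  have C0: "norm (zeta (1 / 2 + \<i> * of_real t)) \<le> C0 * (1 + \<bar>t\<bar>) powr \<eta>" for t :: real
  proof -
    have "C0' * (1 + \<bar>t\<bar>) powr \<eta> \<le> C0 * (1 + \<bar>t\<bar>) powr \<eta>" by (intro mult_right_mono) (auto simp: C0_def)
    then show ?thesis using C0'[of t] by linarith
  qed
  obtain \<tau> where tau: "\<tau> \<longlonglongrightarrow> 0"
    and approx: "\<And>X v. cmod (zeta_approx X v) \<le> cmod (zeta (1/2 + \<i> * of_real v)) + (1 + \<bar>v\<bar>) * \<tau> X"
    using zeta_approx_le by blast
  define K where "K = 24 * (2 * C0 + 1) + 16"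
  have K0: "K > 0" using C00 by (simp add: K_def)
  show ?thesis
  proof (intro exI[of _ K] conjI allI impI K0)
    fix T :: real and N :: nat
    assume "20 \<le> T \<and> 0 < N"
    then have T: "20 \<le> T" and N: "0 < N" by auto
    have "\<forall>\<^sub>F X in sequentially. \<bar>\<tau> X\<bar> < 1 / (1 + T)"
      using tendstoD[OF tau, of "1 / (1 + T)"] T by (simp add: dist_real_def)
    moreover have "\<forall>\<^sub>F X in sequentially. ln (real X + 1) - ln (real N) - 1/2 \<ge> 0"
      by real_asymp
    moreover have "\<forall>\<^sub>F X in sequentially. real N * exp (- (ln (real X + 1) - ln (real N) - 1/2)\<^sup>2 / 2) \<le> 1"
    proof -
      have "((\<lambda>X::nat. real N * exp (- (ln (real X + 1) - ln (real N) - 1/2)\<^sup>2 / 2)) \<longlongrightarrow> 0) sequentially"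
        by real_asymp
      then have "\<forall>\<^sub>F X in sequentially. real N * exp (- (ln (real X + 1) - ln (real N) - 1/2)\<^sup>2 / 2) < 1"
        by (rule order_tendstoD) auto
      then show ?thesis by eventually_elim auto
    qed
    moreover have "\<forall>\<^sub>F X in sequentially. X \<ge> N" by (rule eventually_ge_at_top)
    ultimately have "\<forall>\<^sub>F X in sequentially. \<bar>\<tau> X\<bar> < 1 / (1 + T) \<and> ln (real X + 1) - ln (real N) - 1/2 \<ge> 0 \<and>
       real N * exp (- (ln (real X + 1) - ln (real N) - 1/2)\<^sup>2 / 2) \<le> 1 \<and> X \<ge> N"
      by eventually_elim auto
    then obtain X where X: "\<bar>\<tau> X\<bar> < 1 / (1 + T)" "ln (real X + 1) - ln (real N) - 1/2 \<ge> 0"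
       "real N * exp (- (ln (real X + 1) - ln (real N) - 1/2)\<^sup>2 / 2) \<le> 1" "X \<ge> N"
      using eventually_happens by fastforce
    define cN where "cN = ln (real X + 1) - ln (real N) - 1/2"
    define V where "V j = real N / 2 ^ j" for j :: nat
    have V0: "V j > 0" for j using N by (simp add: V_def)
    have VN: "V j \<le> real N" for j using N by (simp add: V_def divide_le_eq mult_le_cancel_left1)
    show "\<exists>X\<ge>N. \<forall>t\<in>{0..T}. cmod (expsum {1..X} (\<lambda>n. ln (real n)) (\<lambda>n. of_real (dyadic_weight N n)) t)
       \<le> 16 * real N * exp (- t\<^sup>2 / 2) + K * sqrt (real N) * T powr \<eta>"
    proof (intro exI[of _ X] conjI X(4) ballI)
      fix t assume "t \<in> {0..T}"
      then have t: "0 \<le> t" "t \<le> T" by auto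
      define A where "A = C0 * (1 + T) powr \<eta> + 1"
      have A0: "A \<ge> 0" using C00 by (simp add: A_def)
      define B where "B = exp (- t\<^sup>2 / 2) + exp (- cN\<^sup>2 / 2)"
      have B0: "B \<ge> 0" by (simp add: B_def add_nonneg_nonneg)
      have each: "cmod (expsum {1..X} (\<lambda>n. ln (real n)) (\<lambda>n. of_real (smooth_weight (V j) n)) t)
          \<le> 3 * sqrt (V j) * A + 4 * V j * B" for j
      proof -
        define c where "c = ln (real X + 1) - ln (V j) - 1/2"
        have "ln (V j) \<le> ln (real N)" using V0 VN N by simp
        then have c: "cN \<le> c" "0 \<le> cN" using X(2) by (simp_all add: c_def cN_def)
        have ap: "cmod (zeta_approx X v) \<le> C0 * (1 + \<bar>v\<bar>) powr \<eta> + (1 + \<bar>v\<bar>) * \<bar>\<tau> X\<bar>" for v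
        proof -
          have "(1 + \<bar>v\<bar>) * \<tau> X \<le> (1 + \<bar>v\<bar>) * \<bar>\<tau> X\<bar>" by (intro mult_left_mono) auto
          then show ?thesis using approx[of X v] C0[of v] by linarith
        qed
        have "cmod (expsum {1..X} (\<lambda>n. ln (real n)) (\<lambda>n. of_real (smooth_weight (V j) n)) t)
          \<le> 3 * sqrt (V j) * (C0 * (1 + \<bar>t\<bar>) powr \<eta> + (1 + \<bar>t\<bar>) * \<bar>\<tau> X\<bar>) + 4 * V j * (exp (- t\<^sup>2 / 2) + exp (- c\<^sup>2 / 2))"
          by (rule smooth_sum_le[OF V0 c_def _ eta C00 _ ap]) (use c in auto)
        also have "\<dots> \<le> 3 * sqrt (V j) * A + 4 * V j * B"
        proof (intro add_mono mult_left_mono)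
          have "(1 + \<bar>t\<bar>) powr \<eta> \<le> (1 + T) powr \<eta>" using t eta by (intro powr_mono2) auto
          then have "C0 * (1 + \<bar>t\<bar>) powr \<eta> \<le> C0 * (1 + T) powr \<eta>" using C00 by (intro mult_left_mono) auto
          moreover have "(1 + \<bar>t\<bar>) * \<bar>\<tau> X\<bar> \<le> (1 + T) * (1 / (1 + T))"
            using t X(1) by (intro mult_mono) auto
          moreover have "(1 + T) * (1 / (1 + T)) = 1" using T by simp
          ultimately show "C0 * (1 + \<bar>t\<bar>) powr \<eta> + (1 + \<bar>t\<bar>) * \<bar>\<tau> X\<bar> \<le> A" by (simp add: A_def)
          have "cN\<^sup>2 \<le> c\<^sup>2" using c by (intro power_mono) auto
          then show "exp (- t\<^sup>2 / 2) + exp (- c\<^sup>2 / 2) \<le> B" by (simp add: B_def)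
        qed (use V0[of j] in auto)
        finally show ?thesis .
      qed
      have "expsum {1..X} (\<lambda>n. ln (real n)) (\<lambda>n. of_real (dyadic_weight N n)) t
         = (\<Sum>j<N. 2 * expsum {1..X} (\<lambda>n. ln (real n)) (\<lambda>n. of_real (smooth_weight (V j) n)) t)"
        unfolding expsum_def dyadic_weight_def V_def of_real_sum sum_distrib_right sum_distrib_left
        by (subst sum.swap) (simp add: mult.assoc)
      then have "cmod (expsum {1..X} (\<lambda>n. ln (real n)) (\<lambda>n. of_real (dyadic_weight N n)) t)
         \<le> (\<Sum>j<N. cmod (2 * expsum {1..X} (\<lambda>n. ln (real n)) (\<lambda>n. of_real (smooth_weight (V j) n)) t))"
        by (simp only: norm_sum)
      also have "\<dots> \<le> (\<Sum>j<N. 2 * (3 * sqrt (V j) * A + 4 * V j * B))"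
      proof (intro sum_mono)
        fix j
        have "cmod (2 * z) = 2 * cmod z" for z by (simp add: norm_mult)
        then show "cmod (2 * expsum {1..X} (\<lambda>n. ln (real n)) (\<lambda>n. of_real (smooth_weight (V j) n)) t)
           \<le> 2 * (3 * sqrt (V j) * A + 4 * V j * B)" using each[of j] by (simp only: mult_le_cancel_left_pos zero_less_numeral)
      qed
      also have "\<dots> = 6 * A * (\<Sum>j<N. sqrt (V j)) + 8 * B * (\<Sum>j<N. V j)"
      proof -
        have "2 * (3 * sqrt (V j) * A + 4 * V j * B) = 6 * A * sqrt (V j) + 8 * B * V j" for j
          by (simp add: algebra_simps)
        then show ?thesis by (simp only: sum.distrib sum_distrib_left)
      qed
      also have "\<dots> \<le> 6 * A * (4 * sqrt (real N)) + 8 * B * (2 * real N)"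
      proof (intro add_mono mult_left_mono)
        have V_eq: "V j = real N * (1/2) ^ j" for j by (simp add: V_def power_divide)
        then have "(\<Sum>j<N. V j) = real N * (\<Sum>j<N. (1/2) ^ j)" by (simp only: V_eq sum_distrib_left)
        also have "\<dots> \<le> real N * (1 / (1 - 1/2))" by (intro mult_left_mono geometric_sum_le) auto
        finally show "(\<Sum>j<N. V j) \<le> 2 * real N" by simp
        have "sqrt (V j) \<le> sqrt (real N) * (3/4) ^ j" for j
        proof -
          have "sqrt (1/2) \<le> (3/4 :: real)" by (rule real_le_lsqrt) (auto simp: power2_eq_square)
          then have "sqrt (1/2) ^ j \<le> (3/4 :: real) ^ j" by (intro power_mono) auto
          moreover have "sqrt (V j) = sqrt (real N) * sqrt (1/2) ^ j"
            by (simp add: V_eq real_sqrt_mult real_sqrt_power)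
          ultimately show ?thesis by (simp add: mult_left_mono)
        qed
        then have "(\<Sum>j<N. sqrt (V j)) \<le> (\<Sum>j<N. sqrt (real N) * (3/4) ^ j)" by (intro sum_mono)
        also have "\<dots> = sqrt (real N) * (\<Sum>j<N. (3/4) ^ j)" by (simp only: sum_distrib_left)
        also have "\<dots> \<le> sqrt (real N) * (1 / (1 - 3/4))" by (intro mult_left_mono geometric_sum_le) auto
        finally show "(\<Sum>j<N. sqrt (V j)) \<le> 4 * sqrt (real N)" by simp
      qed (use A0 B0 in auto)
      also have "\<dots> = 24 * sqrt (real N) * A + 16 * real N * exp (- t\<^sup>2 / 2) + 16 * (real N * exp (- cN\<^sup>2 / 2))"
        by (simp add: B_def algebra_simps)
      also have "\<dots> \<le> 24 * sqrt (real N) * ((2 * C0 + 1) * T powr \<eta>) + 16 * real N * exp (- t\<^sup>2 / 2) + 16 * (sqrt (real N) * T powr \<eta>)"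
      proof (intro add_mono mult_left_mono order_refl)
        have T1: "1 \<le> T powr \<eta>" using T eta by (intro ge_one_powr_ge_zero) auto
        have "(1 + T) powr \<eta> \<le> (2 * T) powr \<eta>" using T eta by (intro powr_mono2) auto
        also have "\<dots> = 2 powr \<eta> * T powr \<eta>" using T by (simp add: powr_mult)
        also have "\<dots> \<le> 2 powr 1 * T powr \<eta>" using eta by (intro mult_right_mono powr_mono) auto
        finally have "C0 * (1 + T) powr \<eta> \<le> C0 * (2 * T powr \<eta>)" using C00 by (intro mult_left_mono) auto
        then show "A \<le> (2 * C0 + 1) * T powr \<eta>" using T1 by (simp add: A_def algebra_simps)
        have "1 \<le> sqrt (real N)" using N by simp
        then have "1 * 1 \<le> sqrt (real N) * T powr \<eta>" using T1 by (intro mult_mono) auto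
        then show "real N * exp (- cN\<^sup>2 / 2) \<le> sqrt (real N) * T powr \<eta>" using X(3) by (simp add: cN_def)
      qed auto
      also have "\<dots> = 16 * real N * exp (- t\<^sup>2 / 2) + K * sqrt (real N) * T powr \<eta>"
        by (simp add: K_def algebra_simps)
      finally show "cmod (expsum {1..X} (\<lambda>n. ln (real n)) (\<lambda>n. of_real (dyadic_weight N n)) t)
         \<le> 16 * real N * exp (- t\<^sup>2 / 2) + K * sqrt (real N) * T powr \<eta>" .
    qed
  qed
qed

lemma gauss_integral_le:
  fixes T :: real
  assumes "T \<ge> 0"
  shows "integral {0..T} (\<lambda>t. exp (- t\<^sup>2)) \<le> 2"
proof -
  have "integral {0..T} (\<lambda>t. exp (- t\<^sup>2)) \<le> integral {0..T} (\<lambda>t::real. 1 / (1 + t\<^sup>2))"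
  proof (intro integral_le integrable_continuous_real continuous_intros)
    fix t :: real
    have "1 + t\<^sup>2 \<le> exp (t\<^sup>2)" by (rule exp_ge_add_one_self)
    then have "1 / exp (t\<^sup>2) \<le> 1 / (1 + t\<^sup>2)" by (intro divide_left_mono) (auto simp: add_pos_nonneg)
    then show "exp (- t\<^sup>2) \<le> 1 / (1 + t\<^sup>2)" by (simp add: exp_minus inverse_eq_divide)
  qed (auto simp: add_nonneg_eq_0_iff)
  also have "integral {0..T} (\<lambda>t::real. 1 / (1 + t\<^sup>2)) = arctan T - arctan 0"
    using assms
    by (intro integral_unique fundamental_theorem_of_calculus)
       (auto intro!: derivative_eq_intros simp flip: has_real_derivative_iff_has_vector_derivative simp: inverse_eq_divide add_nonneg_eq_0_iff)
  also have "\<dots> \<le> 2" using arctan_ubound[of T] pi_less_4 by simp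
  finally show ?thesis .
qed

text \<open>
  The Gaussian part of the pointwise bound is integrated against the trivial bound \<open>|M| \<le> R\<close>, the
  rest against the mean square of \<open>M\<close>.
\<close>

theorem mean_I_lindelof:
  assumes LH: lindelof_hypothesis and eta: "\<eta> > (0::real)"
  shows "\<exists>C>0. \<forall>T M \<epsilon> N q. admissible_set T M \<epsilon> \<and> admissible_coeffs N q \<longrightarrow>
         mean_I T M \<epsilon> (Qpoly N q) \<le>
           C * ((real N)\<^sup>2 * (real (card M))\<^sup>2
                + (real N * T) powr \<eta> * (real N * real (card M) * T))"
proof -
  define a where "a = min 1 (\<eta> / 2)"
  have a: "0 < a" "a \<le> 1" "2 * a \<le> \<eta>" using eta by (auto simp: a_def)
  obtain K where K: "K > 0" and main: "\<And>T N. 20 \<le> T \<Longrightarrow> 0 < N \<Longrightarrow> \<exists>X\<ge>N. \<forall>t\<in>{0..T}.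
     cmod (expsum {1..X} (\<lambda>n. ln (real n)) (\<lambda>n. of_real (dyadic_weight N n)) t)
       \<le> 16 * real N * exp (- t\<^sup>2 / 2) + K * sqrt (real N) * T powr a"
    using lindelof_smooth_sum[OF LH a(1,2)] by blast
  define C where "C = 1280 * (1024 + 3280 * K\<^sup>2)"
  have C0: "C > 0" by (simp add: C_def add_pos_nonneg)
  show ?thesis
  proof (intro exI[of _ C] conjI allI impI C0)
    fix T M \<epsilon> N q
    assume "admissible_set T M \<epsilon> \<and> admissible_coeffs N q"
    then have adm: "admissible_set T M \<epsilon>" and q: "admissible_coeffs N q" by auto
    note fin = admissible_set_finite[OF adm]
    have N: "N > 0" using q by (simp add: admissible_coeffs_def)
    have T: "T \<ge> 20" using fin by simp
    define R where "R = real (card M)"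
    have R0: "R \<ge> 0" by (simp add: R_def)
    let ?ln = "\<lambda>n. ln (real n)"
    obtain X where X: "X \<ge> N" and XB: "\<And>t. t \<in> {0..T} \<Longrightarrow>
       cmod (expsum {1..X} ?ln (\<lambda>n. of_real (dyadic_weight N n)) t) \<le> 16 * real N * exp (- t\<^sup>2 / 2) + K * sqrt (real N) * T powr a"
      using main[OF T N] by blast
    define w where "w n = dyadic_weight N n" for n
    have w0: "w n \<ge> 0" for n unfolding w_def dyadic_weight_def by (intro sum_nonneg) (simp add: smooth_weight_nonneg)
    define m where "m t = cmod (expsum M ?ln (\<lambda>_. 1) t)" for t
    define s where "s t = cmod (expsum {1..X} ?ln (\<lambda>n. of_real (w n)) t)" for t
    have cont: "continuous_on S m" "continuous_on S s" for S unfolding m_def s_def by (intro continuous_intros)+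
    have mR: "m t \<le> R" for t
    proof -
      have "m t \<le> (\<Sum>x\<in>M. cmod (1 * cis (- (?ln x * t))))" unfolding m_def expsum_def by (rule norm_sum)
      then show ?thesis by (simp add: R_def)
    qed
    have m0: "m t \<ge> 0" for t by (simp add: m_def)
    have "T * pair_count T M N \<le> T * energy (2 * pi / T) (M \<times> {1..X}) log_prod (\<lambda>(_, n). w n)"
    proof (intro mult_left_mono)
      show "pair_count T M N \<le> energy (2 * pi / T) (M \<times> {1..X}) log_prod (\<lambda>(_, n). w n)"
        unfolding pair_count_def
        by (rule energy_mono) (use fin X w0 dyadic_weight_ge_1 in \<open>auto simp: w_def\<close>)
    qed (use T in auto)
    also have "\<dots> \<le> 32 * integral {0..T} (\<lambda>t. (cmod (expsum (M \<times> {1..X}) log_prod (\<lambda>x. of_real (case x of (_, n) \<Rightarrow> w n)) t))\<^sup>2)"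
      by (rule energy_le_mean_square) (use fin T w0 in auto)
    also have "(\<lambda>x. complex_of_real (case x of (_::nat, n) \<Rightarrow> w n)) = (\<lambda>(x, y). 1 * of_real (w y))" by auto
    also have "integral {0..T} (\<lambda>t. (cmod (expsum (M \<times> {1..X}) log_prod (\<lambda>(x, y). 1 * of_real (w y)) t))\<^sup>2)
        = integral {0..T} (\<lambda>t. (m t)\<^sup>2 * (s t)\<^sup>2)"
      unfolding m_def s_def expsum_mult_log[symmetric] norm_mult power_mult_distrib ..
    also have "\<dots> \<le> integral {0..T} (\<lambda>t. 512 * (real N)\<^sup>2 * R\<^sup>2 * exp (- t\<^sup>2) + 2 * K\<^sup>2 * real N * (T powr a)\<^sup>2 * (m t)\<^sup>2)"
    proof (intro integral_le integrable_continuous_real continuous_intros cont)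
      fix t assume t: "t \<in> {0..T}"
      define x where "x = 16 * real N * exp (- t\<^sup>2 / 2)"
      define y where "y = K * sqrt (real N) * T powr a"
      have "s t \<le> x + y" using XB[OF t] by (simp add: s_def x_def y_def w_def)
      then have "(s t)\<^sup>2 \<le> (x + y)\<^sup>2" by (intro power_mono) (auto simp: s_def)
      also have "\<dots> \<le> 2 * x\<^sup>2 + 2 * y\<^sup>2" using sum_squares_bound[of x y] by (simp add: power2_sum)
      finally have "(m t)\<^sup>2 * (s t)\<^sup>2 \<le> (m t)\<^sup>2 * (2 * x\<^sup>2 + 2 * y\<^sup>2)" by (intro mult_left_mono) auto
      also have "\<dots> = 2 * x\<^sup>2 * (m t)\<^sup>2 + 2 * y\<^sup>2 * (m t)\<^sup>2" by (simp add: algebra_simps)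
      also have "2 * x\<^sup>2 * (m t)\<^sup>2 \<le> 2 * x\<^sup>2 * R\<^sup>2" using mR m0 by (intro mult_left_mono power_mono) auto
      also have "2 * x\<^sup>2 * R\<^sup>2 = 512 * (real N)\<^sup>2 * R\<^sup>2 * exp (- t\<^sup>2)"
      proof -
        have "(exp (- t\<^sup>2 / 2))\<^sup>2 = exp (- t\<^sup>2)" by (simp add: exp_double[symmetric])
        then show ?thesis by (simp add: x_def power_mult_distrib)
      qed
      also have "2 * y\<^sup>2 = 2 * K\<^sup>2 * real N * (T powr a)\<^sup>2" by (simp add: y_def power_mult_distrib)
      finally show "(m t)\<^sup>2 * (s t)\<^sup>2 \<le> 512 * (real N)\<^sup>2 * R\<^sup>2 * exp (- t\<^sup>2) + 2 * K\<^sup>2 * real N * (T powr a)\<^sup>2 * (m t)\<^sup>2" by simp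
    qed
    also have "\<dots> = 512 * (real N)\<^sup>2 * R\<^sup>2 * integral {0..T} (\<lambda>t. exp (- t\<^sup>2)) + 2 * K\<^sup>2 * real N * (T powr a)\<^sup>2 * integral {0..T} (\<lambda>t. (m t)\<^sup>2)"
      by (subst integral_add) (auto intro!: integrable_continuous_real continuous_intros cont)
    also have "\<dots> \<le> 512 * (real N)\<^sup>2 * R\<^sup>2 * 2 + 2 * K\<^sup>2 * real N * (T powr a)\<^sup>2 * (1640 * T * R)"
      using gauss_integral_le[of T] mean_square_M_le[OF adm] T unfolding m_def R_def
      by (intro add_mono mult_left_mono) auto
    also have "\<dots> \<le> 1024 * ((real N)\<^sup>2 * R\<^sup>2) + 3280 * K\<^sup>2 * ((real N * T) powr \<eta> * (real N * R * T))"
    proof -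
      have "(T powr a)\<^sup>2 = T powr (2 * a)" using T by (simp add: power2_eq_square powr_add[symmetric])
      also have "\<dots> \<le> T powr \<eta>" using a T by (intro powr_mono) auto
      also have "\<dots> \<le> (real N * T) powr \<eta>" using T N eta by (intro powr_mono2) auto
      finally have "(T powr a)\<^sup>2 * (real N * R * T) \<le> (real N * T) powr \<eta> * (real N * R * T)"
        using R0 T by (intro mult_right_mono) auto
      then have "3280 * K\<^sup>2 * ((T powr a)\<^sup>2 * (real N * R * T)) \<le> 3280 * K\<^sup>2 * ((real N * T) powr \<eta> * (real N * R * T))"
        by (intro mult_left_mono) auto
      then show ?thesis by (simp add: mult_ac)
    qed
    finally have "T * pair_count T M N \<le> 32 * (1024 * ((real N)\<^sup>2 * R\<^sup>2) + 3280 * K\<^sup>2 * ((real N * T) powr \<eta> * (real N * R * T)))"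
      by simp
    then have "40 * (T * pair_count T M N) \<le> 40 * (32 * (1024 * ((real N)\<^sup>2 * R\<^sup>2) + 3280 * K\<^sup>2 * ((real N * T) powr \<eta> * (real N * R * T))))"
      by (intro mult_left_mono) auto
    also have "\<dots> = 1280 * (1024 * ((real N)\<^sup>2 * R\<^sup>2) + 3280 * K\<^sup>2 * ((real N * T) powr \<eta> * (real N * R * T)))" by simp
    also have "\<dots> \<le> 1280 * ((1024 + 3280 * K\<^sup>2) * ((real N)\<^sup>2 * R\<^sup>2) + (1024 + 3280 * K\<^sup>2) * ((real N * T) powr \<eta> * (real N * R * T)))"
      using R0 T by (intro mult_left_mono add_mono mult_right_mono) auto
    also have "\<dots> = C * ((real N)\<^sup>2 * R\<^sup>2 + (real N * T) powr \<eta> * (real N * R * T))"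
      by (simp add: C_def algebra_simps)
    finally have fin': "40 * (T * pair_count T M N) \<le> C * ((real N)\<^sup>2 * R\<^sup>2 + (real N * T) powr \<eta> * (real N * R * T))" .
    have "mean_I T M \<epsilon> (Qpoly N q) \<le> 40 * (T * pair_count T M N)"
      using mean_I_le_pair_count[OF adm q] by (simp only: mult.assoc)
    also note fin'
    finally show "mean_I T M \<epsilon> (Qpoly N q) \<le>
           C * ((real N)\<^sup>2 * (real (card M))\<^sup>2
                + (real N * T) powr \<eta> * (real N * real (card M) * T))" unfolding R_def .
  qed
qed

theorem theorem4:
  shows
    "(\<exists>C>0. \<forall>T M \<epsilon> N q. admissible_set T M \<epsilon> \<and> admissible_coeffs N q \<longrightarrow>
        mean_I T M \<epsilon> (Qpoly N q) \<le> C * (T * count_J T M N q))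
   \<and> (\<exists>C>0. \<forall>T M \<epsilon> N q. admissible_set T M \<epsilon> \<and> admissible_coeffs N q \<and> (\<forall>m\<in>M. \<epsilon> m = 1) \<longrightarrow>
        mean_I T M \<epsilon> (Qpoly N q) \<le> C * (T * count_J T M N q) \<and>
        T * count_J T M N q \<le> C * mean_I T M \<epsilon> (Qpoly N q))
   \<and> (lindelof_hypothesis \<longrightarrow>
       (\<forall>\<eta>>0. \<exists>C>0. \<forall>T M \<epsilon> N q. admissible_set T M \<epsilon> \<and> admissible_coeffs N q \<longrightarrow>
         mean_I T M \<epsilon> (Qpoly N q) \<le>
           C * ((real N)\<^sup>2 * (real (card M))\<^sup>2
                + (real N * T) powr \<eta> * (real N * real (card M) * T))))
   \<and> (\<forall>\<eta>>0. \<exists>C>0. \<forall>T M \<epsilon> N q. admissible_set T M \<epsilon> \<and> admissible_coeffs N q \<longrightarrow>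
        mean_I T M \<epsilon> (Qpoly N q) \<le>
          C * ((real N)\<^sup>2 * (real (card M))\<^sup>2
               + (real N * T) powr \<eta> * (real N * real (card M) * T
                   + real N * real (card M) powr (7 / 4) * T powr (3 / 4))))
   \<and> (\<forall>\<eta>>0. \<exists>C>0. \<forall>T M \<epsilon> N q. admissible_set T M \<epsilon> \<and> admissible_coeffs N q \<and>
        (real N \<ge> T powr (2 / 3) \<or> real (card M) \<le> T powr (1 / 3)) \<longrightarrow>
        mean_I T M \<epsilon> (Qpoly N q) \<le>
          C * ((real N)\<^sup>2 * (real (card M))\<^sup>2
               + (real N * T) powr \<eta> * (real N * real (card M) * T)))
   \<and> (\<forall>k::nat. k > 0 \<longrightarrow> (\<exists>C>0. \<forall>T M \<epsilon> N. admissible_set T M \<epsilon> \<and> 0 < N \<longrightarrow>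
        mean_I T M \<epsilon> (prime_Qpoly N k) \<le>
          C * ((real N)\<^sup>2 * (real (card M))\<^sup>2 + (real (card M))\<^sup>2 * T
               + real N * real (card M) * T)))"
proof (intro conjI allI impI)
  show "\<exists>C>0. \<forall>T M \<epsilon> N q. admissible_set T M \<epsilon> \<and> admissible_coeffs N q \<longrightarrow>
      mean_I T M \<epsilon> (Qpoly N q) \<le> C * (T * count_J T M N q)"
    by (rule exI[of _ 40]) (use mean_I_le_count_J in auto)
  show "\<exists>C>0. \<forall>T M \<epsilon> N q. admissible_set T M \<epsilon> \<and> admissible_coeffs N q \<and> (\<forall>m\<in>M. \<epsilon> m = 1) \<longrightarrow>
      mean_I T M \<epsilon> (Qpoly N q) \<le> C * (T * count_J T M N q) \<and>
      T * count_J T M N q \<le> C * mean_I T M \<epsilon> (Qpoly N q)"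
  proof (intro exI[of _ 40] conjI allI impI)
    fix T M \<epsilon> N q
    assume asm: "admissible_set T M \<epsilon> \<and> admissible_coeffs N q \<and> (\<forall>m\<in>M. \<epsilon> m = 1)"
    show "mean_I T M \<epsilon> (Qpoly N q) \<le> 40 * (T * count_J T M N q)"
      using asm mean_I_le_count_J by blast
    have "0 \<le> mean_I T M \<epsilon> (Qpoly N q)"
      unfolding mean_I_def by (cases "(\<lambda>t. (cmod (dirichlet_poly M \<epsilon> (\<i> * of_real t) * Qpoly N q (\<i> * of_real t)))\<^sup>2) integrable_on {0..T}")
         (auto intro: integral_nonneg simp: not_integrable_integral)
    then show "T * count_J T M N q \<le> 40 * mean_I T M \<epsilon> (Qpoly N q)"
      using asm count_J_le_mean_I[of T M \<epsilon> N q] by linarith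
  qed simp
qed (use mean_I_lindelof mean_I_unconditional mean_I_extreme_ranges mean_I_prime_power in blast)+

end
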